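(* Let $p>1$ and $E>0$. There exists a function $c_{E,p}:\mathbb{R}^+\to\mathbb{R}^+$, depending only on $E$ and $p$, with $c_{E,p}(T)\to 0$ as $T\to\infty$, such that for every finite energy solution $u:\mathbb{R}\times\mathbb{R}\to\mathbb{R}$ of $-u_{tt}+u_{xx}=|u|^{p-1}u$ with energy $E[u]\le E$ one has $$\frac{1}{2T}\int_{t_0-T}^{t_0+T}\|u(t)\|_{L^\infty_x(\mathbb{R})}\,dt\le c_{E,p}(T)\qquad\text{for all } t_0\in\mathbb{R},\ T>0.$$ In particular, for every such $u$, $$\lim_{T\to+\infty}\ \sup_{t_0\in\mathbb{R}}\ \frac{1}{2T}\int_{t_0-T}^{t_0+T}\|u(t)\|_{L^\infty_x(\mathbb{R})}\,dt=0.$$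
   Context: Here $u=u(t,x)$ with $t,x\in\mathbb{R}$, and $u(t)$ denotes the function $x\mapsto u(t,x)$. A finite energy solution is a global solution $u$ of $-u_{tt}+u_{xx}=|u|^{p-1}u$ in the energy class, i.e. $u\in C(\mathbb{R};H^1_x(\mathbb{R}))\cap C^1(\mathbb{R};L^2_x(\mathbb{R}))$, with the equation holding in the sense of distributions (equivalently, the unique global solution with initial data satisfying $\|u(0)\|_{H^1_x(\mathbb{R})}+\|u_t(0)\|_{L^2_x(\mathbb{R})}<\infty$). Its energy $$E[u]=\int_{\mathbb{R}}\Big(\tfrac12u_t(t,x)^2+\tfrac12u_x(t,x)^2+\tfrac1{p+1}|u(t,x)|^{p+1}\Big)\,dx$$ is independent of $t$. *)

theory Defs
  imports "HOL-Analysis.Analysis" "HOL-Probability.Essential_Supremum"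
begin

definition dir_deriv :: "'a::euclidean_space \<Rightarrow> ('a \<Rightarrow> real) \<Rightarrow> 'a \<Rightarrow> real" where
  "dir_deriv v f z = frechet_derivative f (at z) v"

primrec C_k :: "nat \<Rightarrow> ('a::euclidean_space \<Rightarrow> real) \<Rightarrow> bool" where
  "C_k 0 f \<longleftrightarrow> continuous_on UNIV f"
| "C_k (Suc k) f \<longleftrightarrow> (\<forall>z. f differentiable (at z)) \<and> (\<forall>b\<in>Basis. C_k k (dir_deriv b f))"

definition test_function :: "('a::euclidean_space \<Rightarrow> real) \<Rightarrow> bool" where
  "test_function \<phi> \<longleftrightarrow> (\<forall>k. C_k k \<phi>) \<and> compact (closure {z. \<phi> z \<noteq> 0})"

text \<open>Elements of $L^2(\mathbb{R})$ and $H^1(\mathbb{R})$ are handled through arbitrary Borel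
  representatives; every notion below that is applied to a function class depends only on the
  almost everywhere class.\<close>

definition in_L2 :: "(real \<Rightarrow> real) \<Rightarrow> bool" where
  "in_L2 f \<longleftrightarrow> f \<in> borel_measurable lborel \<and> integrable lborel (\<lambda>x. (f x)\<^sup>2)"

definition norm_L2 :: "(real \<Rightarrow> real) \<Rightarrow> real" where
  "norm_L2 f = sqrt (LINT x|lborel. (f x)\<^sup>2)"

definition norm_Linf :: "(real \<Rightarrow> real) \<Rightarrow> ennreal" where
  "norm_Linf f = esssup lborel (\<lambda>x. ennreal \<bar>f x\<bar>)"

definition has_weak_deriv_L2 :: "(real \<Rightarrow> real) \<Rightarrow> (real \<Rightarrow> real) \<Rightarrow> bool" where
  "has_weak_deriv_L2 f g \<longleftrightarrow> in_L2 g \<and>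
     (\<forall>\<phi>. test_function \<phi> \<longrightarrow>
        (LINT x|lborel. f x * deriv \<phi> x) = - (LINT x|lborel. g x * \<phi> x))"

definition in_H1 :: "(real \<Rightarrow> real) \<Rightarrow> bool" where
  "in_H1 f \<longleftrightarrow> in_L2 f \<and> (\<exists>g. has_weak_deriv_L2 f g)"

text \<open>Any two weak derivatives agree almost everywhere, so the choice of representative is
  immaterial in norms and integrals. The same applies to \<open>time_deriv\<close> below.\<close>

definition weak_deriv :: "(real \<Rightarrow> real) \<Rightarrow> real \<Rightarrow> real" where
  "weak_deriv f = (SOME g. has_weak_deriv_L2 f g)"

definition norm_H1 :: "(real \<Rightarrow> real) \<Rightarrow> real" where
  "norm_H1 f = sqrt ((norm_L2 f)\<^sup>2 + (norm_L2 (weak_deriv f))\<^sup>2)"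

text \<open>Functions of time and space are curried: \<open>u t\<close> is the spatial profile at time \<open>t\<close>.\<close>

definition continuous_H1 :: "(real \<Rightarrow> real \<Rightarrow> real) \<Rightarrow> bool" where
  "continuous_H1 u \<longleftrightarrow> (\<forall>t. in_H1 (u t)) \<and>
     (\<forall>t. ((\<lambda>s. norm_H1 (\<lambda>x. u s x - u t x)) \<longlongrightarrow> 0) (at t))"

definition continuous_L2 :: "(real \<Rightarrow> real \<Rightarrow> real) \<Rightarrow> bool" where
  "continuous_L2 u \<longleftrightarrow> (\<forall>t. in_L2 (u t)) \<and>
     (\<forall>t. ((\<lambda>s. norm_L2 (\<lambda>x. u s x - u t x)) \<longlongrightarrow> 0) (at t))"

text \<open>Derivative of the curve \<open>u\<close> in the norm of $L^2(\mathbb{R})$.\<close>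

definition has_time_deriv :: "(real \<Rightarrow> real \<Rightarrow> real) \<Rightarrow> (real \<Rightarrow> real) \<Rightarrow> real \<Rightarrow> bool" where
  "has_time_deriv u w t \<longleftrightarrow> in_L2 w \<and>
     ((\<lambda>h. norm_L2 (\<lambda>x. (u (t + h) x - u t x) / h - w x)) \<longlongrightarrow> 0) (at 0)"

definition time_deriv :: "(real \<Rightarrow> real \<Rightarrow> real) \<Rightarrow> real \<Rightarrow> real \<Rightarrow> real" where
  "time_deriv u t = (SOME w. has_time_deriv u w t)"

definition C1_L2 :: "(real \<Rightarrow> real \<Rightarrow> real) \<Rightarrow> bool" where
  "C1_L2 u \<longleftrightarrow> (\<forall>t. in_L2 (u t)) \<and> (\<forall>t. \<exists>w. has_time_deriv u w t) \<and>
     continuous_L2 (time_deriv u)"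

text \<open>The equation \<open>- u\<^sub>t\<^sub>t + u\<^sub>x\<^sub>x = |u|\<^bsup>p-1\<^esup> u\<close> tested against \<open>\<phi>\<close>, with points of the plane
  written \<open>(t, x)\<close>. A curve \<open>u\<close> in $L^2(\mathbb{R})$ acts as a distribution on the plane by
  pairing in \<open>x\<close> first and then integrating in \<open>t\<close>; the iterated integral makes this independent
  of the representatives chosen for the individual \<open>u t\<close>, so that no joint measurability of these
  representatives is needed.\<close>

definition weak_wave_equation :: "real \<Rightarrow> (real \<Rightarrow> real \<Rightarrow> real) \<Rightarrow> bool" where
  "weak_wave_equation p u \<longleftrightarrow>
     (\<forall>\<phi> :: real \<times> real \<Rightarrow> real. test_function \<phi> \<longrightarrow>
        (LINT t|lborel. LINT x|lborel.
           u t x * (- dir_deriv (1, 0) (dir_deriv (1, 0) \<phi>) (t, x)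
                    + dir_deriv (0, 1) (dir_deriv (0, 1) \<phi>) (t, x)))
      = (LINT t|lborel. LINT x|lborel. \<bar>u t x\<bar> powr (p - 1) * u t x * \<phi> (t, x)))"

definition finite_energy_solution :: "real \<Rightarrow> (real \<Rightarrow> real \<Rightarrow> real) \<Rightarrow> bool" where
  "finite_energy_solution p u \<longleftrightarrow> continuous_H1 u \<and> C1_L2 u \<and> weak_wave_equation p u"

text \<open>The energy at time \<open>t\<close>; it is conserved by finite energy solutions.\<close>

definition energy :: "real \<Rightarrow> (real \<Rightarrow> real \<Rightarrow> real) \<Rightarrow> real \<Rightarrow> real" where
  "energy p u t = (LINT x|lborel.
      1/2 * (time_deriv u t x)\<^sup>2 + 1/2 * (weak_deriv (u t) x)\<^sup>2
      + 1 / (p + 1) * \<bar>u t x\<bar> powr (p + 1))"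

definition avg_Linf :: "(real \<Rightarrow> real \<Rightarrow> real) \<Rightarrow> real \<Rightarrow> real \<Rightarrow> ennreal" where
  "avg_Linf u t0 T =
     (\<integral>\<^sup>+t\<in>{t0 - T..t0 + T}. norm_Linf (u t) \<partial>lborel) / ennreal (2 * T)"

end

theory Submission
  imports Defs "HOL-Probability.Sinc_Integral"
begin

text \<open>
  Write $W_\pm = u_t \pm u_x$ for the null derivatives and $V = |u|^{p+1}/(p+1)$ for the
  potential energy density. The theorem says that no lump of energy survives: a solution whose
  supremum stays above $\delta$ on a positive proportion of a long time interval would carry a
  fixed amount of potential energy in a small interval around a moving point. For a lump
  travelling with constant velocity the contradiction is classical. Conservation of energy and
  momentum forces the local averages $A$, $B$, $N$ of $W_+^2/2$, $W_-^2/2$, $V$ to satisfy $AB =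
  N^2$, whereas the virial identity (multiply the equation by $u$) forces the average of $W_+
  W_-$ to be $(p+1) N$, and by Cauchy-Schwarz $AB \ge ((p+1)/2)^2 N^2$. For $p > 1$ both are
  possible only if $N = 0$.

  The proof turns this into an integral estimate in which neither a trajectory nor a velocity of
  the lump occurs. The conservation laws read $\partial_t (W_\pm^2/2 + V) = \pm \partial_x
  (W_\pm^2/2 - V)$. Let $A$, $B$, $N$ now be averages over windows of size $R$ in space and in
  time, as functions of the position of the window. Each conservation law has a potential: there
  are bounded functions $P$, $Q$ of $(t, z)$ with $P_t = A - N$, $P_z = A + N$, $Q_t = N - B$,
  $Q_z = N + B$, and
  \[ dP \wedge dQ = 2 (AB - N^2) \, dt \wedge dz. \]
  Green's theorem bounds the integral of $AB - N^2$ over $[s, t] \times \mathbb{R}$ by a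
  constant that is independent of $t - s$ (\<open>interaction_identity\<close>). The virial
  identity holds on each window up to an error $O(\sqrt R)$, which is small compared with the
  size $R$ of a window (\<open>virial_window\<close>), so $2 (AB - N^2)$ is at least a positive
  multiple of $N^2$ up to this error (\<open>potD_window_coercive\<close>). Hence $N$ is small
  in $L^2$ of long space-time strips (\<open>potD_window_square\<close>). Because $V$ alone may
  oscillate in time, the average over time in $N$ is removed with the help of the energy in the
  window, which varies slowly (\<open>energyD_growth\<close>, \<open>massL2_bound\<close>). A
  value of $|u|$ above $\delta$ forces potential energy nearby, since the energy makes $u$
  Hoelder continuous in $x$ (\<open>mass_near\<close>); comparing with the $L^2$ bound gives
  $\delta + C/\rho$ as a bound for the mean of the supremum, with windows of size $R = \rho^4$
  and times $T \ge \rho^6$ (\<open>avg_Linf_decay\<close>). All constants depend on $p$, $E$ and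
  $\delta$ only, so the supremum over all solutions of energy at most $E$ tends to zero.

  The conservation laws have to be justified in the energy class, where $u_{tt}$ and $u_{xx}$
  are mere distributions. Tested with functions of the form $\theta(t) \rho(x \pm t)$, the weak
  equation becomes a transport equation for $W_\pm$ with a continuous source
  (\<open>finite_energy_solution_wave_flow\<close>). In the frame that moves with the
  characteristics $W_\pm$ is then a differentiable curve in $L^2$. Moreover, continuity in time,
  read along the characteristics, gives continuity of $W_\pm$ under translations, and this makes
  $u$ differentiable in $L^2$ in either moving frame (\<open>U_frame_deriv\<close>). The
  conservation laws and the virial identity follow by the product rule
  (\<open>null_energy_conservation\<close>, \<open>virial_identity\<close>).
\<close>

section \<open>Test functions\<close>

lemma C_k_const: "C_k k (\<lambda>z. c)"
proof (induction k arbitrary: c)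
  case (Suc k)
  have "dir_deriv b (\<lambda>z. c) = (\<lambda>z. 0)" for b :: 'a
    by (auto simp: dir_deriv_def frechet_derivative_const)
  then show ?case using Suc by simp
qed auto

lemma C_k_Suc_imp: "C_k (Suc k) f \<Longrightarrow> C_k k f"
proof (induction k arbitrary: f)
  case 0
  then show ?case
    by (auto simp: continuous_on_eq_continuous_at intro: differentiable_imp_continuous_within)
qed auto

lemma C_k_add: "C_k k f \<Longrightarrow> C_k k g \<Longrightarrow> C_k k (\<lambda>z. f z + g z)"
proof (induction k arbitrary: f g)
  case 0 then show ?case by (auto intro: continuous_intros)
next
  case (Suc k)
  have "dir_deriv b (\<lambda>z. f z + g z) = (\<lambda>z. dir_deriv b f z + dir_deriv b g z)" for b
  proof
    fix z
    have "((\<lambda>z. f z + g z) has_derivative (\<lambda>h. frechet_derivative f (at z) h + frechet_derivative g (at z) h)) (at z)"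
      using Suc.prems by (intro has_derivative_add) (auto simp: frechet_derivative_works[symmetric])
    from frechet_derivative_at[OF this] show "dir_deriv b (\<lambda>z. f z + g z) z = dir_deriv b f z + dir_deriv b g z"
      unfolding dir_deriv_def by metis
  qed
  with Suc show ?case by auto
qed

lemma C_k_mult: "C_k k f \<Longrightarrow> C_k k g \<Longrightarrow> C_k k (\<lambda>z. f z * g z)"
proof (induction k arbitrary: f g)
  case 0 then show ?case by (auto intro: continuous_intros)
next
  case (Suc k)
  have d: "dir_deriv b (\<lambda>z. f z * g z) = (\<lambda>z. f z * dir_deriv b g z + dir_deriv b f z * g z)" for b
  proof
    fix z
    have "((\<lambda>z. f z * g z) has_derivative (\<lambda>h. f z * frechet_derivative g (at z) h + frechet_derivative f (at z) h * g z)) (at z)"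
      using Suc.prems by (intro has_derivative_mult) (auto simp: frechet_derivative_works[symmetric])
    from frechet_derivative_at[OF this] show "dir_deriv b (\<lambda>z. f z * g z) z = f z * dir_deriv b g z + dir_deriv b f z * g z"
      unfolding dir_deriv_def by metis
  qed
  have "C_k k f" "C_k k g" using C_k_Suc_imp Suc.prems by blast+
  with Suc show ?case by (auto simp: d intro!: C_k_add)
qed

lemma C_k_cmult: "C_k k f \<Longrightarrow> C_k k (\<lambda>z. c * f z)"
  by (intro C_k_mult C_k_const)

lemma dir_deriv_real_eq:
  assumes "(f has_real_derivative d) (at x)" shows "dir_deriv h f x = h * d"
proof -
  have "(f has_derivative (\<lambda>h. d * h)) (at x)" using assms by (simp add: has_field_derivative_def)
  from frechet_derivative_at[OF this] show ?thesis unfolding dir_deriv_def by (metis mult.commute)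
qed

lemma C_k_Suc_real:
  assumes "\<And>x. (f has_real_derivative f' x) (at x)" "C_k k f'"
  shows "C_k (Suc k) f"
proof -
  have "dir_deriv 1 f = f'" using dir_deriv_real_eq[OF assms(1)] by auto
  with assms show ?thesis by (auto simp: real_differentiable_def)
qed

lemma C_k_Suc_realD:
  assumes "C_k (Suc k) f"
  shows "(f has_real_derivative deriv f x) (at x)" "C_k k (deriv f)"
proof -
  have *: "(f has_real_derivative deriv f x) (at x)" for x
    using assms DERIV_deriv_iff_real_differentiable by auto
  then show "(f has_real_derivative deriv f x) (at x)" .
  have "dir_deriv 1 f = deriv f" using dir_deriv_real_eq[OF *] by auto
  with assms show "C_k k (deriv f)" by auto
qed

text \<open>The test functions on the plane used below are products of two functions of one variable, each
  pulled back along an affine functional.\<close>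

lemma dir_deriv_pullback:
  fixes l :: "'a::euclidean_space \<Rightarrow> real"
  assumes "bounded_linear l" "(f has_real_derivative f' (l z + c)) (at (l z + c))"
  shows "dir_deriv b (\<lambda>z. f (l z + c)) z = l b * f' (l z + c)"
    and "(\<lambda>z. f (l z + c)) differentiable (at z)"
proof -
  have "((\<lambda>z. l z + c) has_derivative l) (at z)"
    using bounded_linear_imp_has_derivative[OF assms(1)] by (auto intro!: derivative_eq_intros)
  from has_derivative_compose[OF this assms(2)[unfolded has_field_derivative_def]]
  have *: "((\<lambda>z. f (l z + c)) has_derivative (\<lambda>h. f' (l z + c) * l h)) (at z)" .
  from frechet_derivative_at[OF this] show "dir_deriv b (\<lambda>z. f (l z + c)) z = l b * f' (l z + c)"
    unfolding dir_deriv_def by (metis mult.commute)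
  from * show "(\<lambda>z. f (l z + c)) differentiable (at z)" by (auto simp: differentiable_def)
qed

lemma C_k_pullback:
  fixes l :: "'a::euclidean_space \<Rightarrow> real"
  assumes "bounded_linear l"
  shows "C_k k f \<Longrightarrow> C_k k (\<lambda>z. f (l z + c))"
proof (induction k arbitrary: f)
  case 0
  have "continuous_on UNIV l" using assms linear_continuous_on by blast
  with 0 show ?case by (auto intro!: continuous_on_compose2[of UNIV f] continuous_intros)
next
  case (Suc k)
  note D = C_k_Suc_realD[OF Suc.prems]
  have "dir_deriv b (\<lambda>z. f (l z + c)) = (\<lambda>z. l b * deriv f (l z + c))" for b
    using dir_deriv_pullback(1)[where f=f and f'="deriv f", OF assms D(1)] by auto
  with Suc.IH[OF D(2)] dir_deriv_pullback(2)[where f=f and f'="deriv f", OF assms D(1)] show ?case by (auto intro!: C_k_cmult)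
qed

lemma test_functionD:
  fixes \<rho> :: "real \<Rightarrow> real"
  assumes "test_function \<rho>"
  shows "(\<rho> has_real_derivative deriv \<rho> x) (at x)" "test_function (deriv \<rho>)"
    "continuous_on A \<rho>" "\<exists>A>0. \<forall>x. \<rho> x \<noteq> 0 \<longrightarrow> \<bar>x\<bar> < A" "\<exists>B>0. \<forall>x. \<bar>\<rho> x\<bar> \<le> B"
proof -
  have C: "C_k k \<rho>" for k using assms test_function_def by blast
  show D: "(\<rho> has_real_derivative deriv \<rho> x) (at x)" for x using C_k_Suc_realD(1)[OF C] .
  have CD: "C_k k (deriv \<rho>)" for k using C_k_Suc_realD(2)[OF C] .
  have cmp: "compact (closure {z. \<rho> z \<noteq> 0})" using assms test_function_def by blast
  have "{z. deriv \<rho> z \<noteq> 0} \<subseteq> closure {z. \<rho> z \<noteq> 0}"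
  proof
    fix z assume z: "z \<in> {z. deriv \<rho> z \<noteq> 0}"
    show "z \<in> closure {z. \<rho> z \<noteq> 0}"
    proof (rule ccontr)
      assume "z \<notin> closure {z. \<rho> z \<noteq> 0}"
      then have "\<forall>\<^sub>F y in nhds z. y \<in> - closure {z. \<rho> z \<noteq> 0}"
        by (intro eventually_nhds_in_open open_Compl closed_closure) simp
      then have "\<forall>\<^sub>F y in nhds z. \<rho> y = 0"
      proof (rule eventually_mono)
        fix y assume y: "y \<in> - closure {z. \<rho> z \<noteq> 0}"
        show "\<rho> y = 0"
        proof (rule ccontr)
          assume "\<rho> y \<noteq> 0"
          then have "y \<in> closure {z. \<rho> z \<noteq> 0}" by (intro subsetD[OF closure_subset]) simp
          with y show False by simp
        qed
      qed
      then have "deriv \<rho> z = deriv (\<lambda>_. 0) z" by (intro deriv_cong_ev) auto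
      with z show False by simp
    qed
  qed
  then have "closure {z. deriv \<rho> z \<noteq> 0} \<subseteq> closure {z. \<rho> z \<noteq> 0}"
    by (metis closure_closure closure_mono)
  then have "compact (closure {z. deriv \<rho> z \<noteq> 0})"
    using cmp by (metis closed_closure closed_Int_compact inf.absorb_iff2 inf.commute)
  then show "test_function (deriv \<rho>)" using CD test_function_def by blast
  have cont: "continuous_on UNIV \<rho>" using C[of 0] by simp
  then show "continuous_on A \<rho>" by (rule continuous_on_subset) auto
  obtain A where A: "A > 0" "\<And>x. x \<in> closure {z. \<rho> z \<noteq> 0} \<Longrightarrow> norm x < A"
    using compact_imp_bounded[OF cmp] bounded_pos_less by metis
  have A': "\<bar>x\<bar> < A" if "\<rho> x \<noteq> 0" for x
  proof -
    have "x \<in> closure {z. \<rho> z \<noteq> 0}" using that by (intro subsetD[OF closure_subset]) simp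
    from A(2)[OF this] show ?thesis by simp
  qed
  with A(1) show "\<exists>A>0. \<forall>x. \<rho> x \<noteq> 0 \<longrightarrow> \<bar>x\<bar> < A" by blast
  have "bounded (\<rho> ` {-A..A})"
    by (intro compact_imp_bounded compact_continuous_image continuous_on_subset[OF cont]) auto
  then obtain B where B: "B > 0" "\<And>x. x \<in> {-A..A} \<Longrightarrow> \<bar>\<rho> x\<bar> \<le> B"
    unfolding bounded_pos by auto
  have "\<bar>\<rho> x\<bar> \<le> B" for x using A'[of x] B(1) B(2)[of x] by (cases "\<rho> x = 0") (auto simp: abs_less_iff)
  then show "\<exists>B>0. \<forall>x. \<bar>\<rho> x\<bar> \<le> B" using B by auto
qed

lemma test_functionI:
  fixes f :: "'a::euclidean_space \<Rightarrow> real"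
  assumes "\<And>k. C_k k f" "\<And>z. f z \<noteq> 0 \<Longrightarrow> norm z \<le> A"
  shows "test_function f"
proof -
  have "bounded {z. f z \<noteq> 0}" using assms(2) bounded_iff by blast
  then show ?thesis using assms(1) by (auto simp: test_function_def intro: compact_closure[THEN iffD2])
qed

text \<open>For \<open>\<sigma> = \<plusminus>1\<close> the factor \<open>\<rho>\<close> is constant along the characteristics \<open>x + \<sigma>t = const\<close>, and \<open>\<theta>\<close>
  localises in time.\<close>

lemma test_function_sheared:
  fixes \<theta> \<rho> :: "real \<Rightarrow> real" and \<sigma> :: real
  assumes "test_function \<theta>" "test_function \<rho>"
  shows "test_function (\<lambda>z::real\<times>real. \<theta> (fst z) * \<rho> (snd z + \<sigma> * fst z))"
proof -
  obtain A where A: "A>0" "\<And>x. \<theta> x \<noteq> 0 \<Longrightarrow> \<bar>x\<bar> < A" using test_functionD(4)[OF assms(1)] by auto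
  obtain B where B: "B>0" "\<And>x. \<rho> x \<noteq> 0 \<Longrightarrow> \<bar>x\<bar> < B" using test_functionD(4)[OF assms(2)] by auto
  have 1: "C_k k (\<lambda>z::real\<times>real. \<theta> (fst z + 0))" for k
    using assms by (intro C_k_pullback bounded_linear_fst) (auto simp: test_function_def)
  have 2: "C_k k (\<lambda>z::real\<times>real. \<rho> ((snd z + \<sigma> * fst z) + 0))" for k
    using assms by (intro C_k_pullback) 
      (auto simp: test_function_def intro!: bounded_linear_add bounded_linear_snd bounded_linear_fst
         bounded_linear_compose[OF bounded_linear_mult_right])
  show ?thesis
  proof (rule test_functionI[where A="A + (B + \<bar>\<sigma>\<bar> * A)"])
    show "C_k k (\<lambda>z::real\<times>real. \<theta> (fst z) * \<rho> (snd z + \<sigma> * fst z))" for k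
      using C_k_mult[OF 1 2] by simp
    fix z :: "real\<times>real" assume "\<theta> (fst z) * \<rho> (snd z + \<sigma> * fst z) \<noteq> 0"
    then have *: "\<bar>fst z\<bar> < A" "\<bar>snd z + \<sigma> * fst z\<bar> < B" using A B by auto
    then have "\<bar>\<sigma> * fst z\<bar> \<le> \<bar>\<sigma>\<bar> * A" by (simp add: abs_mult mult_left_mono)
    with * have "\<bar>fst z\<bar> + \<bar>snd z\<bar> \<le> A + (B + \<bar>\<sigma>\<bar> * A)" by linarith
    moreover have "norm z \<le> \<bar>fst z\<bar> + \<bar>snd z\<bar>" using norm_Pair_le[of "fst z" "snd z"] by simp
    ultimately show "norm z \<le> A + (B + \<bar>\<sigma>\<bar> * A)" by linarith
  qed
qed

lemma dir_deriv_sheared: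
  fixes \<theta> \<rho> :: "real \<Rightarrow> real" and \<sigma> :: real
  assumes "test_function \<theta>" "test_function \<rho>"
  defines "\<phi> \<equiv> (\<lambda>z::real\<times>real. \<theta> (fst z) * \<rho> (snd z + \<sigma> * fst z))"
  shows "dir_deriv (a, b) \<phi> = (\<lambda>z. a * (deriv \<theta> (fst z) * \<rho> (snd z + \<sigma> * fst z)) 
            + (b + \<sigma> * a) * (\<theta> (fst z) * deriv \<rho> (snd z + \<sigma> * fst z)))"
    and "\<phi> differentiable (at z)"
proof -
  have *: "(\<phi> has_derivative (\<lambda>h. fst h * (deriv \<theta> (fst z) * \<rho> (snd z + \<sigma> * fst z)) 
            + (snd h + \<sigma> * fst h) * (\<theta> (fst z) * deriv \<rho> (snd z + \<sigma> * fst z)))) (at z)" for z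
  proof -
    have t: "((\<lambda>z. \<theta> (fst z)) has_derivative (\<lambda>h. deriv \<theta> (fst z) * fst h)) (at z)"
      using test_functionD(1)[OF assms(1)] unfolding has_field_derivative_def
      using has_derivative_compose[OF has_derivative_fst[OF has_derivative_ident]] by blast
    have r: "((\<lambda>z. \<rho> (snd z + \<sigma> * fst z)) has_derivative (\<lambda>h. deriv \<rho> (snd z + \<sigma> * fst z) * (snd h + \<sigma> * fst h))) (at z)"
      using test_functionD(1)[OF assms(2)] unfolding has_field_derivative_def
      by (rule has_derivative_compose[rotated]) (auto intro!: derivative_eq_intros)
    show ?thesis unfolding \<phi>_def
      by (rule has_derivative_eq_rhs[OF has_derivative_mult[OF t r]]) (auto simp: algebra_simps)
  qed
  from frechet_derivative_at[OF *] show "dir_deriv (a, b) \<phi> = (\<lambda>z. a * (deriv \<theta> (fst z) * \<rho> (snd z + \<sigma> * fst z)) 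
            + (b + \<sigma> * a) * (\<theta> (fst z) * deriv \<rho> (snd z + \<sigma> * fst z)))"
    by (simp add: dir_deriv_def fun_eq_iff * [THEN frechet_derivative_at, symmetric])
  from *[of z] show "\<phi> differentiable (at z)" unfolding differentiable_def by blast
qed

lemma dir_deriv_lincomb:
  assumes "f differentiable (at z)" "g differentiable (at z)"
  shows "dir_deriv v (\<lambda>z. a * f z + b * g z) z = a * dir_deriv v f z + b * dir_deriv v g z"
proof -
  have "((\<lambda>z. a * f z + b * g z) has_derivative (\<lambda>h. a * frechet_derivative f (at z) h + b * frechet_derivative g (at z) h)) (at z)"
    using assms by (intro derivative_intros) (auto simp: frechet_derivative_works[symmetric])
  from frechet_derivative_at[OF this] show ?thesis unfolding dir_deriv_def by metis
qed

text \<open>The wave operator is a product of derivatives along the two families of characteristics, and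
  one of them annihilates \<open>\<rho>(x + \<sigma>t)\<close>. Hence no term with two derivatives on
  \<open>\<rho>\<close> survives.\<close>

lemma wave_operator_sheared:
  fixes \<theta> \<rho> :: "real \<Rightarrow> real" and \<sigma> :: real
  assumes "test_function \<theta>" "test_function \<rho>" "\<sigma>\<^sup>2 = 1"
  defines "\<phi> \<equiv> (\<lambda>z::real\<times>real. \<theta> (fst z) * \<rho> (snd z + \<sigma> * fst z))"
  shows "- dir_deriv (1, 0) (dir_deriv (1, 0) \<phi>) (t, x) + dir_deriv (0, 1) (dir_deriv (0, 1) \<phi>) (t, x)
     = - deriv (deriv \<theta>) t * \<rho> (x + \<sigma> * t) - 2 * \<sigma> * (deriv \<theta> t * deriv \<rho> (x + \<sigma> * t))"
proof -
  note T = assms(1,2) assms(1,2)[THEN test_functionD(2)]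
  have D: "dir_deriv (a, b) \<phi> = (\<lambda>z. a * (deriv \<theta> (fst z) * \<rho> (snd z + \<sigma> * fst z)) 
            + (b + \<sigma> * a) * (\<theta> (fst z) * deriv \<rho> (snd z + \<sigma> * fst z)))" for a b
    unfolding \<phi>_def by (rule dir_deriv_sheared[OF T(1,2)])
  define A where "A = (\<lambda>z::real\<times>real. deriv \<theta> (fst z) * \<rho> (snd z + \<sigma> * fst z))"
  define B where "B = (\<lambda>z::real\<times>real. \<theta> (fst z) * deriv \<rho> (snd z + \<sigma> * fst z))"
  have dA: "dir_deriv (a, b) A = (\<lambda>z. a * (deriv (deriv \<theta>) (fst z) * \<rho> (snd z + \<sigma> * fst z)) 
            + (b + \<sigma> * a) * (deriv \<theta> (fst z) * deriv \<rho> (snd z + \<sigma> * fst z)))" for a b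
    unfolding A_def by (rule dir_deriv_sheared(1)[OF T(3,2)])
  have dB: "dir_deriv (a, b) B = (\<lambda>z. a * (deriv \<theta> (fst z) * deriv \<rho> (snd z + \<sigma> * fst z)) 
            + (b + \<sigma> * a) * (\<theta> (fst z) * deriv (deriv \<rho>) (snd z + \<sigma> * fst z)))" for a b
    unfolding B_def by (rule dir_deriv_sheared(1)[OF T(1,4)])
  have diff: "A differentiable (at z)" "B differentiable (at z)" for z
    unfolding A_def B_def by (rule dir_deriv_sheared(2)[OF T(3,2)], rule dir_deriv_sheared(2)[OF T(1,4)])
  have D': "dir_deriv (a, b) \<phi> = (\<lambda>z. a * A z + (b + \<sigma> * a) * B z)" for a b
    unfolding D A_def B_def ..
  have s: "\<sigma> * \<sigma> = 1" using assms(3) by (simp add: power2_eq_square)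
  have "dir_deriv (1, 0) (dir_deriv (1, 0) \<phi>) (t, x) = dir_deriv (1, 0) A (t,x) + \<sigma> * dir_deriv (1,0) B (t,x)"
    unfolding D' using dir_deriv_lincomb[OF diff, where v="(1,0)" and a=1 and b=\<sigma>] by simp
  also have "\<dots> = deriv (deriv \<theta>) t * \<rho> (x + \<sigma> * t) + 2 * \<sigma> * (deriv \<theta> t * deriv \<rho> (x + \<sigma> * t))
     + (\<sigma> * \<sigma>) * (\<theta> t * deriv (deriv \<rho>) (x + \<sigma> * t))"
    unfolding dA dB by (simp add: algebra_simps)
  finally have 1: "dir_deriv (1, 0) (dir_deriv (1, 0) \<phi>) (t, x) = \<dots>" .
  have "dir_deriv (0, 1) (dir_deriv (0, 1) \<phi>) (t, x) = 0 * dir_deriv (0, 1) A (t,x) + 1 * dir_deriv (0,1) B (t,x)"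
    unfolding D' using dir_deriv_lincomb[OF diff, where v="(0,1)" and a=0 and b=1] by simp
  also have "\<dots> = \<theta> t * deriv (deriv \<rho>) (x + \<sigma> * t)"
    unfolding dB by simp
  finally show ?thesis unfolding 1 s by simp
qed

section \<open>Smooth cutoffs\<close>

text \<open>The index \<open>n\<close> makes the family closed under differentiation up to linear
  combinations, so that smoothness of all members is a single induction.\<close>

definition flat :: "nat \<Rightarrow> real \<Rightarrow> real" where
  "flat n x = (if x > 0 then exp (- inverse x) * inverse x ^ n else 0)"

lemma flat_tendsto_0: "((\<lambda>x. flat n x) \<longlongrightarrow> 0) (at_right 0)"
proof -
  have "((\<lambda>x. inverse x ^ n / exp (inverse x :: real)) \<longlongrightarrow> 0) (at_right 0)"
    by (rule filterlim_compose[OF tendsto_power_div_exp_0 filterlim_inverse_at_top_right])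
  then show ?thesis
    by (rule Lim_transform_eventually) (auto simp: flat_def eventually_at_right_field exp_minus field_simps intro!: exI[of _ 1])
qed

lemma flat_has_derivative:
  "(flat n has_real_derivative (- real n * flat (Suc n) x + flat (Suc (Suc n)) x)) (at x)"
proof (cases x "0::real" rule: linorder_cases)
  case less
  have "((\<lambda>x. 0) has_real_derivative 0) (at x)" by simp
  then have "(flat n has_real_derivative 0) (at x)"
    by (rule has_field_derivative_transform_within_open[where S="{..<0}"]) (use less in \<open>auto simp: flat_def\<close>)
  with less show ?thesis by (simp add: flat_def)
next
  case greater
  have "((\<lambda>x. exp (- inverse x) * inverse x ^ n) has_real_derivative (- real n * flat (Suc n) x + flat (Suc (Suc n)) x)) (at x)"
    using greater by (auto intro!: derivative_eq_intros simp: flat_def) (cases n; simp add: field_simps power2_eq_square)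
  then show ?thesis
    by (rule has_field_derivative_transform_within_open[where S="{0<..}"]) (use greater in \<open>auto simp: flat_def\<close>)
next
  case equal
  have z: "flat n 0 = 0" by (simp add: flat_def)
  have q: "flat n y / y = flat (Suc n) y" for y by (auto simp: flat_def field_simps)
  have "((\<lambda>y. (flat n y - flat n 0) / (y - 0)) \<longlongrightarrow> 0) (at 0)"
  proof (rule filterlim_split_at_real)
    show "((\<lambda>y. (flat n y - flat n 0) / (y - 0)) \<longlongrightarrow> 0) (at_left 0)"
      by (rule Lim_transform_eventually[OF tendsto_const]) (auto simp: flat_def eventually_at_left_field intro!: exI[of _ "-1"])
    show "((\<lambda>y. (flat n y - flat n 0) / (y - 0)) \<longlongrightarrow> 0) (at_right 0)"
      using flat_tendsto_0[of "Suc n"] by (simp add: z q)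
  qed
  then show ?thesis using equal by (simp add: has_field_derivative_iff) (simp add: flat_def[of _ 0])
qed

lemma C_k_flat: "C_k k (flat n)"
proof (induction k arbitrary: n)
  case 0
  show ?case using DERIV_isCont[OF flat_has_derivative] by (simp add: continuous_on_eq_continuous_at)
next
  case (Suc k)
  show ?case
    by (rule C_k_Suc_real[OF flat_has_derivative]) (intro C_k_add C_k_cmult Suc)
qed

definition raw_bump :: "real \<Rightarrow> real" where "raw_bump x = flat 0 x * flat 0 (1 - x)"

lemma C_k_raw_bump: "C_k k raw_bump"
proof -
  have "C_k k (\<lambda>x. flat 0 (- x + 1))"
    by (rule C_k_pullback[OF _ C_k_flat]) (auto intro: bounded_linear_minus bounded_linear_ident)
  from C_k_mult[OF C_k_flat this] show ?thesis unfolding raw_bump_def by (simp add: add.commute)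
qed

lemma raw_bump_nonneg: "0 \<le> raw_bump x" by (auto simp: raw_bump_def flat_def)
lemma raw_bump_outside: "x \<le> 0 \<or> x \<ge> 1 \<Longrightarrow> raw_bump x = 0" by (auto simp: raw_bump_def flat_def)
lemma raw_bump_cont: "continuous_on A raw_bump"
  using C_k_raw_bump[of 0] continuous_on_subset by auto

lemma raw_bump_integral_pos: "integral {0..1} raw_bump > 0"
proof -
  have "integral {0..1} raw_bump \<noteq> 0"
  proof
    assume "integral {0..1} raw_bump = 0"
    then have "\<forall>x\<in>{0..1}. raw_bump x = 0"
      using integral_eq_0_iff[OF raw_bump_cont[of "{0..1}"]] raw_bump_nonneg by auto
    then have "raw_bump (1/2) = 0" by auto
    then show False by (auto simp: raw_bump_def flat_def)
  qed
  moreover have "integral {0..1} raw_bump \<ge> 0" by (intro integral_nonneg integrable_continuous_real raw_bump_cont raw_bump_nonneg)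
  ultimately show ?thesis by simp
qed

definition bump :: "real \<Rightarrow> real" where "bump x = raw_bump x / integral {0..1} raw_bump"
definition smooth_step :: "real \<Rightarrow> real" where "smooth_step x = integral {0..x} bump"

lemma bump_nonneg: "0 \<le> bump x"
  using raw_bump_nonneg raw_bump_integral_pos by (simp add: bump_def)
lemma bump_outside: "x \<le> 0 \<or> x \<ge> 1 \<Longrightarrow> bump x = 0" by (simp add: bump_def raw_bump_outside)
lemma C_k_bump: "C_k k bump"
  using C_k_cmult[OF C_k_raw_bump, of k "1 / integral {0..1} raw_bump"] by (simp add: bump_def[abs_def])
lemma bump_cont: "continuous_on A bump"
  using C_k_bump[of 0] continuous_on_subset by auto
lemma bump_integral: "integral {0..1} bump = 1"
  using raw_bump_integral_pos by (simp add: bump_def[abs_def])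

lemma test_function_bump: "test_function bump"
  by (rule test_functionI[OF C_k_bump, where A=1]) (metis abs_le_iff bump_outside le_cases minus_le_iff order_trans real_norm_def neg_le_0_iff_le zero_le_one)

lemma smooth_step_left: "x \<le> 0 \<Longrightarrow> smooth_step x = 0"
  by (cases "x = 0") (auto simp: smooth_step_def)

lemma smooth_step_right: "x \<ge> 1 \<Longrightarrow> smooth_step x = 1"
proof -
  assume x: "x \<ge> 1"
  have "integral {1..x} bump = integral {1..x} (\<lambda>_. 0)"
    by (rule integral_cong) (auto simp: bump_outside)
  moreover have "integral {0..1} bump + integral {1..x} bump = integral {0..x} bump"
    using x by (intro Henstock_Kurzweil_Integration.integral_combine integrable_continuous_real bump_cont) auto
  ultimately show ?thesis by (simp add: smooth_step_def bump_integral)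
qed

lemma smooth_step_deriv: "(smooth_step has_real_derivative bump x) (at x)"
proof -
  have eq: "smooth_step y = integral {min x 0 - 1..y} bump" if "y > min x 0 - 1" for y
  proof (cases "y \<ge> 0")
    case True
    have "integral {min x 0 - 1..0} bump = integral {min x 0 - 1..0} (\<lambda>_. 0)"
      by (rule integral_cong) (auto simp: bump_outside)
    moreover have "integral {min x 0 - 1..0} bump + integral {0..y} bump = integral {min x 0 - 1..y} bump"
      using True by (intro Henstock_Kurzweil_Integration.integral_combine integrable_continuous_real bump_cont) auto
    ultimately show ?thesis by (simp add: smooth_step_def)
  next
    case False
    then have "integral {min x 0 - 1..y} bump = integral {min x 0 - 1..y} (\<lambda>_. 0)"
      by (intro integral_cong) (auto simp: bump_outside)
    with False show ?thesis by (simp add: smooth_step_left)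
  qed
  have "((\<lambda>y. integral {min x 0 - 1..y} bump) has_vector_derivative bump x) (at x within {min x 0 - 1..x + 1})"
    by (intro integral_has_vector_derivative bump_cont) auto
  then have "((\<lambda>y. integral {min x 0 - 1..y} bump) has_real_derivative bump x) (at x)"
    by (subst (asm) at_within_interior) (auto simp: has_real_derivative_iff_has_vector_derivative)
  then show ?thesis
    by (rule has_field_derivative_transform_within_open[where S="{min x 0 - 1<..}"]) (auto simp: eq)
qed

lemma smooth_step_bounds: "0 \<le> smooth_step x" "smooth_step x \<le> 1"
proof -
  have mono: "smooth_step x \<le> smooth_step y" if "x \<le> y" for x y
    by (rule DERIV_nonneg_imp_nondecreasing[OF that]) (use smooth_step_deriv bump_nonneg in blast)
  show "0 \<le> smooth_step x" using mono[of "min x 0" x] smooth_step_left[of "min x 0"] by simp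
  show "smooth_step x \<le> 1" using mono[of x "max x 1"] smooth_step_right[of "max x 1"] by simp
qed

lemma C_k_smooth_step: "C_k k smooth_step"
  using C_k_Suc_imp[OF C_k_Suc_real[OF smooth_step_deriv C_k_bump]] .

text \<open>As \<open>n\<close> grows these functions converge to the indicator of \<open>(a, b]\<close> at every point, the end points
  included, because \<open>smooth_step\<close> vanishes on the closed half line \<open>x \<le> 0\<close>.\<close>

definition cutoff :: "real \<Rightarrow> real \<Rightarrow> nat \<Rightarrow> real \<Rightarrow> real" where
  "cutoff a b n x = smooth_step (real (Suc n) * (x - a)) - smooth_step (real (Suc n) * (x - b))"

lemma cutoff_support: "a \<le> b \<Longrightarrow> x \<notin> {a..b + 1} \<Longrightarrow> cutoff a b n x = 0"
proof -
  assume "a \<le> b" "x \<notin> {a..b+1}"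
  then consider "x < a" | "x > b + 1" by force
  then show ?thesis
  proof cases
    case 1
    with \<open>a \<le> b\<close> show ?thesis unfolding cutoff_def by (simp add: smooth_step_left mult_nonneg_nonpos)
  next
    case 2
    have "real (Suc n) * (x - c) \<ge> 1" if "x - c \<ge> 1" for c
      using mult_mono[of 1 "real (Suc n)" 1 "x - c"] that by simp
    with 2 \<open>a \<le> b\<close> show ?thesis unfolding cutoff_def by (simp add: smooth_step_right)
  qed
qed

lemma cutoff_bound: "\<bar>cutoff a b n x\<bar> \<le> 1"
  using smooth_step_bounds unfolding cutoff_def by (smt (verit))

lemma C_k_smooth_step_affine: "C_k k (\<lambda>x. smooth_step (c * (x - a)))"
proof -
  have "C_k k (\<lambda>x. smooth_step (c * x + (- c * a)))"
    by (rule C_k_pullback[OF _ C_k_smooth_step]) (rule bounded_linear_mult_right)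
  then show ?thesis by (simp add: algebra_simps)
qed

lemma test_function_cutoff: assumes "a \<le> b" shows "test_function (cutoff a b n)"
proof (rule test_functionI)
  show "C_k k (cutoff a b n)" for k
    using C_k_add[OF C_k_smooth_step_affine C_k_cmult[OF C_k_smooth_step_affine, of k "-1"]]
    by (simp add: cutoff_def[abs_def])
  show "norm z \<le> \<bar>a\<bar> + \<bar>b\<bar> + 1" if "cutoff a b n z \<noteq> 0" for z
    using cutoff_support[OF assms, of z n] that by force
qed

lemma cutoff_tendsto:
  assumes "a \<le> b"
  shows "(\<lambda>n. cutoff a b n x) \<longlonglongrightarrow> indicator {a<..b} x"
proof -
  have *: "(\<lambda>n. smooth_step (real (Suc n) * (x - a))) \<longlonglongrightarrow> (if x > a then 1 else 0)" for a
  proof (cases "x > a")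
    case True
    have "\<forall>\<^sub>F n in sequentially. real n \<ge> 1 / (x - a)"
      using filterlim_real_sequentially by (simp add: filterlim_at_top)
    then have "\<forall>\<^sub>F n in sequentially. smooth_step (real (Suc n) * (x - a)) = 1"
    proof eventually_elim
      case (elim n)
      with True have "real n * (x - a) \<ge> 1" by (simp add: field_simps)
      then show ?case using True by (intro smooth_step_right) (simp add: algebra_simps)
    qed
    with True show ?thesis by (simp add: tendsto_eventually)
  next
    case False
    then show ?thesis by (simp add: smooth_step_left mult_nonneg_nonpos)
  qed
  from tendsto_diff[OF *[of a] *[of b]] show ?thesis
    unfolding cutoff_def by (rule tendsto_eq_rhs) (use assms in \<open>auto simp: indicator_def\<close>)
qed

section \<open>Square integrable functions\<close>

text \<open>The common core of two Cauchy-Schwarz inequalities: the one in $L^2(\mathbb{R})$, and the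
  one for null energies averaged over a window of space and time.\<close>

lemma psd_discriminant:
  fixes A B C :: real
  assumes "\<And>x y. 0 \<le> A * x\<^sup>2 + 2 * B * x * y + C * y\<^sup>2"
  shows "B\<^sup>2 \<le> A * C"
proof (cases "C > 0")
  case True
  have "0 \<le> C * (A * C - B\<^sup>2)"
    using assms[of C "-B"] by (simp add: power2_eq_square algebra_simps)
  with True show ?thesis by (simp add: zero_le_mult_iff)
next
  case False
  with assms[of 0 1] have C: "C = 0" by simp
  have "B = 0"
  proof (rule ccontr)
    assume B: "B \<noteq> 0"
    have "0 \<le> A * B\<^sup>2 + 2 * B * (- B) * ((\<bar>A\<bar> + 1) / 2)"
      using assms[of "-B" "- (\<bar>A\<bar> + 1) / 2 * -1"] C by (simp add: algebra_simps power2_eq_square)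
    also have "\<dots> = B\<^sup>2 * (A - \<bar>A\<bar> - 1)" by (simp add: power2_eq_square field_simps)
    also have "\<dots> < 0" using B by (intro mult_pos_neg) auto
    finally show False by simp
  qed
  with C show ?thesis by simp
qed

lemma in_L2_meas: "in_L2 f \<Longrightarrow> f \<in> borel_measurable borel"
  by (simp add: in_L2_def)

lemma in_L2_sq: "in_L2 f \<Longrightarrow> integrable lborel (\<lambda>x. (f x)\<^sup>2)"
  by (simp add: in_L2_def)

lemma in_L2_mult: 
  assumes "in_L2 f" "in_L2 g" shows "integrable lborel (\<lambda>x. f x * g x)"
proof (rule Bochner_Integration.integrable_bound)
  show "integrable lborel (\<lambda>x. (f x)\<^sup>2 + (g x)\<^sup>2)" using assms by (simp add: in_L2_sq)
  show "(\<lambda>x. f x * g x) \<in> borel_measurable lborel" using assms[THEN in_L2_meas] by simp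
  have "\<bar>a * b\<bar> \<le> \<bar>a\<^sup>2 + b\<^sup>2\<bar>" for a b :: real
  proof -
    have "2 * (\<bar>a\<bar> * \<bar>b\<bar>) \<le> a\<^sup>2 + b\<^sup>2" using sum_squares_bound[of "\<bar>a\<bar>" "\<bar>b\<bar>"] by simp
    moreover have "0 \<le> \<bar>a\<bar> * \<bar>b\<bar>" by simp
    ultimately show ?thesis unfolding abs_mult by linarith
  qed
  then show "AE x in lborel. norm (f x * g x) \<le> norm ((f x)\<^sup>2 + (g x)\<^sup>2)" by simp
qed

lemma in_L2_bounded_mult:
  assumes "in_L2 f" "\<Phi> \<in> borel_measurable borel" "\<And>x. \<bar>\<Phi> x\<bar> \<le> B"
  shows "in_L2 (\<lambda>x. \<Phi> x * f x)"
proof -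
  have "integrable lborel (\<lambda>x. (\<Phi> x * f x)\<^sup>2)"
  proof (rule Bochner_Integration.integrable_bound)
    show "integrable lborel (\<lambda>x. B\<^sup>2 * (f x)\<^sup>2)" using assms by (simp add: in_L2_sq)
    show "(\<lambda>x. (\<Phi> x * f x)\<^sup>2) \<in> borel_measurable lborel"
      using assms in_L2_meas[OF assms(1)] by simp
    have "(\<Phi> x)\<^sup>2 \<le> B\<^sup>2" for x using assms(3)[of x] by (metis abs_ge_zero power2_abs power_mono)
    then show "AE x in lborel. norm ((\<Phi> x * f x)\<^sup>2) \<le> norm (B\<^sup>2 * (f x)\<^sup>2)"
      by (simp add: power_mult_distrib mult_right_mono)
  qed
  then show ?thesis using assms in_L2_meas[OF assms(1)] by (simp add: in_L2_def)
qed

lemma in_L2_cmult: "in_L2 f \<Longrightarrow> in_L2 (\<lambda>x. c * f x)"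
  by (rule in_L2_bounded_mult[where B="\<bar>c\<bar>"]) auto

lemma in_L2_add: 
  assumes "in_L2 f" "in_L2 g" shows "in_L2 (\<lambda>x. f x + g x)"
proof -
  have "integrable lborel (\<lambda>x. (f x)\<^sup>2 + 2 * (f x * g x) + (g x)\<^sup>2)"
    using assms by (intro Bochner_Integration.integrable_add integrable_mult_right in_L2_mult in_L2_sq)
  moreover have "(f x + g x)\<^sup>2 = (f x)\<^sup>2 + 2 * (f x * g x) + (g x)\<^sup>2" for x
    by (simp add: power2_eq_square algebra_simps)
  ultimately show ?thesis using assms[THEN in_L2_meas] by (simp add: in_L2_def)
qed

lemma in_L2_minus: "in_L2 f \<Longrightarrow> in_L2 (\<lambda>x. - f x)"
  using in_L2_cmult[of f "-1"] by simp

lemma in_L2_diff: "in_L2 f \<Longrightarrow> in_L2 g \<Longrightarrow> in_L2 (\<lambda>x. f x - g x)"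
  using in_L2_add[OF _ in_L2_minus, of f g] by simp

lemma in_L2_zero: "in_L2 (\<lambda>x. 0)" by (simp add: in_L2_def)

lemma in_L2_divide: "in_L2 f \<Longrightarrow> in_L2 (\<lambda>x. f x / c)"
  using in_L2_cmult[of f "1/c"] by simp

lemma in_L2_abs: 
  assumes "in_L2 f" shows "in_L2 (\<lambda>x. \<bar>f x\<bar>)"
  using in_L2_meas[OF assms] in_L2_sq[OF assms] by (simp add: in_L2_def)

lemma norm_L2_nonneg: "0 \<le> norm_L2 f" by (simp add: norm_L2_def)

lemma norm_L2_square: "(norm_L2 f)\<^sup>2 = (LBINT x. (f x)\<^sup>2)"
  by (simp add: norm_L2_def)

lemma norm_L2_abs: "norm_L2 (\<lambda>x. \<bar>f x\<bar>) = norm_L2 f" by (simp add: norm_L2_def)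

lemma norm_L2_cmult: "norm_L2 (\<lambda>x. c * f x) = \<bar>c\<bar> * norm_L2 f"
  by (simp add: norm_L2_def power_mult_distrib real_sqrt_mult)

lemma norm_L2_minus: "norm_L2 (\<lambda>x. - f x) = norm_L2 f"
  by (simp add: norm_L2_def)

lemma norm_L2_diff_commute: "norm_L2 (\<lambda>x. f x - g x) = norm_L2 (\<lambda>x. g x - f x)"
  by (simp add: norm_L2_def power2_commute)

lemma Cauchy_Schwarz_L2:
  assumes "in_L2 f" "in_L2 g"
  shows "\<bar>LBINT x. f x * g x\<bar> \<le> norm_L2 f * norm_L2 g"
proof -
  define A B C where "A = (LBINT x. (f x)\<^sup>2)" "B = (LBINT x. f x * g x)" "C = (LBINT x. (g x)\<^sup>2)"
  have "0 \<le> A * x\<^sup>2 + 2 * B * x * y + C * y\<^sup>2" for x y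
  proof -
    have "0 \<le> (LBINT z. (x * f z + y * g z)\<^sup>2)" by (intro integral_nonneg_AE) auto
    also have "\<dots> = (LBINT z. x\<^sup>2 * (f z)\<^sup>2 + (2 * x * y) * (f z * g z) + y\<^sup>2 * (g z)\<^sup>2)"
      by (intro Bochner_Integration.integral_cong) (auto simp: power2_eq_square algebra_simps)
    also have "\<dots> = x\<^sup>2 * A + (2 * x * y) * B + y\<^sup>2 * C"
      unfolding A_B_C_def using assms by (simp add: in_L2_sq in_L2_mult)
    finally show ?thesis by (simp add: algebra_simps)
  qed
  from psd_discriminant[OF this] have "B\<^sup>2 \<le> A * C" .
  also have "A * C = (norm_L2 f * norm_L2 g)\<^sup>2" by (simp add: power_mult_distrib norm_L2_square A_B_C_def)
  finally have "\<bar>B\<bar> \<le> \<bar>norm_L2 f * norm_L2 g\<bar>" by (simp add: abs_le_square_iff)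
  then show ?thesis by (simp add: A_B_C_def abs_mult norm_L2_nonneg)
qed

lemma Cauchy_Schwarz_L2_abs:
  assumes "in_L2 f" "in_L2 g"
  shows "(LBINT x. \<bar>f x * g x\<bar>) \<le> norm_L2 f * norm_L2 g"
  using Cauchy_Schwarz_L2[OF assms[THEN in_L2_abs]] by (simp add: norm_L2_abs abs_mult)

lemma norm_L2_triangle:
  assumes "in_L2 f" "in_L2 g"
  shows "norm_L2 (\<lambda>x. f x + g x) \<le> norm_L2 f + norm_L2 g"
proof -
  have "(norm_L2 (\<lambda>x. f x + g x))\<^sup>2 = (LBINT x. (f x)\<^sup>2 + 2 * (f x * g x) + (g x)\<^sup>2)"
    unfolding norm_L2_square by (intro Bochner_Integration.integral_cong) (auto simp: power2_eq_square algebra_simps)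
  also have "\<dots> = (norm_L2 f)\<^sup>2 + 2 * (LBINT x. f x * g x) + (norm_L2 g)\<^sup>2"
    unfolding norm_L2_square using assms by (simp add: in_L2_sq in_L2_mult)
  also have "\<dots> \<le> (norm_L2 f + norm_L2 g)\<^sup>2"
    using Cauchy_Schwarz_L2[OF assms] by (simp add: power2_sum)
  finally show ?thesis by (rule power2_le_imp_le) (simp add: norm_L2_nonneg)
qed

lemma norm_L2_triangle_diff:
  assumes "in_L2 f" "in_L2 g" "in_L2 h"
  shows "norm_L2 (\<lambda>x. f x - h x) \<le> norm_L2 (\<lambda>x. f x - g x) + norm_L2 (\<lambda>x. g x - h x)"
  using norm_L2_triangle[OF in_L2_diff[OF assms(1,2)] in_L2_diff[OF assms(2,3)]] by simp

lemma norm_L2_mono: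
  assumes "f \<in> borel_measurable borel" "in_L2 g" "AE x in lborel. \<bar>f x\<bar> \<le> \<bar>g x\<bar>"
  shows "in_L2 f" "norm_L2 f \<le> norm_L2 g"
proof -
  have *: "AE x in lborel. (f x)\<^sup>2 \<le> (g x)\<^sup>2"
    using assms(3) by (simp add: abs_le_square_iff)
  have "integrable lborel (\<lambda>x. (f x)\<^sup>2)"
    by (rule Bochner_Integration.integrable_bound[OF in_L2_sq[OF assms(2)]]) (use assms * in auto)
  then show "in_L2 f" using assms by (simp add: in_L2_def)
  then show "norm_L2 f \<le> norm_L2 g"
    unfolding norm_L2_def by (intro real_sqrt_le_mono integral_mono_AE in_L2_sq assms *) auto
qed

lemma norm_L2_cong_AE:
  assumes "f \<in> borel_measurable borel" "g \<in> borel_measurable borel" "AE x in lborel. f x = g x"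
  shows "norm_L2 f = norm_L2 g" "in_L2 f \<longleftrightarrow> in_L2 g"
proof -
  have *: "AE x in lborel. (f x)\<^sup>2 = (g x)\<^sup>2" using assms(3) by auto
  show "norm_L2 f = norm_L2 g"
    unfolding norm_L2_def using assms * by (intro arg_cong[where f=sqrt] integral_cong_AE) auto
  have "integrable lborel (\<lambda>x. (f x)\<^sup>2) \<longleftrightarrow> integrable lborel (\<lambda>x. (g x)\<^sup>2)"
    using assms * by (intro integrable_cong_AE) auto
  with assms show "in_L2 f \<longleftrightarrow> in_L2 g" by (simp add: in_L2_def)
qed

lemma integral_shift: "(LBINT x. f (x + c)) = (LBINT x. f x)" for f :: "real \<Rightarrow> real"
  using lborel_integral_real_affine[of 1 f c] by (simp add: add.commute)

lemma integrable_shift: "integrable lborel f \<Longrightarrow> integrable lborel (\<lambda>x. f (x + c))" for f :: "real \<Rightarrow> real"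
  using lborel_integrable_real_affine[of f 1 c] by (simp add: add.commute)

lemma in_L2_shift: 
  assumes "in_L2 f" shows "in_L2 (\<lambda>x. f (x + c))"
proof -
  have [measurable]: "f \<in> borel_measurable borel" by (rule in_L2_meas[OF assms])
  show ?thesis using integrable_shift[OF in_L2_sq[OF assms]] by (simp add: in_L2_def)
qed

lemma norm_L2_shift: "norm_L2 (\<lambda>x. f (x + c)) = norm_L2 f"
  unfolding norm_L2_def by (subst integral_shift[of "\<lambda>x. (f x)\<^sup>2"]) simp

lemma integrable_Icc: "integrable lborel (\<lambda>y. indicator {a..b} y * c :: real)" for a b :: real
  by (intro integrable_mult_left integrable_real_indicator) (auto simp: emeasure_lborel_Icc_eq)

lemma in_L2_Icc: "in_L2 (indicator {a..b})"
  using integrable_Icc[of a b 1]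
  by (simp add: in_L2_def power2_eq_square indicator_inter_arith[symmetric])

lemma norm_L2_Icc: "a \<le> b \<Longrightarrow> norm_L2 (indicator {a..b}) = sqrt (b - a)"
  by (simp add: norm_L2_def power2_eq_square indicator_inter_arith[symmetric])

section \<open>Locally integrable functions and the fundamental lemma\<close>

definition loc_integrable :: "(real \<Rightarrow> real) \<Rightarrow> bool" where
  "loc_integrable g \<longleftrightarrow> g \<in> borel_measurable borel \<and> (\<forall>A. integrable lborel (\<lambda>x. indicator {-A..A} x * g x))"

lemma loc_integrableI_continuous: "continuous_on UNIV g \<Longrightarrow> loc_integrable g"
  using borel_integrable_atLeastAtMost'[of _ _ g] unfolding loc_integrable_def set_integrable_def
  by (auto intro: borel_measurable_continuous_onI continuous_on_subset)

lemma loc_integrableI_L2: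
  assumes "in_L2 g" shows "loc_integrable g"
  unfolding loc_integrable_def
proof (intro conjI allI)
  show [measurable]: "g \<in> borel_measurable borel" using assms by (rule in_L2_meas)
  fix A
  show "integrable lborel (\<lambda>x. indicator {-A..A} x * g x)"
  proof (rule Bochner_Integration.integrable_bound)
    show "integrable lborel (\<lambda>x. indicator {-A..A} x + (g x)\<^sup>2)"
      using assms by (intro Bochner_Integration.integrable_add in_L2_sq integrable_real_indicator) (auto simp: emeasure_lborel_Icc_eq)
    have "\<bar>a\<bar> \<le> \<bar>1 + a\<^sup>2\<bar>" for a :: real
      using sum_squares_bound[of "\<bar>a\<bar>" 1] by (simp add: abs_if split: if_splits)
    then show "AE x in lborel. norm (indicator {- A..A} x * g x) \<le> norm (indicator {- A..A} x + (g x)\<^sup>2)"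
      by (auto simp: indicator_def)
  qed simp
qed

lemma loc_integrable_add: "loc_integrable f \<Longrightarrow> loc_integrable g \<Longrightarrow> loc_integrable (\<lambda>x. f x + g x)"
  by (auto simp: loc_integrable_def algebra_simps)

lemma loc_integrable_diff: "loc_integrable f \<Longrightarrow> loc_integrable g \<Longrightarrow> loc_integrable (\<lambda>x. f x - g x)"
  by (auto simp: loc_integrable_def algebra_simps)

lemma loc_integrable_bounded_support:
  assumes "loc_integrable g" "\<rho> \<in> borel_measurable borel" "\<And>x. \<bar>\<rho> x\<bar> \<le> B" "\<And>x. \<rho> x \<noteq> 0 \<Longrightarrow> \<bar>x\<bar> \<le> A"
  shows "integrable lborel (\<lambda>x. g x * \<rho> x)"
proof (rule Bochner_Integration.integrable_bound)
  show "integrable lborel (\<lambda>x. B * (indicator {-A..A} x * g x))"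
    using assms(1) by (intro integrable_mult_right) (simp add: loc_integrable_def)
  have [measurable]: "g \<in> borel_measurable borel" "\<rho> \<in> borel_measurable borel" using assms by (simp_all add: loc_integrable_def)
  show "(\<lambda>x. g x * \<rho> x) \<in> borel_measurable lborel" by simp
  have "norm (g x * \<rho> x) \<le> norm (B * (indicator {- A..A} x * g x))" for x
  proof (cases "\<rho> x = 0")
    case False
    then have "indicator {-A..A} x = (1::real)" using assms(4)[of x] by (auto simp: abs_le_iff)
    moreover have "\<bar>\<rho> x\<bar> \<le> \<bar>B\<bar>" using assms(3)[of x] by linarith
    ultimately show ?thesis using mult_right_mono[of "\<bar>\<rho> x\<bar>" "\<bar>B\<bar>" "\<bar>g x\<bar>"] by (simp add: abs_mult mult.commute)
  qed simp
  then show "AE x in lborel. norm (g x * \<rho> x) \<le> norm (B * (indicator {- A..A} x * g x))" by simp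
qed

lemma test_function_meas: "test_function \<rho> \<Longrightarrow> \<rho> \<in> borel_measurable borel" for \<rho> :: "real \<Rightarrow> real"
  by (intro borel_measurable_continuous_onI test_functionD(3))

lemma loc_integrable_test:
  assumes "loc_integrable g" "test_function \<rho>"
  shows "integrable lborel (\<lambda>x. g x * \<rho> x)"
proof -
  obtain A B where "\<And>x. \<rho> x \<noteq> 0 \<Longrightarrow> \<bar>x\<bar> < A" "\<And>x. \<bar>\<rho> x\<bar> \<le> B"
    using test_functionD(4,5)[OF assms(2)] by blast
  then show ?thesis
    using assms test_function_meas by (intro loc_integrable_bounded_support[where A=A and B=B]) (auto intro: less_imp_le)
qed

lemma in_L2_test:
  assumes "test_function \<rho>" shows "in_L2 \<rho>"
proof -
  have "loc_integrable \<rho>" by (intro loc_integrableI_continuous test_functionD(3) assms)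
  from loc_integrable_test[OF this assms] show ?thesis
    by (simp add: in_L2_def power2_eq_square test_function_meas[OF assms])
qed

lemma cutoff_integral_limit:
  assumes "loc_integrable g" "a \<le> b"
  shows "(\<lambda>n. LBINT x. g x * cutoff a b n x) \<longlonglongrightarrow> (LBINT x. g x * indicator {a<..b} x)"
proof (rule integral_dominated_convergence)
  have [measurable]: "g \<in> borel_measurable borel" using assms by (simp add: loc_integrable_def)
  show "(\<lambda>x. g x * cutoff a b n x) \<in> borel_measurable lborel" for n
    using test_function_meas[OF test_function_cutoff[OF assms(2)], of n] by simp
  show "(\<lambda>x. g x * indicator {a<..b} x) \<in> borel_measurable lborel" by simp
  show "integrable lborel (\<lambda>x. \<bar>g x * indicator {a..b+1} x\<bar>)"
    using assms by (intro integrable_abs loc_integrable_bounded_support[where B=1 and A="\<bar>a\<bar> + \<bar>b\<bar> + 1"])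
      (auto simp: indicator_def split: if_splits)
  show "AE x in lborel. (\<lambda>n. g x * cutoff a b n x) \<longlonglongrightarrow> g x * indicator {a<..b} x"
    by (intro AE_I2 tendsto_mult_left cutoff_tendsto assms)
  have "\<bar>g x * cutoff a b n x\<bar> \<le> \<bar>g x * indicator {a..b + 1} x\<bar>" for n x
  proof (cases "x \<in> {a..b+1}")
    case True
    then show ?thesis using mult_left_mono[OF cutoff_bound[of a b n x], of "\<bar>g x\<bar>"] by (simp add: abs_mult)
  next
    case False
    then show ?thesis using cutoff_support[OF assms(2) False] by simp
  qed
  then show "AE x in lborel. norm (g x * cutoff a b n x) \<le> \<bar>g x * indicator {a..b + 1} x\<bar>" for n
    by simp
qed

text \<open>The positive and the negative part of \<open>h\<close> are densities of finite measures.
  These agree on all half lines, hence everywhere, so their densities agree almost everywhere.\<close>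

lemma integrable_zero_on_Ioc_imp_AE_zero:
  fixes h :: "real \<Rightarrow> real"
  assumes h: "integrable lborel h" and z: "\<And>a. (LBINT x. h x * indicator {a<..} x) = 0"
  shows "AE x in lborel. h x = 0"
proof -
  have [measurable]: "h \<in> borel_measurable borel" using h by auto
  define M N where "M = density lborel (\<lambda>x. ennreal (h x))" and "N = density lborel (\<lambda>x. ennreal (- h x))"
  have i: "integrable lborel (\<lambda>x. h x * indicator {a<..} x)" for a
    using integrable_mult_indicator[OF _ h, of "{a<..}"] by (simp add: mult.commute)
  have eq: "emeasure M {a<..} = ennreal (enn2real (\<integral>\<^sup>+x. ennreal (h x * indicator {a<..} x) \<partial>lborel)) \<and> 
     emeasure N {a<..} = ennreal (enn2real (\<integral>\<^sup>+x. ennreal (- (h x * indicator {a<..} x)) \<partial>lborel))" for a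
  proof -
    have "emeasure M {a<..} = (\<integral>\<^sup>+x. ennreal (h x * indicator {a<..} x) \<partial>lborel)"
      unfolding M_def by (subst emeasure_density) (auto intro!: nn_integral_cong simp: indicator_def)
    moreover have "emeasure N {a<..} = (\<integral>\<^sup>+x. ennreal (- (h x * indicator {a<..} x)) \<partial>lborel)"
      unfolding N_def by (subst emeasure_density) (auto intro!: nn_integral_cong simp: indicator_def)
    ultimately show ?thesis using real_integrable_def[of lborel "\<lambda>x. h x * indicator {a<..} x"] i[of a]
      by (simp add: less_top)
  qed
  have "M = N"
  proof (rule measure_eqI_lessThan)
    show "emeasure M {x<..} = emeasure N {x<..}" for x
      using z[of x] eq[of x] real_lebesgue_integral_def[OF i[of x]] by simp
  qed (use eq in \<open>auto simp: M_def N_def\<close>)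
  then have "AE x in lborel. ennreal (h x) = ennreal (- h x)"
    unfolding M_def N_def by (intro sigma_finite_measure.density_unique[OF sigma_finite_lborel]) auto
  then show ?thesis
  proof eventually_elim
    case (elim x)
    show ?case
    proof (cases "h x \<ge> 0")
      case True
      then have "ennreal (- h x) = 0" by (simp add: ennreal_neg)
      with elim True show ?thesis by (simp add: ennreal_eq_0_iff)
    next
      case False
      then have "ennreal (h x) = 0" by (simp add: ennreal_neg)
      with elim have "ennreal (- h x) = 0" by simp
      with False show ?thesis by (simp add: ennreal_eq_0_iff)
    qed
  qed
qed

text \<open>Smooth cutoffs approximate the indicators of half-open intervals, so the integral of
  \<open>g\<close> over every bounded interval vanishes.\<close>

lemma fundamental_lemma:
  assumes g: "loc_integrable g" and z: "\<And>\<rho>. test_function \<rho> \<Longrightarrow> (LBINT x. g x * \<rho> x) = 0"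
  shows "AE x in lborel. g x = 0"
proof -
  have 0: "(LBINT x. g x * indicator {a<..b} x) = 0" if "a \<le> b" for a b
    using cutoff_integral_limit[OF g that] by (simp add: z[OF test_function_cutoff[OF that]] LIMSEQ_const_iff)
  have [measurable]: "g \<in> borel_measurable borel" using g by (simp add: loc_integrable_def)
  have "AE x in lborel. g x * indicator {-real n<..real n} x = 0" for n :: nat
  proof (rule integrable_zero_on_Ioc_imp_AE_zero)
    show "integrable lborel (\<lambda>x. g x * indicator {-real n<..real n} x)"
      by (rule loc_integrable_bounded_support[OF g, where B=1 and A="real n"]) (auto simp: indicator_def split: if_splits)
    fix a
    have "g x * indicator {-real n<..real n} x * indicator {a<..} x = g x * indicator {max a (-real n)<..max (max a (-real n)) (real n)} x" for x
      by (auto simp: indicator_def)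
    note eq = this
    show "(LBINT x. g x * indicator {-real n<..real n} x * indicator {a<..} x) = 0"
      unfolding eq by (rule 0) simp
  qed
  then have "AE x in lborel. \<forall>n. g x * indicator {-real n<..real n} x = 0"
    unfolding AE_all_countable by blast
  then show ?thesis
  proof eventually_elim
    case (elim x)
    obtain n where "\<bar>x\<bar> < real n" using reals_Archimedean2 by blast
    then have "indicator {-real n<..real n} x = (1::real)" by (auto simp: indicator_def abs_less_iff)
    with elim[rule_format, of n] show ?case by simp
  qed
qed

lemma FTC_has_integral:
  assumes "a \<le> b" "\<And>x. (F has_real_derivative f x) (at x)"
  shows "(f has_integral F b - F a) {a..b}"
  by (rule fundamental_theorem_of_calculus[OF assms(1)])
    (use assms(2) in \<open>auto simp: has_real_derivative_iff_has_vector_derivative intro: has_vector_derivative_at_within\<close>)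

lemmas FTC_integral = integral_unique[OF FTC_has_integral]

section \<open>Primitives and continuous representatives\<close>

text \<open>The difference of indicators is the signed indicator of the interval between
  \<open>0\<close> and \<open>x\<close>; it avoids a case distinction on the sign of \<open>x\<close>
  in applications of Fubini's theorem.\<close>

definition primitive :: "(real \<Rightarrow> real) \<Rightarrow> real \<Rightarrow> real" where
  "primitive g x = (LBINT y. (indicator {..x} y - indicator {..0} y) * g y)"

lemma loc_integrable_Icc:
  assumes "loc_integrable g" shows "set_integrable lborel {a..b} g"
proof -
  have "integrable lborel (\<lambda>x. g x * indicator {a..b} x)"
    using assms by (intro loc_integrable_bounded_support[where B=1 and A="\<bar>a\<bar> + \<bar>b\<bar>"]) (auto simp: indicator_def split: if_splits)
  then show ?thesis by (simp add: set_integrable_def mult.commute)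
qed

lemma loc_integrable_HK:
  assumes "loc_integrable g"
  shows "g integrable_on {a..b}" "integral {a..b} g = (LBINT x. indicator {a..b} x * g x)"
  using set_borel_integral_eq_integral[OF loc_integrable_Icc[OF assms, of a b]]
  by (auto simp: set_lebesgue_integral_def)

lemma primitive_diff:
  assumes g: "loc_integrable g" and "a \<le> b"
  shows "primitive g b - primitive g a = integral {a..b} g"
proof -
  have [measurable]: "g \<in> borel_measurable borel" using g by (simp add: loc_integrable_def)
  have i: "integrable lborel (\<lambda>y. (indicator {..x} y - indicator {..0} y) * g y)" for x
  proof -
    have "integrable lborel (\<lambda>y. g y * (indicator {..x} y - indicator {..0} y))"
      by (rule loc_integrable_bounded_support[OF g, where B=1 and A="\<bar>x\<bar>"]) (auto simp: indicator_def of_bool_def split: if_splits)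
    then show ?thesis by (simp add: mult.commute)
  qed
  have "primitive g b - primitive g a = (LBINT y. (indicator {..b} y - indicator {..0} y) * g y - (indicator {..a} y - indicator {..0} y) * g y)"
    unfolding primitive_def using i by (simp add: Bochner_Integration.integral_diff)
  also have "\<dots> = (LBINT x. indicator {a..b} x * g x)"
  proof (rule integral_cong_AE)
    have "AE x in lborel. x \<noteq> a" by (rule AE_lborel_singleton)
    then show "AE y in lborel. (indicator {..b} y - indicator {..0} y) * g y - (indicator {..a} y - indicator {..0} y) * g y = indicator {a..b} y * g y"
      by eventually_elim (use assms(2) in \<open>auto simp: indicator_def\<close>)
  qed auto
  finally show ?thesis using loc_integrable_HK(2)[OF g] by simp
qed

lemma primitive_continuous:
  assumes g: "loc_integrable g" shows "continuous_on UNIV (primitive g)"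
proof -
  have "isCont (primitive g) x" for x
  proof -
    have "continuous_on {x-1..x+1} (\<lambda>y. integral {x-1..y} g)"
      by (rule indefinite_integral_continuous_1[OF loc_integrable_HK(1)[OF g]])
    then have "continuous_on {x-1..x+1} (\<lambda>y. primitive g (x-1) + integral {x-1..y} g)"
      by (intro continuous_intros)
    moreover have "primitive g (x-1) + integral {x-1..y} g = primitive g y" if "y \<in> {x-1..x+1}" for y
      using primitive_diff[OF g, of "x-1" y] that by simp
    ultimately have "continuous_on {x-1..x+1} (primitive g)" by (rule continuous_on_eq)
    then show ?thesis by (rule continuous_on_interior) auto
  qed
  then show ?thesis by (simp add: continuous_on_eq_continuous_at)
qed

lemma eq_primitive:
  assumes g: "loc_integrable g" and F: "\<And>a b. a \<le> b \<Longrightarrow> F b - F a = integral {a..b} g"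
  shows "F x = primitive g x + (F 0 - primitive g 0)"
  using F[of 0 x] F[of x 0] primitive_diff[OF g, of 0 x] primitive_diff[OF g, of x 0]
  by (cases "x \<ge> 0") simp_all

lemma primitive_deriv:
  assumes g: "continuous_on UNIV g" shows "(primitive g has_real_derivative g x) (at x)"
proof -
  have "((\<lambda>y. integral {x-1..y} g) has_vector_derivative g x) (at x within {x-1..x+1})"
    by (intro integral_has_vector_derivative continuous_on_subset[OF g]) auto
  then have *: "((\<lambda>y. integral {x-1..y} g) has_real_derivative g x) (at x)"
    by (subst (asm) at_within_interior) (auto simp: has_real_derivative_iff_has_vector_derivative)
  have "((\<lambda>y. integral {x-1..y} g + primitive g (x-1)) has_real_derivative g x) (at x)"
    using DERIV_add[OF * DERIV_const] by simp
  then show ?thesis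
    by (rule has_field_derivative_transform_within_open[where S="{x-1<..}"])
      (use primitive_diff[OF loc_integrableI_continuous[OF g], of "x-1", symmetric] in auto)
qed

lemma test_integral_tail:
  assumes "test_function \<rho>"
  shows "(LBINT x. indicator {y..} x * deriv \<rho> x) = - \<rho> y"
proof -
  obtain A where A: "A > 0" "\<And>x. \<rho> x \<noteq> 0 \<Longrightarrow> \<bar>x\<bar> < A" using test_functionD(4)[OF assms] by auto
  obtain A' where A': "A' > 0" "\<And>x. deriv \<rho> x \<noteq> 0 \<Longrightarrow> \<bar>x\<bar> < A'"
    using test_functionD(4)[OF test_functionD(2)[OF assms]] by auto
  define b where "b = max y (max A A')"
  have "(LBINT x. indicator {y..} x * deriv \<rho> x) = (LBINT x. indicator {y..b} x *\<^sub>R deriv \<rho> x)"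
  proof (intro Bochner_Integration.integral_cong refl)
    show "indicator {y..} x * deriv \<rho> x = indicator {y..b} x *\<^sub>R deriv \<rho> x" for x
      using A'(2)[of x] by (cases "deriv \<rho> x = 0") (auto simp: indicator_def b_def)
  qed
  also have "\<dots> = \<rho> b - \<rho> y"
  proof (rule integral_FTC_atLeastAtMost)
    show "y \<le> b" by (simp add: b_def)
    show "(\<rho> has_vector_derivative deriv \<rho> x) (at x within {y..b})" for x
      using test_functionD(1)[OF assms, of x] has_real_derivative_iff_has_vector_derivative has_vector_derivative_at_within by blast
    show "continuous_on {y..b} (deriv \<rho>)" by (rule test_functionD(3)[OF test_functionD(2)[OF assms]])
  qed
  also have "\<rho> b = 0" using A(2)[of b] A(1) by (cases "\<rho> b = 0") (auto simp: b_def)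
  finally show ?thesis by simp
qed

lemma test_integral_deriv:
  assumes "test_function \<rho>" shows "(LBINT x. deriv \<rho> x) = 0"
proof -
  obtain A where A: "A > 0" "\<And>x. \<rho> x \<noteq> 0 \<Longrightarrow> \<bar>x\<bar> < A" using test_functionD(4)[OF assms] by auto
  obtain A' where A': "A' > 0" "\<And>x. deriv \<rho> x \<noteq> 0 \<Longrightarrow> \<bar>x\<bar> < A'"
    using test_functionD(4)[OF test_functionD(2)[OF assms]] by auto
  have "(LBINT x. deriv \<rho> x) = (LBINT x. indicator {-(max A A')..} x * deriv \<rho> x)"
  proof (intro Bochner_Integration.integral_cong refl)
    show "deriv \<rho> x = indicator {-(max A A')..} x * deriv \<rho> x" for x
      using A'(2)[of x] by (cases "deriv \<rho> x = 0") (auto simp: indicator_def)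
  qed
  also have "\<dots> = - \<rho> (- max A A')" by (rule test_integral_tail[OF assms])
  also have "\<rho> (- max A A') = 0" using A(2)[of "- max A A'"] A(1) by (cases "\<rho> (- max A A') = 0") auto
  finally show ?thesis by simp
qed

lemma integrable_tensor:
  fixes f g :: "real \<Rightarrow> real"
  assumes f: "integrable lborel f" and g: "integrable lborel g"
  shows "integrable (lborel \<Otimes>\<^sub>M lborel) (\<lambda>z. f (fst z) * g (snd z))"
proof (rule lborel_pair.Fubini_integrable)
  have [measurable]: "f \<in> borel_measurable borel" "g \<in> borel_measurable borel" using f g by auto
  show "(\<lambda>z. f (fst z) * g (snd z)) \<in> borel_measurable (lborel \<Otimes>\<^sub>M lborel)" by measurable
  show "integrable lborel (\<lambda>x. LBINT y. norm (f (fst (x, y)) * g (snd (x, y))))"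
    using f by (simp add: abs_mult)
  show "AE x in lborel. integrable lborel (\<lambda>y. f (fst (x, y)) * g (snd (x, y)))"
    using g by simp
qed

text \<open>The density \<open>g\<close> is only locally integrable, so the product rule is not at hand
  pointwise; the identity is Fubini's theorem for \<open>g(y) \<rho>'(x)\<close> times the signed
  indicator of \<open>y\<close> lying between \<open>0\<close> and \<open>x\<close>.\<close>

lemma primitive_by_parts:
  assumes g: "loc_integrable g" and t: "test_function \<rho>"
  shows "(LBINT x. primitive g x * deriv \<rho> x) = - (LBINT x. g x * \<rho> x)"
proof -
  note t' = test_functionD(2)[OF t]
  obtain A where A: "A > 0" "\<And>x. deriv \<rho> x \<noteq> 0 \<Longrightarrow> \<bar>x\<bar> < A" using test_functionD(4)[OF t'] by auto
  have [measurable]: "g \<in> borel_measurable borel" "deriv \<rho> \<in> borel_measurable borel"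
    using g test_function_meas[OF t'] by (simp_all add: loc_integrable_def)
  define k where "k = (\<lambda>(x, y). (indicator {..x} y - indicator {..0} y) * g y * deriv \<rho> x :: real)"
  have kb: "\<bar>k (x, y)\<bar> \<le> \<bar>deriv \<rho> x * (indicator {-A..A} y * g y)\<bar>" for x y
  proof (cases "deriv \<rho> x = 0")
    case False
    then have "\<bar>x\<bar> < A" using A by auto
    then show ?thesis by (auto simp: k_def indicator_def abs_mult mult.commute)
  qed (simp add: k_def)
  have i1: "integrable lborel (deriv \<rho>)"
    using loc_integrable_test[OF loc_integrableI_continuous t', of "\<lambda>_. 1"] by simp
  have i2: "integrable lborel (\<lambda>y. indicator {-A..A} y * g y)" using g by (simp add: loc_integrable_def)
  have "integrable (lborel \<Otimes>\<^sub>M lborel) k"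
  proof (rule Bochner_Integration.integrable_bound)
    show "integrable (lborel \<Otimes>\<^sub>M lborel) (\<lambda>z. deriv \<rho> (fst z) * (indicator {-A..A} (snd z) * g (snd z)))"
      by (rule integrable_tensor[OF i1 i2])
    show "k \<in> borel_measurable (lborel \<Otimes>\<^sub>M lborel)"
      unfolding k_def by (simp add: indicator_def) measurable
    show "AE z in lborel \<Otimes>\<^sub>M lborel. norm (k z) \<le> norm (deriv \<rho> (fst z) * (indicator {-A..A} (snd z) * g (snd z)))"
      using kb by (intro AE_I2) (auto simp: split_beta')
  qed
  from lborel_pair.Fubini_integral[of "\<lambda>x y. k (x, y)"] this
  have "(LBINT y. LBINT x. k (x, y)) = (LBINT x. LBINT y. k (x, y))" by simp
  moreover have "(LBINT y. k (x, y)) = primitive g x * deriv \<rho> x" for x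
    by (simp add: k_def primitive_def)
  moreover have "(LBINT x. k (x, y)) = - (g y * \<rho> y)" for y
  proof -
    have "(LBINT x. k (x, y)) = (LBINT x. g y * (indicator {y..} x * deriv \<rho> x) - (indicator {..0} y * g y) * deriv \<rho> x)"
      by (intro Bochner_Integration.integral_cong refl) (auto simp: k_def indicator_def)
    also have "\<dots> = (LBINT x. g y * (indicator {y..} x * deriv \<rho> x)) - (LBINT x. (indicator {..0} y * g y) * deriv \<rho> x)"
      using integrable_mult_indicator[OF _ i1, of "{y..}"] by (intro Bochner_Integration.integral_diff integrable_mult_right i1) auto
    also have "\<dots> = - (g y * \<rho> y)"
      by (simp add: test_integral_tail[OF t] test_integral_deriv[OF t])
    finally show ?thesis .
  qed
  ultimately show ?thesis by simp
qed

lemma test_function_primitive: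
  assumes t: "test_function \<kappa>" and z: "(LBINT x. \<kappa> x) = 0"
  obtains \<rho> where "test_function \<rho>" "deriv \<rho> = \<kappa>"
proof -
  obtain A where A: "A > 0" "\<And>x. \<kappa> x \<noteq> 0 \<Longrightarrow> \<bar>x\<bar> < A" using test_functionD(4)[OF t] by auto
  have l: "loc_integrable \<kappa>" by (intro loc_integrableI_continuous test_functionD(3) t)
  define \<rho> where "\<rho> = (\<lambda>x. primitive \<kappa> x - primitive \<kappa> (-A))"
  have d: "(\<rho> has_real_derivative \<kappa> x) (at x)" for x
    unfolding \<rho>_def using DERIV_diff[OF primitive_deriv[OF test_functionD(3)[OF t]] DERIV_const] by simp
  have dr: "deriv \<rho> = \<kappa>" using d DERIV_imp_deriv by blast
  have "test_function \<rho>"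
  proof (rule test_functionI)
    show "C_k k \<rho>" for k
      using C_k_Suc_imp[OF C_k_Suc_real[OF d, of k]] t by (simp add: test_function_def)
    fix x assume x: "\<rho> x \<noteq> 0"
    show "norm x \<le> A"
    proof (rule ccontr)
      assume "\<not> norm x \<le> A"
      then consider "x < -A" | "x > A" by force
      then have "\<rho> x = 0"
      proof cases
        case 1
        have "integral {x..-A} \<kappa> = integral {x..-A} (\<lambda>_. 0)"
          by (rule integral_cong) (use A in \<open>force\<close>)
        with 1 show ?thesis using primitive_diff[OF l, of x "-A"] by (simp add: \<rho>_def)
      next
        case 2
        have "integral {-A..x} \<kappa> = (LBINT y. indicator {-A..x} y * \<kappa> y)" by (rule loc_integrable_HK[OF l])
        also have "\<dots> = (LBINT y. \<kappa> y)"
        proof (intro Bochner_Integration.integral_cong refl)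
          show "indicator {-A..x} y * \<kappa> y = \<kappa> y" for y
            using A(2)[of y] 2 by (cases "\<kappa> y = 0") (auto simp: indicator_def)
        qed
        finally show ?thesis using primitive_diff[OF l, of "-A" x] 2 A z by (simp add: \<rho>_def)
      qed
      with x show False by simp
    qed
  qed
  with dr show thesis using that by blast
qed

lemma bump_LINT: "(LBINT x. bump x) = 1"
proof -
  have "(LBINT x. bump x) = (LBINT x. indicator {0..1} x * bump x)"
    by (intro Bochner_Integration.integral_cong refl) (metis bump_outside indicator_simps(1) indicator_simps(2) atLeastAtMost_iff le_cases mult_cancel_right1 mult_eq_0_iff mult_1)
  also have "\<dots> = integral {0..1} bump"
    by (rule loc_integrable_HK(2)[symmetric]) (intro loc_integrableI_continuous bump_cont)
  finally show ?thesis by (simp add: bump_integral)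
qed

lemma test_function_lincomb:
  fixes f g :: "real \<Rightarrow> real"
  assumes "test_function f" "test_function g"
  shows "test_function (\<lambda>x. f x + c * g x)"
proof -
  obtain A where A: "A>0" "\<And>x. f x \<noteq> 0 \<Longrightarrow> \<bar>x\<bar> < A" using test_functionD(4)[OF assms(1)] by auto
  obtain B where B: "B>0" "\<And>x. g x \<noteq> 0 \<Longrightarrow> \<bar>x\<bar> < B" using test_functionD(4)[OF assms(2)] by auto
  show ?thesis
  proof (rule test_functionI[where A="A + B"])
    show "C_k k (\<lambda>x. f x + c * g x)" for k
      using assms by (intro C_k_add C_k_cmult) (auto simp: test_function_def)
    show "norm x \<le> A + B" if "f x + c * g x \<noteq> 0" for x
      using that A(1) A(2)[of x] B(1) B(2)[of x] by (cases "f x = 0") auto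
  qed
qed

text \<open>A test function with vanishing integral is the derivative of a test function, and every test
  function has vanishing integral after a multiple of \<open>bump\<close> is subtracted.\<close>

lemma du_Bois_Reymond:
  assumes D: "loc_integrable D" and z: "\<And>\<rho>. test_function \<rho> \<Longrightarrow> (LBINT x. D x * deriv \<rho> x) = 0"
  shows "\<exists>c. AE x in lborel. D x = c"
proof -
  define c where "c = (LBINT x. D x * bump x)"
  have ci: "loc_integrable (\<lambda>_. 1)" by (intro loc_integrableI_continuous continuous_intros)
  have "AE x in lborel. D x - c = 0"
  proof (rule fundamental_lemma)
    show "loc_integrable (\<lambda>x. D x - c)"
      by (intro loc_integrable_diff D loc_integrableI_continuous continuous_intros)
    fix \<kappa> :: "real \<Rightarrow> real" assume k: "test_function \<kappa>"
    define m where "m = (LBINT x. \<kappa> x)"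
    have ik: "integrable lborel \<kappa>" using loc_integrable_test[OF ci k] by simp
    have ib: "integrable lborel bump" using loc_integrable_test[OF ci test_function_bump] by simp
    have t: "test_function (\<lambda>x. \<kappa> x + (- m) * bump x)" by (intro test_function_lincomb k test_function_bump)
    have "(LBINT x. \<kappa> x + (- m) * bump x) = 0"
      using ik ib by (simp add: m_def bump_LINT)
    from test_function_primitive[OF t this] obtain \<rho> where "test_function \<rho>" "deriv \<rho> = (\<lambda>x. \<kappa> x + (- m) * bump x)" .
    with z[of \<rho>] have "0 = (LBINT x. D x * (\<kappa> x + (- m) * bump x))" by simp
    also have "\<dots> = (LBINT x. D x * \<kappa> x + (- m) * (D x * bump x))"
      by (intro Bochner_Integration.integral_cong refl) (auto simp: algebra_simps)
    also have "\<dots> = (LBINT x. D x * \<kappa> x) - m * c"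
      using loc_integrable_test[OF D k] loc_integrable_test[OF D test_function_bump] by (simp add: c_def)
    finally have "(LBINT x. D x * \<kappa> x) = c * m" by simp
    then show "(LBINT x. (D x - c) * \<kappa> x) = 0"
      using loc_integrable_test[OF D k] ik by (simp add: left_diff_distrib m_def)
  qed
  then show ?thesis by (intro exI[of _ c]) simp
qed

lemma weak_deriv_unique:
  assumes "has_weak_deriv_L2 f g" "has_weak_deriv_L2 f h"
  shows "AE x in lborel. g x = h x"
proof -
  have g: "loc_integrable g" "loc_integrable h" using assms by (auto simp: has_weak_deriv_L2_def intro: loc_integrableI_L2)
  have "AE x in lborel. g x - h x = 0"
  proof (rule fundamental_lemma)
    show "loc_integrable (\<lambda>x. g x - h x)" by (intro loc_integrable_diff g)
    show "(LBINT x. (g x - h x) * \<rho> x) = 0" if "test_function \<rho>" for \<rho>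
      using assms that loc_integrable_test[OF _ that] g by (simp add: has_weak_deriv_L2_def left_diff_distrib)
  qed
  then show ?thesis by simp
qed

lemma H1_continuous_representative:
  assumes f: "in_L2 f" and g: "has_weak_deriv_L2 f g"
  shows "\<exists>c. AE x in lborel. f x = primitive g x + c"
proof -
  have gl: "loc_integrable g" using g by (auto simp: has_weak_deriv_L2_def intro: loc_integrableI_L2)
  have fl: "loc_integrable f" by (rule loc_integrableI_L2[OF f])
  have pl: "loc_integrable (primitive g)" by (intro loc_integrableI_continuous primitive_continuous gl)
  have "\<exists>c. AE x in lborel. f x - primitive g x = c"
  proof (rule du_Bois_Reymond)
    show "loc_integrable (\<lambda>x. f x - primitive g x)" by (intro loc_integrable_diff fl pl)
    show "(LBINT x. (f x - primitive g x) * deriv \<rho> x) = 0" if t: "test_function \<rho>" for \<rho>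
      using g t primitive_by_parts[OF gl t] loc_integrable_test[OF _ test_functionD(2)[OF t]] fl pl
      by (simp add: has_weak_deriv_L2_def left_diff_distrib)
  qed
  then obtain c where "AE x in lborel. f x - primitive g x = c" by blast
  then have "AE x in lborel. f x = primitive g x + c" by eventually_elim simp
  then show ?thesis by blast
qed

section \<open>Calculus of curves in $L^2$\<close>

definition L2_cont :: "(real \<Rightarrow> real \<Rightarrow> real) \<Rightarrow> real \<Rightarrow> bool" where
  "L2_cont A t \<longleftrightarrow> ((\<lambda>s. norm_L2 (\<lambda>x. A s x - A t x)) \<longlongrightarrow> 0) (at t)"

lemma tendsto_at_shift: "(f \<longlongrightarrow> L) (at t) \<longleftrightarrow> ((\<lambda>h. f (t + h)) \<longlongrightarrow> L) (at 0)" for t :: real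
  by (rule iffI, erule LIM_offset_zero, erule LIM_offset_zero_cancel)

lemma squeeze0_eventually:
  assumes "(g \<longlongrightarrow> 0) F" "\<forall>\<^sub>F s in F. f s \<le> g s" "\<And>s. 0 \<le> f s"
  shows "(f \<longlongrightarrow> (0::real)) F"
  using assms(1) by (rule tendsto_sandwich[rotated 2, OF tendsto_const]) (use assms in auto)

lemma squeeze0:
  assumes "(g \<longlongrightarrow> 0) F" "\<And>s. f s \<le> g s" "\<And>s. 0 \<le> f s"
  shows "(f \<longlongrightarrow> (0::real)) F"
  by (rule squeeze0_eventually[OF assms(1)]) (use assms in auto)

lemma squeeze0_at:
  assumes "(g \<longlongrightarrow> 0) (at a)" "\<And>s. s \<noteq> a \<Longrightarrow> f s \<le> g s" "\<And>s. 0 \<le> f s"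
  shows "(f \<longlongrightarrow> (0::real)) (at a)"
  by (rule squeeze0_eventually[OF assms(1)]) (use assms in \<open>auto simp: eventually_at_filter\<close>)

lemma L2_cont_add:
  assumes "\<And>s. in_L2 (A s)" "\<And>s. in_L2 (B s)" "L2_cont A t" "L2_cont B t"
  shows "L2_cont (\<lambda>s x. A s x + B s x) t"
  unfolding L2_cont_def
proof (rule squeeze0)
  show "((\<lambda>s. norm_L2 (\<lambda>x. A s x - A t x) + norm_L2 (\<lambda>x. B s x - B t x)) \<longlongrightarrow> 0) (at t)"
    using tendsto_add[OF assms(3,4)[unfolded L2_cont_def]] by simp
  show "norm_L2 (\<lambda>x. A s x + B s x - (A t x + B t x)) \<le> norm_L2 (\<lambda>x. A s x - A t x) + norm_L2 (\<lambda>x. B s x - B t x)" for s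
    using norm_L2_triangle[OF in_L2_diff[OF assms(1)[of s] assms(1)[of t]] in_L2_diff[OF assms(2)[of s] assms(2)[of t]]]
    by (simp add: algebra_simps)
qed (rule norm_L2_nonneg)

lemma L2_cont_cmult: 
  assumes "L2_cont A t" shows "L2_cont (\<lambda>s x. c * A s x) t"
proof -
  have "norm_L2 (\<lambda>x. c * A s x - c * A t x) = \<bar>c\<bar> * norm_L2 (\<lambda>x. A s x - A t x)" for s
    using norm_L2_cmult[of c "\<lambda>x. A s x - A t x"] by (simp add: right_diff_distrib)
  then show ?thesis using tendsto_mult_right_zero[OF assms[unfolded L2_cont_def], of "\<bar>c\<bar>"] by (simp add: L2_cont_def)
qed

lemma L2_cont_norm:
  assumes "\<And>s. in_L2 (A s)" "L2_cont A t"
  shows "isCont (\<lambda>s. norm_L2 (A s)) t"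
proof -
  have "\<bar>norm_L2 (A s) - norm_L2 (A t)\<bar> \<le> norm_L2 (\<lambda>x. A s x - A t x)" for s
    using norm_L2_triangle[OF in_L2_diff[OF assms(1)[of s] assms(1)[of t]] assms(1)[of t]]
      norm_L2_triangle[OF in_L2_diff[OF assms(1)[of t] assms(1)[of s]] assms(1)[of s]]
      norm_L2_diff_commute[of "A s" "A t"] by simp
  then have "((\<lambda>s. \<bar>norm_L2 (A s) - norm_L2 (A t)\<bar>) \<longlongrightarrow> 0) (at t)"
    by (intro squeeze0_eventually[OF assms(2)[unfolded L2_cont_def]]) auto
  then have "((\<lambda>s. norm_L2 (A s) - norm_L2 (A t)) \<longlongrightarrow> 0) (at t)"
    by (rule tendsto_rabs_zero_cancel)
  then show ?thesis unfolding isCont_def by (rule LIM_zero_cancel)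
qed

text \<open>Minkowski's inequality for an integral over a bounded interval. The function \<open>s \<mapsto> H s x\<close> may fail to be square
  integrable for exceptional \<open>x\<close>; there the pointwise Cauchy-Schwarz bound holds because its right
  hand side is infinite.\<close>

lemma L2_average:
  fixes H :: "real \<Rightarrow> real \<Rightarrow> real"
  assumes Hm: "(\<lambda>z. H (fst z) (snd z)) \<in> borel_measurable (borel \<Otimes>\<^sub>M borel)" and ab: "a < b"
    and HL: "\<And>s. s \<in> {a..b} \<Longrightarrow> in_L2 (H s)" and HK: "\<And>s. s \<in> {a..b} \<Longrightarrow> norm_L2 (H s) \<le> K"
  shows "in_L2 (\<lambda>x. LBINT s. indicator {a..b} s * H s x)"
    and "norm_L2 (\<lambda>x. LBINT s. indicator {a..b} s * H s x) \<le> (b - a) * K"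
proof -
  note [measurable] = Hm
  have Hm1: "(\<lambda>s. H s x) \<in> borel_measurable borel" for x
    using measurable_compose[OF measurable_Pair1'[of x borel borel] Hm] 
    measurable_compose[OF measurable_Pair2'[of x borel borel] Hm] by simp
  have Hm2: "(\<lambda>z. H (snd z) (fst z)) \<in> borel_measurable (borel \<Otimes>\<^sub>M borel)"
    using measurable_compose[OF measurable_pair_swap' Hm] by (simp add: case_prod_beta')
  note [measurable] = Hm1 Hm2
  have K: "0 \<le> K" using HK[of a] norm_L2_nonneg[of "H a"] ab by simp
  define I where "I = (\<lambda>x. LBINT s. indicator {a..b} s * H s x)"
  have [measurable]: "I \<in> borel_measurable borel"
  proof -
    have "(\<lambda>(x, s). indicator {a..b} s * H s x) \<in> borel_measurable (borel \<Otimes>\<^sub>M lborel)"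
      using Hm2 by (simp add: case_prod_beta') measurable
    then show ?thesis unfolding I_def by (rule lborel.borel_measurable_lebesgue_integral)
  qed
  have pt: "ennreal ((I x)\<^sup>2) \<le> ennreal (b - a) * (\<integral>\<^sup>+s. ennreal ((indicator {a..b} s * H s x)\<^sup>2) \<partial>lborel)" for x
  proof (cases "integrable lborel (\<lambda>s. (indicator {a..b} s * H s x)\<^sup>2)")
    case True
    then have L: "in_L2 (\<lambda>s. indicator {a..b} s * H s x)" by (simp add: in_L2_def)
    note Li = in_L2_Icc[of a b]
    have "I x = (LBINT s. indicator {a..b} s * (indicator {a..b} s * H s x))"
      unfolding I_def by (intro Bochner_Integration.integral_cong) (auto simp: indicator_def)
    then have "\<bar>I x\<bar> \<le> norm_L2 (indicator {a..b}) * norm_L2 (\<lambda>s. indicator {a..b} s * H s x)"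
      using Cauchy_Schwarz_L2[OF Li L] by simp
    then have "\<bar>I x\<bar>\<^sup>2 \<le> (norm_L2 (indicator {a..b}) * norm_L2 (\<lambda>s. indicator {a..b} s * H s x))\<^sup>2"
      by (intro power_mono) auto
    then have "(I x)\<^sup>2 \<le> (norm_L2 (indicator {a..b}))\<^sup>2 * (norm_L2 (\<lambda>s. indicator {a..b} s * H s x))\<^sup>2"
      by (simp only: power_mult_distrib power2_abs)
    also have "(norm_L2 (indicator {a..b}))\<^sup>2 = b - a" using ab by (simp add: norm_L2_Icc)
    finally have "ennreal ((I x)\<^sup>2) \<le> ennreal ((b - a) * (LBINT s. (indicator {a..b} s * H s x)\<^sup>2))"
      by (intro ennreal_leI) (simp add: norm_L2_square)
    also have "\<dots> = ennreal (b - a) * (\<integral>\<^sup>+s. ennreal ((indicator {a..b} s * H s x)\<^sup>2) \<partial>lborel)"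
      using ab by (subst nn_integral_eq_integral[OF True]) (auto simp: ennreal_mult)
    finally show ?thesis .
  next
    case False
    then have "(\<integral>\<^sup>+s. ennreal ((indicator {a..b} s * H s x)\<^sup>2) \<partial>lborel) = \<infinity>"
      by (subst (asm) integrable_iff_bounded) (auto simp: less_top[symmetric])
    then show ?thesis using ab by (simp add: ennreal_mult_top)
  qed
  have "(\<integral>\<^sup>+x. ennreal ((I x)\<^sup>2) \<partial>lborel) \<le> (\<integral>\<^sup>+x. ennreal (b - a) * (\<integral>\<^sup>+s. ennreal ((indicator {a..b} s * H s x)\<^sup>2) \<partial>lborel) \<partial>lborel)"
    by (intro nn_integral_mono pt)
  also have "\<dots> = ennreal (b - a) * (\<integral>\<^sup>+x. (\<integral>\<^sup>+s. ennreal ((indicator {a..b} s * H s x)\<^sup>2) \<partial>lborel) \<partial>lborel)"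
    by (intro nn_integral_cmult) measurable
  also have "(\<integral>\<^sup>+x. (\<integral>\<^sup>+s. ennreal ((indicator {a..b} s * H s x)\<^sup>2) \<partial>lborel) \<partial>lborel)
      = (\<integral>\<^sup>+s. (\<integral>\<^sup>+x. ennreal ((indicator {a..b} s * H s x)\<^sup>2) \<partial>lborel) \<partial>lborel)"
    by (intro lborel_pair.Fubini') measurable
  also have "\<dots> \<le> (\<integral>\<^sup>+s. ennreal (K\<^sup>2) * indicator {a..b} s \<partial>lborel)"
  proof (intro nn_integral_mono)
    fix s show "(\<integral>\<^sup>+x. ennreal ((indicator {a..b} s * H s x)\<^sup>2) \<partial>lborel) \<le> ennreal (K\<^sup>2) * indicator {a..b} s"
    proof (cases "s \<in> {a..b}")
      case True
      have "(\<integral>\<^sup>+x. ennreal ((H s x)\<^sup>2) \<partial>lborel) = ennreal ((norm_L2 (H s))\<^sup>2)"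
        unfolding norm_L2_square by (intro nn_integral_eq_integral in_L2_sq HL True) auto
      also have "\<dots> \<le> ennreal (K\<^sup>2)"
        by (intro ennreal_leI power_mono HK True norm_L2_nonneg)
      finally show ?thesis using True by simp
    qed simp
  qed
  also have "\<dots> = ennreal (K\<^sup>2) * ennreal (b - a)"
    using ab by (subst nn_integral_cmult) auto
  finally have "(\<integral>\<^sup>+x. ennreal ((I x)\<^sup>2) \<partial>lborel) \<le> ennreal (b - a) * (ennreal (K\<^sup>2) * ennreal (b - a))"
    by (simp add: mult_left_mono)
  also have "\<dots> = ennreal ((b - a) * (K\<^sup>2 * (b - a)))"
    using ab by (subst ennreal_mult, simp, simp, subst ennreal_mult) auto
  also have "(b - a) * (K\<^sup>2 * (b - a)) = ((b - a) * K)\<^sup>2" by (simp add: power2_eq_square)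
  finally have *: "(\<integral>\<^sup>+x. ennreal ((I x)\<^sup>2) \<partial>lborel) \<le> ennreal (((b - a) * K)\<^sup>2)" .
  have i: "integrable lborel (\<lambda>x. (I x)\<^sup>2)"
    by (rule integrableI_bounded) (use * in \<open>auto simp: top.extremum_strict intro: order.strict_trans1\<close>)
  then show "in_L2 (\<lambda>x. LBINT s. indicator {a..b} s * H s x)" by (simp add: in_L2_def I_def[symmetric])
  have "(norm_L2 I)\<^sup>2 \<le> ((b - a) * K)\<^sup>2"
    using * nn_integral_eq_integral[OF i] by (simp add: norm_L2_square)
  then have "norm_L2 I \<le> (b - a) * K"
    by (rule power2_le_imp_le) (use K ab in auto)
  then show "norm_L2 (\<lambda>x. LBINT s. indicator {a..b} s * H s x) \<le> (b - a) * K" by (simp add: I_def)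
qed

section \<open>Translations of functions with a square integrable derivative\<close>

text \<open>The function \<open>F\<close> is a continuous function with weak derivative \<open>g\<close>
  in $L^2(\mathbb{R})$. It may lie outside $L^2(\mathbb{R})$ itself.\<close>

definition is_L2_primitive :: "(real \<Rightarrow> real) \<Rightarrow> (real \<Rightarrow> real) \<Rightarrow> bool" where
  "is_L2_primitive F g \<longleftrightarrow> in_L2 g \<and> (\<forall>a b. a \<le> b \<longrightarrow> F b - F a = integral {a..b} g)"

lemma integral_shift_interval:
  assumes "loc_integrable g"
  shows "(LBINT s. indicator {0..h} s * g (s + x)) = integral {x..x+h} g"
proof -
  have "(LBINT s. indicator {0..h} s * g (s + x)) = (LBINT s. indicator {x..x+h} (s + x) * g (s + x))"
    by (intro Bochner_Integration.integral_cong) (auto simp: indicator_def)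
  also have "\<dots> = (LBINT s. indicator {x..x+h} s * g s)" by (rule integral_shift)
  finally show ?thesis using loc_integrable_HK(2)[OF assms] by simp
qed

lemma is_L2_primitive_bound:
  assumes "is_L2_primitive F g" "a \<le> b"
  shows "\<bar>F b - F a\<bar> \<le> sqrt (b - a) * norm_L2 g"
proof -
  have g: "in_L2 g" and l: "loc_integrable g" using assms loc_integrableI_L2 by (auto simp: is_L2_primitive_def)
  have "F b - F a = (LBINT x. indicator {a..b} x * g x)"
    using assms loc_integrable_HK(2)[OF l] by (simp add: is_L2_primitive_def)
  then have "\<bar>F b - F a\<bar> \<le> norm_L2 (indicator {a..b}) * norm_L2 g"
    using Cauchy_Schwarz_L2[OF in_L2_Icc g] by simp
  also have "norm_L2 (indicator {a..b}) = sqrt (b - a)" by (rule norm_L2_Icc[OF assms(2)])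
  finally show ?thesis .
qed

lemma is_L2_primitive_continuous:
  assumes "is_L2_primitive F g" shows "continuous_on UNIV F"
proof -
  have l: "loc_integrable g" using assms loc_integrableI_L2 by (auto simp: is_L2_primitive_def)
  have "F x = primitive g x + (F 0 - primitive g 0)" for x
    by (rule eq_primitive[OF l]) (use assms in \<open>simp add: is_L2_primitive_def\<close>)
  then have eq: "F = (\<lambda>x. primitive g x + (F 0 - primitive g 0))" by (rule ext)
  show ?thesis by (subst eq) (intro continuous_intros primitive_continuous l)
qed

text \<open>The translation difference quotient of \<open>F\<close> is an average of translates of its derivative,
  so it inherits the modulus of continuity of the latter. With \<open>k = 0\<close> this says that translation is
  Lipschitz on \<open>F\<close>, with \<open>k = 1\<close> that it is differentiable.\<close>

lemma shift_quotient:
  assumes F: "is_L2_primitive F g" and h: "0 < h"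
    and K: "\<And>s. 0 \<le> s \<Longrightarrow> s \<le> h \<Longrightarrow> norm_L2 (\<lambda>x. g (x + s) - k * g x) \<le> K"
  shows "in_L2 (\<lambda>x. F (x + h) - F x - h * (k * g x))" "norm_L2 (\<lambda>x. F (x + h) - F x - h * (k * g x)) \<le> h * K"
proof -
  have g: "in_L2 g" and l: "loc_integrable g" using F loc_integrableI_L2 by (auto simp: is_L2_primitive_def)
  have [measurable]: "g \<in> borel_measurable borel" by (rule in_L2_meas[OF g])
  have eq: "(LBINT s. indicator {0..h} s * (g (x + s) - k * g x)) = F (x + h) - F x - h * (k * g x)" for x
  proof -
    have "integrable lborel (\<lambda>s. indicator {0..h} s * g (s + x))"
    proof -
      have "integrable lborel (\<lambda>s. indicator {x..x+h} (s + x) * g (s + x))"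
        using integrable_shift[OF loc_integrable_Icc[OF l, unfolded set_integrable_def, of x "x+h"], of x] by simp
      moreover have "indicator {x..x+h} (s + x) = (indicator {0..h} s :: real)" for s by (auto simp: indicator_def)
      ultimately show ?thesis by simp
    qed
    moreover have "integrable lborel (\<lambda>s. indicator {0..h} s * (k * g x))"
      by (rule integrable_Icc)
    moreover have "(LBINT s. indicator {0..h} s * (g (x + s) - k * g x)) = (LBINT s. indicator {0..h} s * g (s + x) - indicator {0..h} s * (k * g x))"
      by (intro Bochner_Integration.integral_cong) (auto simp: algebra_simps)
    ultimately have "(LBINT s. indicator {0..h} s * (g (x + s) - k * g x)) = (LBINT s. indicator {0..h} s * g (s + x)) - (LBINT s. indicator {0..h} s * (k * g x))"
      by simp
    also have "\<dots> = integral {x..x+h} g - h * (k * g x)" using h by (simp add: integral_shift_interval[OF l])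
    also have "integral {x..x+h} g = F (x + h) - F x" using F h by (simp add: is_L2_primitive_def)
    finally show ?thesis .
  qed
  have "(\<lambda>z. g (snd z + fst z) - k * g (snd z)) \<in> borel_measurable (borel \<Otimes>\<^sub>M borel)" by measurable
  from L2_average[OF this h, where K=K] K in_L2_diff[OF in_L2_shift[OF g] in_L2_cmult[OF g]]
  show "in_L2 (\<lambda>x. F (x + h) - F x - h * (k * g x))" "norm_L2 (\<lambda>x. F (x + h) - F x - h * (k * g x)) \<le> h * K"
    by (simp_all add: eq)
qed

lemma shift_quotient_abs:
  assumes F: "is_L2_primitive F g"
    and K: "\<And>s. \<bar>s\<bar> \<le> \<bar>h\<bar> \<Longrightarrow> norm_L2 (\<lambda>x. g (x + s) - k * g x) \<le> K"
    and k: "k = 0 \<or> k = 1"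
  shows "in_L2 (\<lambda>x. F (x + h) - F x - h * (k * g x))" "norm_L2 (\<lambda>x. F (x + h) - F x - h * (k * g x)) \<le> \<bar>h\<bar> * K"
proof -
  have *: "in_L2 (\<lambda>x. F (x + h) - F x - h * (k * g x)) \<and> norm_L2 (\<lambda>x. F (x + h) - F x - h * (k * g x)) \<le> \<bar>h\<bar> * K"
  proof (cases h "0::real" rule: linorder_cases)
    case greater
    then show ?thesis using shift_quotient[OF F greater, of k K] K by simp
  next
    case equal
    then show ?thesis by (simp add: in_L2_zero norm_L2_def)
  next
    case less
    have g: "in_L2 g" using F by (simp add: is_L2_primitive_def)
    \<comment> \<open>Negative shifts reduce to positive ones by reflection.\<close>
    define R where "R = (\<lambda>x. - F (- x))"
    have R: "is_L2_primitive R (\<lambda>x. g (- x))"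
    proof -
      have "in_L2 (\<lambda>x. g (- x))"
        using lborel_integrable_real_affine[OF in_L2_sq[OF g], of "-1" 0] in_L2_meas[OF g] by (simp add: in_L2_def)
      moreover have "R b - R a = integral {a..b} (\<lambda>x. g (- x))" if "a \<le> b" for a b
        using F that Henstock_Kurzweil_Integration.integral_reflect_real[of b a "\<lambda>x. g (- x)"] by (simp add: R_def is_L2_primitive_def)
      ultimately show ?thesis by (simp add: is_L2_primitive_def)
    qed
    have refl: "norm_L2 (\<lambda>x. f (- x)) = norm_L2 f" for f :: "real \<Rightarrow> real"
      unfolding norm_L2_def using lborel_integral_real_affine[of "-1" "\<lambda>x. (f x)\<^sup>2" 0] by simp
    have reflL: "in_L2 (\<lambda>x. f (- x))" if "in_L2 f" for f :: "real \<Rightarrow> real"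
      using lborel_integrable_real_affine[OF in_L2_sq[OF that], of "-1" 0] in_L2_meas[OF that] by (simp add: in_L2_def)
    have K': "norm_L2 (\<lambda>x. g (- (x + s)) - k * g (- x)) \<le> K" if "0 \<le> s" "s \<le> - h" for s
      using K[of "- s"] that less refl[of "\<lambda>x. g (x + - s) - k * g x"] by (simp add: algebra_simps)
    have hp: "0 < - h" using less by simp
    define f where "f = (\<lambda>x. R (x + - h) - R x - - h * (k * g (- x)))"
    have f: "in_L2 f" unfolding f_def by (rule shift_quotient(1)[OF R hp]) (rule K')
    have f': "norm_L2 f \<le> - h * K" unfolding f_def by (rule shift_quotient(2)[OF R hp]) (rule K')
    have 2: "in_L2 (\<lambda>x. f (- x))" "norm_L2 (\<lambda>x. f (- x)) \<le> - h * K"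
      using reflL[OF f] f' by (simp_all only: refl)
    have "(\<lambda>x. f (- x)) = (\<lambda>x. - (F (x + h) - F x - h * (k * g x)))"
      by (simp add: f_def R_def algebra_simps)
    then show ?thesis
      using 2 in_L2_minus[of "\<lambda>x. - (F (x + h) - F x - h * (k * g x))"] norm_L2_minus[of "\<lambda>x. (F (x + h) - F x - h * (k * g x))"] less
      by simp
  qed
  from * show "in_L2 (\<lambda>x. F (x + h) - F x - h * (k * g x))" "norm_L2 (\<lambda>x. F (x + h) - F x - h * (k * g x)) \<le> \<bar>h\<bar> * K"
    by blast+
qed

lemma shift_lipschitz:
  assumes "is_L2_primitive F g"
  shows "norm_L2 (\<lambda>x. F (x + h) - F x) \<le> \<bar>h\<bar> * norm_L2 g"
  using shift_quotient_abs(2)[OF assms, of h 0 "norm_L2 g"] by (simp add: norm_L2_shift)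

lemma test_is_L2_primitive:
  assumes "test_function \<rho>" shows "is_L2_primitive \<rho> (deriv \<rho>)"
  unfolding is_L2_primitive_def
proof (intro conjI allI impI)
  show "in_L2 (deriv \<rho>)" by (intro in_L2_test test_functionD assms)
  show "\<rho> b - \<rho> a = integral {a..b} (deriv \<rho>)" if "a \<le> b" for a b
    by (rule FTC_integral[symmetric, OF that test_functionD(1)[OF assms]])
qed

section \<open>Differentiable curves\<close>

lemma has_time_derivI_shift:
  assumes F: "is_L2_primitive F g" and g: "L2_cont (\<lambda>h x. g (x + h)) 0"
  shows "((\<lambda>h. norm_L2 (\<lambda>x. (F (x + h) - F x) / h - g x)) \<longlongrightarrow> 0) (at 0)"
proof (rule tendstoI)
  fix e :: real assume "e > 0"
  then have "\<forall>\<^sub>F h in at 0. norm_L2 (\<lambda>x. g (x + h) - g x) < e / 2"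
    using g order_tendstoD(2)[of _ 0 "at 0" "e/2"] unfolding L2_cont_def by fastforce
  then obtain d where d: "d > 0" "\<And>h. h \<noteq> 0 \<Longrightarrow> \<bar>h\<bar> < d \<Longrightarrow> norm_L2 (\<lambda>x. g (x + h) - g x) < e / 2"
    unfolding eventually_at by (auto simp: dist_real_def)
  have d': "norm_L2 (\<lambda>x. g (x + h) - 1 * g x) \<le> e / 2" if "\<bar>h\<bar> < d" for h
    using d(2)[of h] that \<open>e > 0\<close> by (cases "h = 0") (auto simp: norm_L2_def)
  have "norm_L2 (\<lambda>x. (F (x + h) - F x) / h - g x) < e" if h: "h \<noteq> 0" "\<bar>h\<bar> < d" for h
  proof -
    have "norm_L2 (\<lambda>x. F (x + h) - F x - h * (1 * g x)) \<le> \<bar>h\<bar> * (e / 2)"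
      using h d' by (intro shift_quotient_abs(2)[OF F]) auto
    moreover have "(F (x + h) - F x) / h - g x = (1/h) * (F (x + h) - F x - h * (1 * g x))" for x
      using h by (simp add: field_simps)
    ultimately have "norm_L2 (\<lambda>x. (F (x + h) - F x) / h - g x) \<le> \<bar>1/h\<bar> * (\<bar>h\<bar> * (e / 2))"
      by (simp only: norm_L2_cmult) (intro mult_left_mono, auto)
    also have "\<dots> = e / 2" using h by simp
    finally show ?thesis using \<open>e > 0\<close> by simp
  qed
  then show "\<forall>\<^sub>F h in at 0. dist (norm_L2 (\<lambda>x. (F (x + h) - F x) / h - g x)) 0 < e"
    unfolding eventually_at by (intro exI[of _ d]) (use d in \<open>auto simp: dist_real_def norm_L2_nonneg\<close>)
qed

lemma L2_cont_time_deriv: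
  assumes A: "\<And>s. in_L2 (A s)" and d: "has_time_deriv A A' t"
  shows "L2_cont A t"
proof -
  have A': "in_L2 A'" using d by (simp add: has_time_deriv_def)
  have "((\<lambda>h. norm_L2 (\<lambda>x. A (t + h) x - A t x)) \<longlongrightarrow> 0) (at 0)"
  proof (rule squeeze0_at)
    have "((\<lambda>h. \<bar>h\<bar> * (norm_L2 (\<lambda>x. (A (t + h) x - A t x) / h - A' x) + norm_L2 A')) \<longlongrightarrow> \<bar>0\<bar> * (0 + norm_L2 A')) (at 0)"
      using d unfolding has_time_deriv_def by (intro tendsto_intros) auto
    then show "((\<lambda>h. \<bar>h\<bar> * (norm_L2 (\<lambda>x. (A (t + h) x - A t x) / h - A' x) + norm_L2 A')) \<longlongrightarrow> 0) (at 0)" by simp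
    show "norm_L2 (\<lambda>x. A (t + h) x - A t x) \<le> \<bar>h\<bar> * (norm_L2 (\<lambda>x. (A (t + h) x - A t x) / h - A' x) + norm_L2 A')" if "h \<noteq> 0" for h
    proof -
      have "norm_L2 (\<lambda>x. ((A (t + h) x - A t x) / h - A' x) + A' x) \<le> norm_L2 (\<lambda>x. (A (t + h) x - A t x) / h - A' x) + norm_L2 A'"
        by (intro norm_L2_triangle in_L2_diff in_L2_divide A A')
      moreover have "A (t + h) x - A t x = h * (((A (t + h) x - A t x) / h - A' x) + A' x)" for x using that by simp
      ultimately show ?thesis using norm_L2_cmult[of h "\<lambda>x. ((A (t + h) x - A t x) / h - A' x) + A' x"]
        by (simp add: mult_left_mono)
    qed
  qed (rule norm_L2_nonneg)
  then show ?thesis unfolding L2_cont_def by (subst tendsto_at_shift)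
qed

text \<open>Energy densities are products of curves in $L^2(\mathbb{R})$, so $L^1(\mathbb{R})$ is the
  space in which they are differentiable.\<close>

definition has_L1_deriv :: "(real \<Rightarrow> real \<Rightarrow> real) \<Rightarrow> (real \<Rightarrow> real) \<Rightarrow> real \<Rightarrow> bool" where
  "has_L1_deriv Q Q' t \<longleftrightarrow> (\<forall>s. integrable lborel (Q s)) \<and> integrable lborel Q' \<and>
     ((\<lambda>h. LBINT x. \<bar>(Q (t + h) x - Q t x) / h - Q' x\<bar>) \<longlongrightarrow> 0) (at 0)"

lemma has_L1_deriv_mult:
  assumes A: "\<And>s. in_L2 (A s)" and B: "\<And>s. in_L2 (B s)"
    and dA: "has_time_deriv A A' t" and dB: "has_time_deriv B B' t"
  shows "has_L1_deriv (\<lambda>s x. A s x * B s x) (\<lambda>x. A' x * B t x + A t x * B' x) t"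
  unfolding has_L1_deriv_def
proof (intro conjI allI)
  have A': "in_L2 A'" and B': "in_L2 B'" using dA dB by (auto simp: has_time_deriv_def)
  show "integrable lborel (\<lambda>x. A s x * B s x)" for s by (intro in_L2_mult A B)
  show "integrable lborel (\<lambda>x. A' x * B t x + A t x * B' x)" by (intro Bochner_Integration.integrable_add in_L2_mult A B A' B')
  \<comment> \<open>The three error terms are those of the usual proof of the product rule.\<close>
  define a where "a = (\<lambda>h x. (A (t + h) x - A t x) / h - A' x)"
  define b where "b = (\<lambda>h x. (B (t + h) x - B t x) / h - B' x)"
  have aL: "in_L2 (a h)" "in_L2 (b h)" for h unfolding a_def b_def by (intro in_L2_diff in_L2_divide A B A' B')+
  have a0: "((\<lambda>h. norm_L2 (a h)) \<longlongrightarrow> 0) (at 0)" "((\<lambda>h. norm_L2 (b h)) \<longlongrightarrow> 0) (at 0)"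
    using dA dB unfolding a_def b_def has_time_deriv_def by auto
  have cB: "((\<lambda>h. norm_L2 (\<lambda>x. B (t + h) x - B t x)) \<longlongrightarrow> 0) (at 0)"
    using L2_cont_time_deriv[OF B dB] unfolding L2_cont_def by (subst (asm) tendsto_at_shift)
  have nB: "((\<lambda>h. norm_L2 (B (t + h))) \<longlongrightarrow> norm_L2 (B t)) (at 0)"
    using L2_cont_norm[OF B L2_cont_time_deriv[OF B dB]] unfolding isCont_def by (subst (asm) tendsto_at_shift)
  show "((\<lambda>h. LBINT x. \<bar>(A (t + h) x * B (t + h) x - A t x * B t x) / h - (A' x * B t x + A t x * B' x)\<bar>) \<longlongrightarrow> 0) (at 0)"
  proof (rule squeeze0_at)
    have "((\<lambda>h. norm_L2 (a h) * norm_L2 (B (t + h)) + norm_L2 A' * norm_L2 (\<lambda>x. B (t + h) x - B t x) + norm_L2 (A t) * norm_L2 (b h)) \<longlongrightarrow> 0 * norm_L2 (B t) + norm_L2 A' * 0 + norm_L2 (A t) * 0) (at 0)"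
      by (intro tendsto_intros a0 cB nB)
    then show "((\<lambda>h. norm_L2 (a h) * norm_L2 (B (t + h)) + norm_L2 A' * norm_L2 (\<lambda>x. B (t + h) x - B t x) + norm_L2 (A t) * norm_L2 (b h)) \<longlongrightarrow> 0) (at 0)" by simp
    show "(LBINT x. \<bar>(A (t + h) x * B (t + h) x - A t x * B t x) / h - (A' x * B t x + A t x * B' x)\<bar>)
       \<le> norm_L2 (a h) * norm_L2 (B (t + h)) + norm_L2 A' * norm_L2 (\<lambda>x. B (t + h) x - B t x) + norm_L2 (A t) * norm_L2 (b h)" if "h \<noteq> 0" for h
    proof -
      have L: "in_L2 (\<lambda>x. B (t + h) x - B t x)" by (intro in_L2_diff B)
      have "(A (t + h) x * B (t + h) x - A t x * B t x) / h - (A' x * B t x + A t x * B' x) = a h x * B (t + h) x + A' x * (B (t + h) x - B t x) + A t x * b h x" for x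
        using that by (simp add: a_def b_def field_simps)
      then have "(LBINT x. \<bar>(A (t + h) x * B (t + h) x - A t x * B t x) / h - (A' x * B t x + A t x * B' x)\<bar>)
         = (LBINT x. \<bar>a h x * B (t + h) x + A' x * (B (t + h) x - B t x) + A t x * b h x\<bar>)" by simp
      also have "\<dots> \<le> (LBINT x. \<bar>a h x * B (t + h) x\<bar> + \<bar>A' x * (B (t + h) x - B t x)\<bar> + \<bar>A t x * b h x\<bar>)"
        by (intro integral_mono integrable_abs Bochner_Integration.integrable_add in_L2_mult A B A' B' aL L) auto
      also have "\<dots> = (LBINT x. \<bar>a h x * B (t + h) x\<bar>) + (LBINT x. \<bar>A' x * (B (t + h) x - B t x)\<bar>) + (LBINT x. \<bar>A t x * b h x\<bar>)"
        by (simp only: integrable_abs in_L2_mult A B A' B' aL L Bochner_Integration.integral_add Bochner_Integration.integrable_add)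
      also have "\<dots> \<le> norm_L2 (a h) * norm_L2 (B (t + h)) + norm_L2 A' * norm_L2 (\<lambda>x. B (t + h) x - B t x) + norm_L2 (A t) * norm_L2 (b h)"
        by (intro add_mono Cauchy_Schwarz_L2_abs A B A' B' aL L)
      finally show ?thesis .
    qed
  qed simp
qed

lemma L2_cont_inner:
  assumes A: "\<And>s. in_L2 (A s)" and B: "\<And>s. in_L2 (B s)" and cA: "L2_cont A t" and cB: "L2_cont B t"
  shows "((\<lambda>s. LBINT x. \<bar>A s x * B s x - A t x * B t x\<bar>) \<longlongrightarrow> 0) (at t)"
proof (rule squeeze0)
  have "((\<lambda>s. norm_L2 (\<lambda>x. A s x - A t x) * norm_L2 (B s) + norm_L2 (A t) * norm_L2 (\<lambda>x. B s x - B t x)) \<longlongrightarrow> 0 * norm_L2 (B t) + norm_L2 (A t) * 0) (at t)"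
    using cA cB L2_cont_norm[OF B cB] unfolding L2_cont_def isCont_def by (intro tendsto_intros)
  then show "((\<lambda>s. norm_L2 (\<lambda>x. A s x - A t x) * norm_L2 (B s) + norm_L2 (A t) * norm_L2 (\<lambda>x. B s x - B t x)) \<longlongrightarrow> 0) (at t)" by simp
  show "(LBINT x. \<bar>A s x * B s x - A t x * B t x\<bar>) \<le> norm_L2 (\<lambda>x. A s x - A t x) * norm_L2 (B s) + norm_L2 (A t) * norm_L2 (\<lambda>x. B s x - B t x)" for s
  proof -
    have L: "in_L2 (\<lambda>x. A s x - A t x)" "in_L2 (\<lambda>x. B s x - B t x)" by (intro in_L2_diff A B)+
    have "(LBINT x. \<bar>A s x * B s x - A t x * B t x\<bar>) \<le> (LBINT x. \<bar>(A s x - A t x) * B s x\<bar> + \<bar>A t x * (B s x - B t x)\<bar>)"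
    proof (intro integral_mono integrable_abs Bochner_Integration.integrable_add Bochner_Integration.integrable_diff in_L2_mult A B L)
      fix x show "\<bar>A s x * B s x - A t x * B t x\<bar> \<le> \<bar>(A s x - A t x) * B s x\<bar> + \<bar>A t x * (B s x - B t x)\<bar>"
        using abs_triangle_ineq[of "(A s x - A t x) * B s x" "A t x * (B s x - B t x)"] by (simp add: algebra_simps)
    qed
    also have "\<dots> = (LBINT x. \<bar>(A s x - A t x) * B s x\<bar>) + (LBINT x. \<bar>A t x * (B s x - B t x)\<bar>)"
      by (intro Bochner_Integration.integral_add integrable_abs in_L2_mult A B L)
    also have "\<dots> \<le> norm_L2 (\<lambda>x. A s x - A t x) * norm_L2 (B s) + norm_L2 (A t) * norm_L2 (\<lambda>x. B s x - B t x)"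
      by (intro add_mono Cauchy_Schwarz_L2_abs A B L)
    finally show ?thesis .
  qed
qed simp

lemma isCont_integral_L1:
  fixes Q :: "real \<Rightarrow> real \<Rightarrow> real"
  assumes "\<And>s. integrable lborel (Q s)" "((\<lambda>s. LBINT x. \<bar>Q s x - Q t x\<bar>) \<longlongrightarrow> 0) (at t)"
  shows "isCont (\<lambda>s. LBINT x. Q s x) t"
proof -
  have "\<bar>(LBINT x. Q s x) - (LBINT x. Q t x)\<bar> \<le> (LBINT x. \<bar>Q s x - Q t x\<bar>)" for s
  proof -
    have "(LBINT x. Q s x) - (LBINT x. Q t x) = (LBINT x. Q s x - Q t x)" using assms(1) by simp
    then show ?thesis by (simp add: integral_abs_bound)
  qed
  then have "((\<lambda>s. \<bar>(LBINT x. Q s x) - (LBINT x. Q t x)\<bar>) \<longlongrightarrow> 0) (at t)"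
    by (intro squeeze0_eventually[OF assms(2)]) auto
  then have "((\<lambda>s. (LBINT x. Q s x) - (LBINT x. Q t x)) \<longlongrightarrow> 0) (at t)"
    by (rule tendsto_rabs_zero_cancel)
  then show ?thesis unfolding isCont_def by (rule LIM_zero_cancel)
qed

lemma integrable_bounded_mult:
  fixes f R :: "real \<Rightarrow> real"
  assumes "integrable lborel R" "f \<in> borel_measurable borel" "\<And>x. \<bar>f x\<bar> \<le> C"
  shows "integrable lborel (\<lambda>x. f x * R x)"
proof (rule Bochner_Integration.integrable_bound)
  show "integrable lborel (\<lambda>x. C * R x)" using assms by simp
  show "(\<lambda>x. f x * R x) \<in> borel_measurable lborel" using assms by simp
  have "\<bar>f x\<bar> \<le> \<bar>C\<bar>" for x using assms(3)[of x] by linarith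
  then show "AE x in lborel. norm (f x * R x) \<le> norm (C * R x)" by (auto simp: abs_mult intro!: AE_I2 mult_right_mono)
qed

text \<open>The weight may move with time. Being uniformly Lipschitz in time, its difference quotients
  are bounded, so dominated convergence applies to them.\<close>

lemma has_L1_deriv_weight:
  fixes \<Phi> :: "real \<Rightarrow> real \<Rightarrow> real"
  assumes Q: "has_L1_deriv Q Q' t"
    and m: "\<And>s. \<Phi> s \<in> borel_measurable borel" and B: "\<And>s x. \<bar>\<Phi> s x\<bar> \<le> B"
    and L: "\<And>s r x. \<bar>\<Phi> s x - \<Phi> r x\<bar> \<le> B * \<bar>s - r\<bar>"
    and d: "\<And>x. ((\<lambda>s. \<Phi> s x) has_real_derivative \<Phi>' x) (at t)" 
  shows "((\<lambda>s. LBINT x. \<Phi> s x * Q s x) has_real_derivative (LBINT x. \<Phi>' x * Q t x + \<Phi> t x * Q' x)) (at t)"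
proof -
  have iQ: "integrable lborel (Q s)" and iQ': "integrable lborel Q'" for s using Q by (auto simp: has_L1_deriv_def)
  have [measurable]: "Q s \<in> borel_measurable borel" "Q' \<in> borel_measurable borel" for s
    using iQ[of s] iQ' by (simp_all)
  note [measurable] = m
  have B0: "0 \<le> B" using B[of 0 0] by simp
  define q where "q = (\<lambda>h x. (\<Phi> (t + h) x - \<Phi> t x) / h)"
  have qb: "\<bar>q h x\<bar> \<le> B" for h x
    using L[of "t+h" x t] B0 by (cases "h = 0") (auto simp: q_def abs_divide divide_le_eq)
  have qm [measurable]: "q h \<in> borel_measurable borel" for h unfolding q_def by measurable
  have ql: "((\<lambda>h. q h x) \<longlongrightarrow> \<Phi>' x) (at 0)" for x
    using d[of x] unfolding DERIV_def q_def .
  have Phi'm [measurable]: "\<Phi>' \<in> borel_measurable borel"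
  proof (rule borel_measurable_LIMSEQ_real)
    show "(\<lambda>n. q (1 / real (Suc n)) x) \<longlonglongrightarrow> \<Phi>' x" for x
      by (rule filterlim_compose[OF ql[of x]]) (use LIMSEQ_Suc[OF lim_1_over_n[where 'a=real]] in \<open>auto simp: filterlim_at\<close>)
  qed (rule qm)
  have Phi'b: "\<bar>\<Phi>' x\<bar> \<le> B" for x
    by (rule tendsto_upperbound[OF tendsto_rabs[OF ql[of x]]]) (auto simp: qb)
  have l1: "((\<lambda>h. LBINT x. q h x * Q t x) \<longlongrightarrow> (LBINT x. \<Phi>' x * Q t x)) (at 0)"
    unfolding tendsto_at_iff_sequentially comp_def
  proof (intro allI impI)
    fix X :: "nat \<Rightarrow> real" assume X: "\<forall>i. X i \<in> UNIV - {0}" "X \<longlonglongrightarrow> 0"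
    show "(\<lambda>n. LBINT x. q (X n) x * Q t x) \<longlonglongrightarrow> (LBINT x. \<Phi>' x * Q t x)"
    proof (rule integral_dominated_convergence[where w="\<lambda>x. B * \<bar>Q t x\<bar>"])
      show "integrable lborel (\<lambda>x. B * \<bar>Q t x\<bar>)" using iQ by simp
      show "AE x in lborel. (\<lambda>n. q (X n) x * Q t x) \<longlonglongrightarrow> \<Phi>' x * Q t x"
        using ql[unfolded tendsto_at_iff_sequentially comp_def] X by (intro AE_I2 tendsto_mult_right) blast
      show "AE x in lborel. norm (q (X n) x * Q t x) \<le> B * \<bar>Q t x\<bar>" for n
        using qb by (auto simp: abs_mult intro!: AE_I2 mult_right_mono)
    qed auto
  qed
  define r where "r = (\<lambda>h x. (Q (t + h) x - Q t x) / h - Q' x)"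
  have ir: "integrable lborel (r h)" for h unfolding r_def using iQ iQ' by simp
  have r0: "((\<lambda>h. LBINT x. \<bar>r h x\<bar>) \<longlongrightarrow> 0) (at 0)" using Q by (simp add: has_L1_deriv_def r_def)
  have e1: "((\<lambda>h. LBINT x. \<Phi> (t + h) x * r h x) \<longlongrightarrow> 0) (at 0)"
  proof (rule tendsto_rabs_zero_cancel, rule squeeze0)
    show "((\<lambda>h. B * (LBINT x. \<bar>r h x\<bar>)) \<longlongrightarrow> 0) (at 0)" using tendsto_mult_right_zero[OF r0] .
    show "\<bar>LBINT x. \<Phi> (t + h) x * r h x\<bar> \<le> B * (LBINT x. \<bar>r h x\<bar>)" for h
    proof -
      have "\<bar>LBINT x. \<Phi> (t + h) x * r h x\<bar> \<le> (LBINT x. \<bar>\<Phi> (t + h) x * r h x\<bar>)" by (rule integral_abs_bound)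
      also have "\<dots> \<le> (LBINT x. B * \<bar>r h x\<bar>)"
        using ir by (intro integral_mono integrable_abs integrable_bounded_mult[OF ir m B] integrable_mult_right) (auto simp: abs_mult intro: mult_right_mono B)
      finally show ?thesis by simp
    qed
  qed simp
  have e2: "((\<lambda>h. LBINT x. (\<Phi> (t + h) x - \<Phi> t x) * Q' x) \<longlongrightarrow> 0) (at 0)"
  proof (rule tendsto_rabs_zero_cancel, rule squeeze0)
    have "((\<lambda>h. (B * \<bar>h\<bar>) * (LBINT x. \<bar>Q' x\<bar>)) \<longlongrightarrow> (B * \<bar>0\<bar>) * (LBINT x. \<bar>Q' x\<bar>)) (at 0)" by (intro tendsto_intros)
    then show "((\<lambda>h. (B * \<bar>h\<bar>) * (LBINT x. \<bar>Q' x\<bar>)) \<longlongrightarrow> 0) (at 0)" by simp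
    show "\<bar>LBINT x. (\<Phi> (t + h) x - \<Phi> t x) * Q' x\<bar> \<le> (B * \<bar>h\<bar>) * (LBINT x. \<bar>Q' x\<bar>)" for h
    proof -
      have "\<bar>LBINT x. (\<Phi> (t + h) x - \<Phi> t x) * Q' x\<bar> \<le> (LBINT x. \<bar>(\<Phi> (t + h) x - \<Phi> t x) * Q' x\<bar>)" by (rule integral_abs_bound)
      also have "\<dots> \<le> (LBINT x. (B * \<bar>h\<bar>) * \<bar>Q' x\<bar>)"
        using iQ' L[of "t+h" _ t] by (intro integral_mono integrable_abs integrable_bounded_mult[where C="B * \<bar>h\<bar>", OF iQ'] integrable_mult_right) (auto simp: abs_mult intro: mult_right_mono)
      finally show ?thesis by simp
    qed
  qed simp
  have eq: "((LBINT x. \<Phi> (t + h) x * Q (t + h) x) - (LBINT x. \<Phi> t x * Q t x)) / h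
     = (LBINT x. q h x * Q t x) + (LBINT x. \<Phi> (t + h) x * r h x) + (LBINT x. (\<Phi> (t + h) x - \<Phi> t x) * Q' x) + (LBINT x. \<Phi> t x * Q' x)" if "h \<noteq> 0" for h
  proof -
    have i: "integrable lborel (\<lambda>x. q h x * Q t x)" "integrable lborel (\<lambda>x. \<Phi> (t + h) x * r h x)"
      "integrable lborel (\<lambda>x. (\<Phi> (t + h) x - \<Phi> t x) * Q' x)" "integrable lborel (\<lambda>x. \<Phi> t x * Q' x)"
      using L[of "t+h" _ t] by (auto intro!: integrable_bounded_mult[OF iQ _ qb] integrable_bounded_mult[OF ir m B] integrable_bounded_mult[OF iQ' m B] integrable_bounded_mult[where C="B * \<bar>h\<bar>", OF iQ'])
    have "(\<Phi> (t + h) x * Q (t + h) x - \<Phi> t x * Q t x) / h = q h x * Q t x + \<Phi> (t + h) x * r h x + (\<Phi> (t + h) x - \<Phi> t x) * Q' x + \<Phi> t x * Q' x" for x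
      using that by (simp add: q_def r_def field_simps)
    then have "(LBINT x. (\<Phi> (t + h) x * Q (t + h) x - \<Phi> t x * Q t x) / h) = (LBINT x. q h x * Q t x + \<Phi> (t + h) x * r h x + (\<Phi> (t + h) x - \<Phi> t x) * Q' x + \<Phi> t x * Q' x)"
      by simp
    also have "\<dots> = (LBINT x. q h x * Q t x) + (LBINT x. \<Phi> (t + h) x * r h x) + (LBINT x. (\<Phi> (t + h) x - \<Phi> t x) * Q' x) + (LBINT x. \<Phi> t x * Q' x)"
      using i by (simp only: Bochner_Integration.integral_add Bochner_Integration.integrable_add)
    finally show ?thesis using integrable_bounded_mult[OF iQ m B] by simp
  qed
  have "((\<lambda>h. (LBINT x. q h x * Q t x) + (LBINT x. \<Phi> (t + h) x * r h x) + (LBINT x. (\<Phi> (t + h) x - \<Phi> t x) * Q' x) + (LBINT x. \<Phi> t x * Q' x))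
     \<longlongrightarrow> (LBINT x. \<Phi>' x * Q t x) + 0 + 0 + (LBINT x. \<Phi> t x * Q' x)) (at 0)"
    by (intro tendsto_intros l1 e1 e2)
  then have "((\<lambda>h. ((LBINT x. \<Phi> (t + h) x * Q (t + h) x) - (LBINT x. \<Phi> t x * Q t x)) / h) \<longlongrightarrow> (LBINT x. \<Phi>' x * Q t x) + 0 + 0 + (LBINT x. \<Phi> t x * Q' x)) (at 0)"
    by (rule Lim_transform_eventually) (simp add: eventually_at_filter eq)
  moreover have "(LBINT x. \<Phi>' x * Q t x) + 0 + 0 + (LBINT x. \<Phi> t x * Q' x) = (LBINT x. \<Phi>' x * Q t x + \<Phi> t x * Q' x)"
    using integrable_bounded_mult[OF iQ Phi'm Phi'b] integrable_bounded_mult[OF iQ' m B] by simp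
  ultimately show ?thesis unfolding DERIV_def by simp
qed

lemma has_L1_deriv_integral:
  assumes Q: "has_L1_deriv Q Q' t"
  shows "((\<lambda>s. LBINT x. Q s x) has_real_derivative (LBINT x. Q' x)) (at t)"
  using has_L1_deriv_weight[OF Q, of "\<lambda>_ _. 1" 1 "\<lambda>_. 0"] by simp

section \<open>The nonlinearity and its potential\<close>

definition nl :: "real \<Rightarrow> real \<Rightarrow> real" where "nl p x = \<bar>x\<bar> powr (p - 1) * x"
definition pot :: "real \<Rightarrow> real \<Rightarrow> real" where "pot p x = \<bar>x\<bar> powr (p + 1) / (p + 1)"

lemma nl_0 [simp]: "nl p 0 = 0" by (simp add: nl_def)

lemma nl_deriv:
  assumes p: "p > 1"
  shows "(nl p has_real_derivative p * \<bar>x\<bar> powr (p - 1)) (at x)"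
proof -
  have pos: "(nl p has_real_derivative p * \<bar>x\<bar> powr (p - 1)) (at x)" if "x > 0" for x
  proof -
    have "((\<lambda>y. y powr p) has_real_derivative p * x powr (p - 1)) (at x)"
      by (rule has_real_derivative_powr[OF that])
    then have "(nl p has_real_derivative p * x powr (p - 1)) (at x)"
      by (rule has_field_derivative_transform_within_open[where S="{0<..}"])
        (use that in \<open>auto simp: nl_def powr_mult_base mult.commute\<close>)
    with that show ?thesis by simp
  qed
  show ?thesis
  proof (cases x "0::real" rule: linorder_cases)
    case greater then show ?thesis by (rule pos)
  next
    case less
    then have "(nl p has_real_derivative p * \<bar>- x\<bar> powr (p - 1)) (at (- x))" by (intro pos) simp
    then have "((\<lambda>y. nl p (- y)) has_real_derivative p * \<bar>- x\<bar> powr (p - 1) * (- 1)) (at x)"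
      by (rule DERIV_chain2) (auto intro!: derivative_eq_intros)
    from DERIV_minus[OF this] show ?thesis by (simp add: nl_def[abs_def])
  next
    case equal
    have "((\<lambda>h. \<bar>h\<bar> powr (p - 1)) \<longlongrightarrow> \<bar>0\<bar> powr (p - 1)) (at 0)"
      using p by (intro tendsto_powr' tendsto_intros) auto
    then have 0: "((\<lambda>h. \<bar>h\<bar> powr (p - 1)) \<longlongrightarrow> 0) (at 0)" using p by simp
    have "((\<lambda>h. (nl p (0 + h) - nl p 0) / h) \<longlongrightarrow> 0) (at 0)"
      by (rule Lim_transform_eventually[OF 0]) (auto simp: nl_def eventually_at_filter)
    then show ?thesis using equal p unfolding DERIV_def by simp
  qed
qed

lemma nl_mult_self: "nl p x * x = (p + 1) * pot p x" if "p > 1"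
  using that by (cases "x = 0") (auto simp: nl_def pot_def powr_diff powr_add power2_eq_square[symmetric] abs_if)

lemma pot_eq: "pot p x = nl p x * x / (p + 1)" if "p > 1"
  using nl_mult_self[OF that, of x] that by (simp add: field_simps)

lemma pot_deriv:
  assumes p: "p > 1" shows "(pot p has_real_derivative nl p x) (at x)"
proof -
  have "((\<lambda>x. nl p x * x / (p + 1)) has_real_derivative (p * \<bar>x\<bar> powr (p - 1) * x + 1 * nl p x) / (p + 1)) (at x)"
    by (intro DERIV_cdivide DERIV_mult nl_deriv p DERIV_ident)
  moreover have "(p * \<bar>x\<bar> powr (p - 1) * x + 1 * nl p x) / (p + 1) = nl p x"
    using p by (simp add: nl_def field_simps)
  moreover have "(\<lambda>x. nl p x * x / (p + 1)) = pot p" using pot_eq[OF p] by auto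
  ultimately show ?thesis by simp
qed

lemma pot_nonneg: "p > 1 \<Longrightarrow> 0 \<le> pot p x" by (simp add: pot_def)

lemma nl_cont: "p > 1 \<Longrightarrow> continuous_on A (nl p)"
  using DERIV_isCont[OF nl_deriv] by (auto intro: continuous_at_imp_continuous_on)

lemma pot_cont: "p > 1 \<Longrightarrow> continuous_on A (pot p)"
  using DERIV_isCont[OF pot_deriv] by (auto intro: continuous_at_imp_continuous_on)

lemma nl_lipschitz:
  assumes p: "p > 1" and ab: "\<bar>a\<bar> \<le> M" "\<bar>b\<bar> \<le> M"
  shows "\<bar>nl p b - nl p a\<bar> \<le> (p * M powr (p - 1)) * \<bar>b - a\<bar>"
proof -
  have *: "\<bar>nl p b - nl p a\<bar> \<le> (p * M powr (p - 1)) * \<bar>b - a\<bar>" if "a < b" "\<bar>a\<bar> \<le> M" "\<bar>b\<bar> \<le> M" for a b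
  proof -
    from MVT2[OF that(1) nl_deriv[OF p]]
    obtain z where z: "a < z" "z < b" "nl p b - nl p a = (b - a) * (p * \<bar>z\<bar> powr (p - 1))" by auto
    have "\<bar>z\<bar> powr (p - 1) \<le> M powr (p - 1)" using z that p by (intro powr_mono2) auto
    then have "(b - a) * (p * \<bar>z\<bar> powr (p - 1)) \<le> (b - a) * (p * M powr (p - 1))"
      using that p by (intro mult_left_mono) auto
    moreover have "0 \<le> (b - a) * (p * \<bar>z\<bar> powr (p - 1))" using that p by simp
    ultimately show ?thesis using z that by (simp add: mult.commute)
  qed
  show ?thesis
  proof (cases a b rule: linorder_cases)
    case less then show ?thesis by (intro * ab)
  next
    case equal then show ?thesis by simp
  next
    case greater
    then show ?thesis using *[OF _ ab(2,1)] by (simp add: abs_minus_commute)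
  qed
qed

text \<open>As \<open>p > 1\<close>, the nonlinearity is Lipschitz on bounded sets, so the remainder of
  first order is quadratic. Hence the potential energy of a curve that is differentiable in
  $L^2(\mathbb{R})$ is differentiable.\<close>

lemma pot_taylor:
  assumes p: "p > 1" and ab: "\<bar>a\<bar> \<le> M" "\<bar>b\<bar> \<le> M"
  shows "\<bar>pot p b - pot p a - nl p a * (b - a)\<bar> \<le> (p * M powr (p - 1)) * (b - a)\<^sup>2"
proof (cases "a = b")
  case False
  then have "min a b < max a b" by auto
  from MVT2[OF this pot_deriv[OF p]]
  obtain z where z: "min a b < z" "z < max a b" "pot p (max a b) - pot p (min a b) = (max a b - min a b) * nl p z" by auto
  then have e: "pot p b - pot p a = (b - a) * nl p z"
    by (auto simp: min_def max_def algebra_simps split: if_splits)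
  have zM: "\<bar>z\<bar> \<le> M" "\<bar>z - a\<bar> \<le> \<bar>b - a\<bar>" using z(1,2) ab by auto
  have "\<bar>pot p b - pot p a - nl p a * (b - a)\<bar> = \<bar>nl p z - nl p a\<bar> * \<bar>b - a\<bar>"
    unfolding e by (simp add: abs_mult[symmetric] algebra_simps)
  also have "\<dots> \<le> ((p * M powr (p - 1)) * \<bar>z - a\<bar>) * \<bar>b - a\<bar>"
    by (intro mult_right_mono nl_lipschitz p ab zM) auto
  also have "\<dots> \<le> ((p * M powr (p - 1)) * \<bar>b - a\<bar>) * \<bar>b - a\<bar>"
    using p zM by (intro mult_right_mono mult_left_mono) auto
  finally show ?thesis by (simp add: power2_eq_square abs_mult[symmetric] mult.assoc)
qed simp

lemma L2_cont_nl:
  assumes p: "p > 1" and A: "\<And>s. in_L2 (A s)" and c: "L2_cont A t" and M: "\<forall>\<^sub>F s in at t. \<forall>x. \<bar>A s x\<bar> \<le> M" "\<And>x. \<bar>A t x\<bar> \<le> M"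
  shows "L2_cont (\<lambda>s x. nl p (A s x)) t"
  unfolding L2_cont_def
proof (rule squeeze0_eventually)
  show "((\<lambda>s. \<bar>p * M powr (p - 1)\<bar> * norm_L2 (\<lambda>x. A s x - A t x)) \<longlongrightarrow> 0) (at t)"
    using tendsto_mult_right_zero[OF c[unfolded L2_cont_def]] .
  show "\<forall>\<^sub>F s in at t. norm_L2 (\<lambda>x. nl p (A s x) - nl p (A t x)) \<le> \<bar>p * M powr (p - 1)\<bar> * norm_L2 (\<lambda>x. A s x - A t x)"
    using M(1)
  proof eventually_elim
    case (elim s)
    have [measurable]: "A s \<in> borel_measurable borel" for s by (rule in_L2_meas[OF A])
    have [measurable]: "nl p \<in> borel_measurable borel" by (intro borel_measurable_continuous_onI nl_cont p)
    have "norm_L2 (\<lambda>x. nl p (A s x) - nl p (A t x)) \<le> norm_L2 (\<lambda>x. (p * M powr (p - 1)) * (A s x - A t x))"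
    proof (rule norm_L2_mono)
      show "in_L2 (\<lambda>x. (p * M powr (p - 1)) * (A s x - A t x))" by (intro in_L2_cmult in_L2_diff A)
      show "AE x in lborel. \<bar>nl p (A s x) - nl p (A t x)\<bar> \<le> \<bar>(p * M powr (p - 1)) * (A s x - A t x)\<bar>"
        using nl_lipschitz[OF p M(2) elim[rule_format]] p by (simp add: abs_mult)
    qed simp
    then show ?case by (simp only: norm_L2_cmult)
  qed
qed (rule norm_L2_nonneg)

lemma in_L2_nl:
  assumes p: "p > 1" and A: "in_L2 A" and M: "\<And>x. \<bar>A x\<bar> \<le> M"
  shows "in_L2 (\<lambda>x. nl p (A x))"
proof (rule norm_L2_mono(1))
  show "in_L2 (\<lambda>x. (p * M powr (p - 1)) * A x)" by (intro in_L2_cmult A)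
  have [measurable]: "A \<in> borel_measurable borel" by (rule in_L2_meas[OF A])
  have [measurable]: "nl p \<in> borel_measurable borel" by (intro borel_measurable_continuous_onI nl_cont p)
  show "(\<lambda>x. nl p (A x)) \<in> borel_measurable borel" by simp
  have "0 \<le> M" using M[of 0] by simp
  then show "AE x in lborel. \<bar>nl p (A x)\<bar> \<le> \<bar>p * M powr (p - 1) * A x\<bar>"
    using nl_lipschitz[OF p _ M, of 0] p by (simp add: abs_mult)
qed

section \<open>Continuous representatives of a curve in the energy space\<close>

text \<open>Over an interval of unit length \<open>F\<close> varies by at most the norm of
  \<open>g\<close>, and its mean is at most its norm.\<close>

lemma is_L2_primitive_sup:
  assumes F: "is_L2_primitive F g" "in_L2 F"
  shows "\<bar>F x\<bar> \<le> norm_L2 F + norm_L2 g"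
proof -
  note Li = in_L2_Icc[of x "x + 1"] and iy = integrable_Icc[of x "x + 1"]
  have i2: "integrable lborel (\<lambda>y. indicator {x..x+1} y * \<bar>F y\<bar>)" by (intro in_L2_mult Li in_L2_abs F)
  have "\<bar>F x\<bar> = (LBINT y. indicator {x..x+1} y * \<bar>F x\<bar>)" by simp
  also have "\<dots> \<le> (LBINT y. indicator {x..x+1} y * \<bar>F y\<bar> + indicator {x..x+1} y * norm_L2 g)"
  proof (intro integral_mono iy Bochner_Integration.integrable_add i2)
    fix y
    have "\<bar>F x\<bar> \<le> \<bar>F y\<bar> + norm_L2 g" if y: "y \<in> {x..x+1}"
    proof -
      have "\<bar>F y - F x\<bar> \<le> sqrt (y - x) * norm_L2 g" using y by (intro is_L2_primitive_bound[OF F(1)]) auto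
      also have "\<dots> \<le> 1 * norm_L2 g" using y by (intro mult_right_mono norm_L2_nonneg) auto
      finally show ?thesis by simp
    qed
    then show "indicator {x..x+1} y * \<bar>F x\<bar> \<le> indicator {x..x+1} y * \<bar>F y\<bar> + indicator {x..x+1} y * norm_L2 g"
      by (auto simp: indicator_def)
  qed
  also have "\<dots> = (LBINT y. indicator {x..x+1} y * \<bar>F y\<bar>) + norm_L2 g"
    by (subst Bochner_Integration.integral_add[OF i2 iy]) simp
  also have "(LBINT y. indicator {x..x+1} y * \<bar>F y\<bar>) \<le> 1 * norm_L2 F"
    using Cauchy_Schwarz_L2[OF Li in_L2_abs[OF F(2)]] by (simp add: norm_L2_Icc norm_L2_abs)
  finally show ?thesis by simp
qed

lemma is_L2_primitive_diff:
  assumes "is_L2_primitive F g" "is_L2_primitive G h"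
  shows "is_L2_primitive (\<lambda>x. F x - G x) (\<lambda>x. g x - h x)"
proof -
  have L: "in_L2 g" "in_L2 h" using assms by (auto simp: is_L2_primitive_def)
  have *: "integral {a..b} (\<lambda>x. g x - h x) = integral {a..b} g - integral {a..b} h" for a b
    by (intro Henstock_Kurzweil_Integration.integral_diff loc_integrable_HK loc_integrableI_L2 L)
  have "(F b - G b) - (F a - G a) = integral {a..b} (\<lambda>x. g x - h x)" if "a \<le> b" for a b
  proof -
    have "F b - F a = integral {a..b} g" "G b - G a = integral {a..b} h"
      using assms that by (simp_all add: is_L2_primitive_def)
    with * show ?thesis by simp
  qed
  moreover have "in_L2 (\<lambda>x. g x - h x)" by (intro in_L2_diff L)
  ultimately show ?thesis by (simp add: is_L2_primitive_def)
qed

text \<open>A curve in the energy space: \<open>U t\<close> is the continuous representative of the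
  profile at time \<open>t\<close>, \<open>w\<close> is the time derivative and \<open>v\<close> the
  space derivative.\<close>

locale energy_curve =
  fixes p :: real and U w v :: "real \<Rightarrow> real \<Rightarrow> real"
  assumes p: "p > 1"
    and U_L2: "in_L2 (U t)" and w_L2: "in_L2 (w t)"
    and U_primitive: "is_L2_primitive (U t) (v t)"
    and U_deriv: "has_time_deriv U (w t) t"
    and w_cont: "L2_cont w t" and v_cont: "L2_cont v t"
begin

lemma v_L2: "in_L2 (v t)" using U_primitive by (simp add: is_L2_primitive_def)

lemma U_L2_cont: "L2_cont U t" by (rule L2_cont_time_deriv[OF U_L2 U_deriv])

lemma U_diff_sup: "\<bar>U s x - U t x\<bar> \<le> norm_L2 (\<lambda>x. U s x - U t x) + norm_L2 (\<lambda>x. v s x - v t x)"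
  by (rule is_L2_primitive_sup[OF is_L2_primitive_diff[OF U_primitive U_primitive] in_L2_diff[OF U_L2 U_L2]])

lemma U_sup: "\<bar>U t x\<bar> \<le> norm_L2 (U t) + norm_L2 (v t)"
  by (rule is_L2_primitive_sup[OF U_primitive U_L2])

lemma U_continuous: "continuous_on UNIV (\<lambda>z. U (fst z) (snd z))"
  unfolding continuous_on_eq_continuous_at[OF open_UNIV]
proof
  fix z :: "real \<times> real"
  define t x where "t = fst z" "x = snd z"
  define D where "D = (\<lambda>s. norm_L2 (\<lambda>x. U s x - U t x) + norm_L2 (\<lambda>x. v s x - v t x))"
  have "isCont D t"
    using tendsto_add[OF U_L2_cont[unfolded L2_cont_def, of t] v_cont[unfolded L2_cont_def, of t]]
    by (simp add: isCont_def D_def norm_L2_def)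
  then have D: "isCont (\<lambda>y. D (fst y)) z" unfolding t_x_def by (intro isCont_o2[of z fst D]) (auto intro: continuous_intros)
  have "D t = 0" by (simp add: D_def norm_L2_def)
  then have D0: "((\<lambda>y. D (fst y)) \<longlongrightarrow> 0) (at z)" using D by (simp add: isCont_def t_x_def)
  have 1: "((\<lambda>y. U (fst y) (snd y) - U t (snd y)) \<longlongrightarrow> 0) (at z)"
  proof (rule tendsto_rabs_zero_cancel, rule squeeze0_eventually[OF D0])
    show "\<forall>\<^sub>F y in at z. \<bar>U (fst y) (snd y) - U t (snd y)\<bar> \<le> D (fst y)"
      using U_diff_sup by (simp add: D_def)
  qed simp
  have "isCont (U t) x" using is_L2_primitive_continuous[OF U_primitive, of t] by (simp add: continuous_on_eq_continuous_at)
  then have "isCont (\<lambda>y. U t (snd y)) z" unfolding t_x_def by (intro isCont_o2[of z snd "U (fst z)"]) (auto intro: continuous_intros)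
  then have 2: "((\<lambda>y. U t (snd y)) \<longlongrightarrow> U t x) (at z)" by (simp add: isCont_def t_x_def)
  from tendsto_add[OF 1 2] show "isCont (\<lambda>z. U (fst z) (snd z)) z" by (simp add: isCont_def t_x_def)
qed

lemma U_continuous' [continuous_intros]:
  "continuous_on A f \<Longrightarrow> continuous_on A g \<Longrightarrow> continuous_on A (\<lambda>z. U (f z) (g z))"
  using continuous_on_compose2[OF U_continuous, of A "\<lambda>z. (f z, g z)"] by (auto intro: continuous_on_Pair)

lemma nl_continuous [continuous_intros]:
  "continuous_on A f \<Longrightarrow> continuous_on A (\<lambda>z. nl p (f z))"
  by (rule continuous_on_compose2[OF nl_cont[OF p, of UNIV]]) auto

lemma U_loc_bound: "\<exists>M. (\<forall>\<^sub>F s in at t. \<forall>x. \<bar>U s x\<bar> \<le> M) \<and> (\<forall>x. \<bar>U t x\<bar> \<le> M)"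
proof -
  have "isCont (\<lambda>s. norm_L2 (U s) + norm_L2 (v s)) t"
    by (intro continuous_intros L2_cont_norm U_L2 v_L2 U_L2_cont v_cont)
  then have "\<forall>\<^sub>F s in at t. norm_L2 (U s) + norm_L2 (v s) < norm_L2 (U t) + norm_L2 (v t) + 1"
    unfolding isCont_def by (rule order_tendstoD) simp
  then have "\<forall>\<^sub>F s in at t. \<forall>x. \<bar>U s x\<bar> \<le> norm_L2 (U t) + norm_L2 (v t) + 1"
    by (rule eventually_mono) (meson U_sup less_imp_le order_trans)
  moreover have "\<bar>U t x\<bar> \<le> norm_L2 (U t) + norm_L2 (v t) + 1" for x using U_sup[of t x] by linarith
  ultimately show ?thesis by blast
qed

lemma nl_L2: "in_L2 (\<lambda>x. nl p (U t x))"
  by (rule in_L2_nl[OF p U_L2 U_sup])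

lemma nl_L2_cont: "L2_cont (\<lambda>s x. nl p (U s x)) t"
  using U_loc_bound[of t] L2_cont_nl[OF p U_L2 U_L2_cont] by blast

end

section \<open>Transport of the null derivatives along characteristics\<close>

text \<open>The null derivatives \<open>w + \<sigma>v\<close> with \<open>\<sigma> =
  \<plusminus>1\<close> solve a transport equation whose source is the nonlinearity. In the frame
  \<open>y = x + \<sigma>t\<close> transport becomes an ordinary differential equation in
  \<open>t\<close> for each \<open>y\<close>, and its integrated form makes sense in the energy class
  since the source is a continuous function of \<open>(t, x)\<close>. This is the form in which the
  wave equation enters all later arguments.\<close>

locale wave_flow = energy_curve +
  assumes transport: "\<And>\<sigma> s t. \<sigma>\<^sup>2 = 1 \<Longrightarrow> s \<le> t \<Longrightarrow> AE y in lborel.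
    (w t (y - \<sigma> * t) + \<sigma> * v t (y - \<sigma> * t)) - (w s (y - \<sigma> * s) + \<sigma> * v s (y - \<sigma> * s))
     = - integral {s..t} (\<lambda>r. nl p (U r (y - \<sigma> * r)))"

lemma sigma_cases: "\<sigma>\<^sup>2 = 1 \<longleftrightarrow> \<sigma> = 1 \<or> \<sigma> = (-1::real)"
  using power2_eq_1_iff by auto

lemma has_time_deriv_translate:
  assumes F: "is_L2_primitive F g" and g: "L2_cont (\<lambda>h x. g (x + h)) 0" and s: "\<sigma>\<^sup>2 = 1"
  shows "has_time_deriv (\<lambda>t x. F (x + \<sigma> * t)) (\<lambda>x. \<sigma> * g (x + \<sigma> * t)) t"
proof -
  have L: "in_L2 g" using F by (simp add: is_L2_primitive_def)
  have s': "\<bar>\<sigma>\<bar> = 1" "\<sigma> * \<sigma> = 1" using s sigma_cases[of \<sigma>] by auto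
  have eq: "norm_L2 (\<lambda>x. (F (x + \<sigma> * (t + h)) - F (x + \<sigma> * t)) / h - \<sigma> * g (x + \<sigma> * t))
     = norm_L2 (\<lambda>x. (F (x + \<sigma> * h) - F x) / (\<sigma> * h) - g x)" for h
  proof -
    have "(F (x + \<sigma> * (t + h)) - F (x + \<sigma> * t)) / h - \<sigma> * g (x + \<sigma> * t)
       = \<sigma> * ((F ((x + \<sigma> * t) + \<sigma> * h) - F (x + \<sigma> * t)) / (\<sigma> * h) - g (x + \<sigma> * t))" for x
      using s' by (cases "h = 0") (auto simp: field_simps)
    then show ?thesis
      using norm_L2_shift[of "\<lambda>x. (F (x + \<sigma> * h) - F x) / (\<sigma> * h) - g x" "\<sigma> * t"] s'
      by (simp only: norm_L2_cmult)
  qed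
  have fl: "filterlim (\<lambda>h. \<sigma> * h) (at 0) (at 0)"
    unfolding filterlim_at using s' by (auto intro!: tendsto_eq_intros simp: eventually_at_filter)
  show ?thesis
    unfolding has_time_deriv_def eq
    using filterlim_compose[OF has_time_derivI_shift[OF F g] fl] in_L2_cmult[OF in_L2_shift[OF L]] by simp
qed

lemma test_shift_cont:
  assumes "test_function \<rho>" shows "L2_cont (\<lambda>h x. \<rho> (x + h)) 0"
  unfolding L2_cont_def
proof (rule squeeze0_eventually)
  show "((\<lambda>h. \<bar>h\<bar> * norm_L2 (deriv \<rho>)) \<longlongrightarrow> 0) (at 0)" by (auto intro!: tendsto_eq_intros)
  show "\<forall>\<^sub>F h in at 0. norm_L2 (\<lambda>x. \<rho> (x + h) - \<rho> (x + 0)) \<le> \<bar>h\<bar> * norm_L2 (deriv \<rho>)"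
    using shift_lipschitz[OF test_is_L2_primitive[OF assms]] by simp
qed (rule norm_L2_nonneg)

lemma test_time_deriv:
  assumes "test_function \<rho>" "\<sigma>\<^sup>2 = 1"
  shows "has_time_deriv (\<lambda>t x. \<rho> (x + \<sigma> * t)) (\<lambda>x. \<sigma> * deriv \<rho> (x + \<sigma> * t)) t"
  by (rule has_time_deriv_translate[OF test_is_L2_primitive test_shift_cont[OF test_functionD(2)]]) (use assms in auto)

lemma test_translate:
  fixes \<rho> :: "real \<Rightarrow> real"
  assumes "test_function \<rho>"
  shows "test_function (\<lambda>x. \<rho> (x + c))" "deriv (\<lambda>x. \<rho> (x + c)) = (\<lambda>x. deriv \<rho> (x + c))"
proof -
  obtain A where A: "A>0" "\<And>x. \<rho> x \<noteq> 0 \<Longrightarrow> \<bar>x\<bar> < A" using test_functionD(4)[OF assms] by auto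
  show "test_function (\<lambda>x. \<rho> (x + c))"
  proof (rule test_functionI[where A="A + \<bar>c\<bar>"])
    show "C_k k (\<lambda>x. \<rho> (x + c))" for k
      using assms by (intro C_k_pullback bounded_linear_ident) (simp add: test_function_def)
    show "norm x \<le> A + \<bar>c\<bar>" if "\<rho> (x + c) \<noteq> 0" for x using A(2)[OF that] by simp
  qed
  have "((\<lambda>x. \<rho> (x + c)) has_real_derivative deriv \<rho> (x + c)) (at x)" for x
    using DERIV_shift test_functionD(1)[OF assms] by blast
  then show "deriv (\<lambda>x. \<rho> (x + c)) = (\<lambda>x. deriv \<rho> (x + c))" using DERIV_imp_deriv by blast
qed

lemma continuous_AE_const:
  fixes f :: "real \<Rightarrow> real"
  assumes f: "continuous_on UNIV f" and AE: "AE x in lborel. f x = c"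
  shows "f x = c"
proof (rule ccontr)
  assume "f x \<noteq> c"
  have "open {x. f x \<noteq> c}"
    using open_Collect_neq[OF f continuous_on_const] .
  moreover have "negligible {x. f x \<noteq> c}"
  proof -
    obtain N where N: "\<And>x. x \<in> space lborel - N \<Longrightarrow> f x = c" "N \<in> null_sets lborel" by (rule AE_E3[OF AE]) blast
    have "N \<in> null_sets lebesgue" using N(2) by (rule null_sets_completionI)
    then have "negligible N" by (simp add: negligible_iff_null_sets)
    moreover have "{x. f x \<noteq> c} \<subseteq> N" using N(1) by auto
    ultimately show ?thesis by (rule negligible_subset)
  qed
  ultimately have "{x. f x \<noteq> c} = {}" using open_not_negligible by auto
  with \<open>f x \<noteq> c\<close> show False by auto
qed

text \<open>By the lemma of du Bois-Reymond \<open>W\<close> plus a primitive of \<open>F\<close> is constant almost everywhere, and by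
  continuity it is constant.\<close>

lemma distributional_derivative:
  assumes W: "continuous_on UNIV W" and F: "continuous_on UNIV F" and st: "s \<le> t"
    and z: "\<And>\<theta>. test_function \<theta> \<Longrightarrow> (LBINT r. W r * deriv \<theta> r) = (LBINT r. F r * \<theta> r)"
  shows "W t - W s = - integral {s..t} F"
proof -
  have l: "loc_integrable W" "loc_integrable F" using W F by (auto intro: loc_integrableI_continuous)
  have pc: "continuous_on UNIV (primitive F)" by (rule primitive_continuous[OF l(2)])
  have "\<exists>c. AE x in lborel. W x + primitive F x = c"
  proof (rule du_Bois_Reymond)
    show "loc_integrable (\<lambda>x. W x + primitive F x)" by (intro loc_integrable_add l loc_integrableI_continuous pc)
    fix \<theta> :: "real \<Rightarrow> real" assume t: "test_function \<theta>"
    note i = loc_integrable_test[OF _ test_functionD(2)[OF t]]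
    have "(LBINT x. (W x + primitive F x) * deriv \<theta> x) = (LBINT x. W x * deriv \<theta> x) + (LBINT x. primitive F x * deriv \<theta> x)"
      unfolding distrib_right by (intro Bochner_Integration.integral_add i l loc_integrableI_continuous pc)
    then show "(LBINT x. (W x + primitive F x) * deriv \<theta> x) = 0"
      using z[OF t] primitive_by_parts[OF l(2) t] by simp
  qed
  then obtain c where c: "AE x in lborel. W x + primitive F x = c" by blast
  have "W x + primitive F x = c" for x
    by (rule continuous_AE_const[OF _ c]) (intro continuous_intros W pc)
  from this[of s] this[of t] primitive_diff[OF l(2) st] show ?thesis by linarith
qed

context energy_curve
begin

lemma test_pairing_cont:
  assumes A: "\<And>s. in_L2 (A s)" and c: "\<And>t. L2_cont A t" and t: "test_function \<rho>" and s: "\<sigma>\<^sup>2 = 1"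
  shows "continuous_on UNIV (\<lambda>t. LBINT x. A t x * \<rho> (x + \<sigma> * t))"
proof -
  have R: "in_L2 (\<lambda>x. \<rho> (x + \<sigma> * t))" for t by (intro in_L2_shift in_L2_test t)
  have "isCont (\<lambda>t. LBINT x. A t x * \<rho> (x + \<sigma> * t)) t" for t
    by (rule isCont_integral_L1[OF in_L2_mult[OF A R] L2_cont_inner[OF A R c L2_cont_time_deriv[OF R test_time_deriv[OF assms(3,4)]]]])
  then show ?thesis by (simp add: continuous_on_eq_continuous_at)
qed

lemma by_parts_space:
  assumes t: "test_function \<rho>"
  shows "(LBINT x. U t x * deriv \<rho> x) = - (LBINT x. v t x * \<rho> x)"
proof -
  have l: "loc_integrable (v t)" by (rule loc_integrableI_L2[OF v_L2])
  have eq: "U t x = primitive (v t) x + (U t 0 - primitive (v t) 0)" for x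
    by (rule eq_primitive[OF l]) (use U_primitive[of t] in \<open>simp add: is_L2_primitive_def\<close>)
  note t' = test_functionD(2)[OF t]
  have i: "integrable lborel (\<lambda>x. primitive (v t) x * deriv \<rho> x)"
    by (intro loc_integrable_test t' loc_integrableI_continuous primitive_continuous l)
  have i2: "integrable lborel (deriv \<rho>)"
    using loc_integrable_test[OF loc_integrableI_continuous t', of "\<lambda>_. 1"] by simp
  show ?thesis
    by (subst eq) (simp add: distrib_right i i2 primitive_by_parts[OF l t] test_integral_deriv[OF t])
qed

text \<open>Test functions \<open>\<theta>(t) \<rho>(x + \<sigma>t)\<close> leave only first derivatives
  of \<open>\<rho>\<close> in the weak equation. Integrating by parts once in \<open>t\<close> and
  once in \<open>x\<close> turns it into the statement that the pairing of \<open>w +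
  \<sigma>v\<close> with \<open>\<rho>(x + \<sigma>t)\<close> has distributional derivative minus the
  pairing of the nonlinearity. Both are continuous in \<open>t\<close>, so the derivative is
  classical, and then \<open>\<rho>\<close> is arbitrary.\<close>

lemma transport_from_weak_equation:
  assumes s: "\<sigma>\<^sup>2 = 1" and st: "a \<le> b"
    and weak: "\<And>\<phi> :: real \<times> real \<Rightarrow> real. test_function \<phi> \<Longrightarrow>
        (LBINT t. LINT x|lborel.
           U t x * (- dir_deriv (1, 0) (dir_deriv (1, 0) \<phi>) (t, x)
                    + dir_deriv (0, 1) (dir_deriv (0, 1) \<phi>) (t, x)))
      = (LBINT t. LBINT x. nl p (U t x) * \<phi> (t, x))"
  shows "AE y in lborel.
    (w b (y - \<sigma> * b) + \<sigma> * v b (y - \<sigma> * b)) - (w a (y - \<sigma> * a) + \<sigma> * v a (y - \<sigma> * a))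
     = - integral {a..b} (\<lambda>r. nl p (U r (y - \<sigma> * r)))"
proof -
  have s': "\<sigma> * \<sigma> = 1" using s by (simp add: power2_eq_square)
  have WL: "in_L2 (\<lambda>x. w t x + \<sigma> * v t x)" for t by (intro in_L2_add in_L2_cmult w_L2 v_L2)
  have Wc: "L2_cont (\<lambda>t x. w t x + \<sigma> * v t x) t" for t
    by (intro L2_cont_add L2_cont_cmult w_L2 in_L2_cmult v_L2 w_cont v_cont)
  have key: "(LBINT x. (w b x + \<sigma> * v b x) * \<rho> (x + \<sigma> * b)) - (LBINT x. (w a x + \<sigma> * v a x) * \<rho> (x + \<sigma> * a))
       = - integral {a..b} (\<lambda>r. LBINT x. nl p (U r x) * \<rho> (x + \<sigma> * r))" if t: "test_function \<rho>" for \<rho>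
  proof (rule distributional_derivative[OF _ _ st])
    define W where "W = (\<lambda>t. LBINT x. (w t x + \<sigma> * v t x) * \<rho> (x + \<sigma> * t))"
    define F where "F = (\<lambda>t. LBINT x. nl p (U t x) * \<rho> (x + \<sigma> * t))"
    define G where "G = (\<lambda>t. LBINT x. U t x * \<rho> (x + \<sigma> * t))"
    define G1 where "G1 = (\<lambda>t. LBINT x. U t x * deriv \<rho> (x + \<sigma> * t))"
    define G' where "G' = (\<lambda>t. LBINT x. w t x * \<rho> (x + \<sigma> * t) + U t x * (\<sigma> * deriv \<rho> (x + \<sigma> * t)))"
    note t' = test_functionD(2)[OF t]
    show "continuous_on UNIV W" unfolding W_def by (rule test_pairing_cont[OF WL Wc t s])
    show "continuous_on UNIV F" unfolding F_def by (rule test_pairing_cont[OF nl_L2 nl_L2_cont t s])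
    have RL: "in_L2 (\<lambda>x. \<rho> (x + \<sigma> * t))" "in_L2 (\<lambda>x. deriv \<rho> (x + \<sigma> * t))" for t
      by (intro in_L2_shift in_L2_test t t')+
    have dG: "(G has_real_derivative G' t) (at t)" for t
      unfolding G_def G'_def
      by (rule has_L1_deriv_integral[OF has_L1_deriv_mult[OF U_L2 RL(1) U_deriv test_time_deriv[OF t s]]])
    have G'_eq: "G' t = (LBINT x. w t x * \<rho> (x + \<sigma> * t)) + \<sigma> * G1 t" for t
    proof -
      have "G' t = (LBINT x. w t x * \<rho> (x + \<sigma> * t) + \<sigma> * (U t x * deriv \<rho> (x + \<sigma> * t)))"
        unfolding G'_def by (intro Bochner_Integration.integral_cong) (auto simp: algebra_simps)
      then show ?thesis unfolding G1_def
        using in_L2_mult[OF w_L2 RL(1), of t t] in_L2_mult[OF U_L2 RL(2), of t t] by simp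
    qed
    have W_eq: "W t = G' t - 2 * \<sigma> * G1 t" for t
    proof -
      have "W t = (LBINT x. w t x * \<rho> (x + \<sigma> * t) + \<sigma> * (v t x * \<rho> (x + \<sigma> * t)))"
        unfolding W_def by (intro Bochner_Integration.integral_cong) (auto simp: algebra_simps)
      also have "\<dots> = (LBINT x. w t x * \<rho> (x + \<sigma> * t)) + \<sigma> * (LBINT x. v t x * \<rho> (x + \<sigma> * t))"
        using in_L2_mult[OF w_L2 RL(1), of t t] in_L2_mult[OF v_L2 RL(1), of t t] by simp
      also have "(LBINT x. v t x * \<rho> (x + \<sigma> * t)) = - G1 t"
        using by_parts_space[OF test_translate(1)[OF t, of "\<sigma> * t"], of t] unfolding test_translate(2)[OF t] G1_def by simp
      finally show ?thesis by (simp add: G'_eq)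
    qed
    have Gc: "continuous_on UNIV G" unfolding G_def by (rule test_pairing_cont[OF U_L2 U_L2_cont t s])
    have G1c: "continuous_on UNIV G1" unfolding G1_def by (rule test_pairing_cont[OF U_L2 U_L2_cont t' s])
    have G'c: "continuous_on UNIV G'"
    proof -
      have "continuous_on UNIV (\<lambda>t. (LBINT x. w t x * \<rho> (x + \<sigma> * t)) + \<sigma> * G1 t)"
        by (intro continuous_intros test_pairing_cont[OF w_L2 w_cont t s] G1c)
      then show ?thesis by (simp add: G'_eq[abs_def, symmetric] G'_eq)
    qed
    show "(LBINT r. W r * deriv \<theta> r) = (LBINT r. F r * \<theta> r)" if th: "test_function \<theta>" for \<theta>
    proof -
      note th' = test_functionD(2)[OF th]
      note th'' = test_functionD(2)[OF th']
      have lG': "loc_integrable G'" and lG1: "loc_integrable G1" using G'c G1c by (auto intro: loc_integrableI_continuous)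
      define \<phi> where "\<phi> = (\<lambda>z::real\<times>real. \<theta> (fst z) * \<rho> (snd z + \<sigma> * fst z))"
      have "(LBINT t. LBINT x. U t x * (- dir_deriv (1, 0) (dir_deriv (1, 0) \<phi>) (t, x) + dir_deriv (0, 1) (dir_deriv (0, 1) \<phi>) (t, x)))
         = (LBINT t. LBINT x. nl p (U t x) * \<phi> (t, x))"
        unfolding \<phi>_def by (rule weak[OF test_function_sheared[OF th t]])
      also have "(\<lambda>t. LBINT x. nl p (U t x) * \<phi> (t, x)) = (\<lambda>t. F t * \<theta> t)"
      proof
        fix t
        have "(LBINT x. nl p (U t x) * \<phi> (t, x)) = (LBINT x. (nl p (U t x) * \<rho> (x + \<sigma> * t)) * \<theta> t)"
          by (intro Bochner_Integration.integral_cong) (auto simp: \<phi>_def)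
        then show "(LBINT x. nl p (U t x) * \<phi> (t, x)) = F t * \<theta> t" by (simp add: F_def)
      qed
      also have "(\<lambda>t. LBINT x. U t x * (- dir_deriv (1, 0) (dir_deriv (1, 0) \<phi>) (t, x) + dir_deriv (0, 1) (dir_deriv (0, 1) \<phi>) (t, x)))
         = (\<lambda>t. - (G t * deriv (deriv \<theta>) t) - 2 * \<sigma> * (G1 t * deriv \<theta> t))"
      proof
        fix t
        have "(LBINT x. U t x * (- dir_deriv (1, 0) (dir_deriv (1, 0) \<phi>) (t, x) + dir_deriv (0, 1) (dir_deriv (0, 1) \<phi>) (t, x)))
          = (LBINT x. (- deriv (deriv \<theta>) t) * (U t x * \<rho> (x + \<sigma> * t)) + (- (2 * \<sigma> * deriv \<theta> t)) * (U t x * deriv \<rho> (x + \<sigma> * t)))"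
          unfolding \<phi>_def wave_operator_sheared[OF th t s]
          by (intro Bochner_Integration.integral_cong) (auto simp: algebra_simps)
        also have "\<dots> = (- deriv (deriv \<theta>) t) * G t + (- (2 * \<sigma> * deriv \<theta> t)) * G1 t"
          unfolding G_def G1_def using in_L2_mult[OF U_L2 RL(1), of t t] in_L2_mult[OF U_L2 RL(2), of t t]
          by (subst Bochner_Integration.integral_add) auto
        finally show "(LBINT x. U t x * (- dir_deriv (1, 0) (dir_deriv (1, 0) \<phi>) (t, x) + dir_deriv (0, 1) (dir_deriv (0, 1) \<phi>) (t, x)))
          = - (G t * deriv (deriv \<theta>) t) - 2 * \<sigma> * (G1 t * deriv \<theta> t)" by simp
      qed
      also have "(LBINT t. - (G t * deriv (deriv \<theta>) t) - 2 * \<sigma> * (G1 t * deriv \<theta> t))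
         = - (LBINT t. G t * deriv (deriv \<theta>) t) - 2 * \<sigma> * (LBINT t. G1 t * deriv \<theta> t)"
        using loc_integrable_test[OF loc_integrableI_continuous[OF Gc] th''] loc_integrable_test[OF lG1 th'] by simp
      also have "(LBINT t. G t * deriv (deriv \<theta>) t) = - (LBINT t. G' t * deriv \<theta> t)"
      proof -
        have eq: "G x = primitive G' x + (G 0 - primitive G' 0)" for x
          by (rule eq_primitive[OF lG']) (rule FTC_integral[symmetric, OF _ dG])
        have i: "integrable lborel (\<lambda>x. primitive G' x * deriv (deriv \<theta>) x)"
          by (intro loc_integrable_test th'' loc_integrableI_continuous primitive_continuous lG')
        have i2: "integrable lborel (deriv (deriv \<theta>))"
          using loc_integrable_test[OF loc_integrableI_continuous th'', of "\<lambda>_. 1"] by simp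
        show ?thesis
          by (subst eq) (simp add: distrib_right i i2 primitive_by_parts[OF lG' th'] test_integral_deriv[OF th'])
      qed
      also have "- (- (LBINT t. G' t * deriv \<theta> t)) - 2 * \<sigma> * (LBINT t. G1 t * deriv \<theta> t)
         = (LBINT t. G' t * deriv \<theta> t - 2 * \<sigma> * (G1 t * deriv \<theta> t))"
        using loc_integrable_test[OF lG' th'] loc_integrable_test[OF lG1 th'] by simp
      also have "\<dots> = (LBINT r. W r * deriv \<theta> r)"
        by (intro Bochner_Integration.integral_cong) (auto simp: W_eq algebra_simps)
      finally show ?thesis .
    qed
  qed
  define N where "N = (\<lambda>r y. nl p (U r (y - \<sigma> * r)))"
  have Nc: "continuous_on A (\<lambda>z. N (f z) (g z))" if "continuous_on A f" "continuous_on A g" for A :: "(real\<times>real) set" and f g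
    unfolding N_def by (intro continuous_intros that)
  have Nc1: "continuous_on UNIV (N r)" for r unfolding N_def
    by (intro nl_continuous continuous_on_compose2[OF is_L2_primitive_continuous[OF U_primitive]] continuous_intros) auto
  define J where "J = (\<lambda>y. integral {a..b} (\<lambda>r. N r y))"
  have Jc: "continuous_on UNIV J"
    using integral_continuous_on_param[of UNIV a b "\<lambda>y r. N r y"] Nc[of UNIV snd fst]
    by (auto simp: J_def case_prod_beta' continuous_on_snd continuous_on_fst continuous_on_id intro: continuous_on_subset)
  define D where "D = (\<lambda>y. (w b (y - \<sigma> * b) + \<sigma> * v b (y - \<sigma> * b)) - (w a (y - \<sigma> * a) + \<sigma> * v a (y - \<sigma> * a)) + J y)"
  have sh: "in_L2 (\<lambda>y. w r (y - \<sigma> * r) + \<sigma> * v r (y - \<sigma> * r))" for r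
    using in_L2_shift[OF WL[of r], of "- \<sigma> * r"] by simp
  have "AE y in lborel. D y = 0"
  proof (rule fundamental_lemma)
    show "loc_integrable D" unfolding D_def
      by (intro loc_integrable_add loc_integrable_diff loc_integrableI_continuous[OF Jc] loc_integrableI_L2 sh)
    fix \<rho> :: "real \<Rightarrow> real" assume t: "test_function \<rho>"
    obtain A where A: "A>0" "\<And>x. \<rho> x \<noteq> 0 \<Longrightarrow> \<bar>x\<bar> < A" using test_functionD(4)[OF t] by auto
    have pull: "(LBINT x. f (x - \<sigma> * r) * \<rho> x) = (LBINT x. f x * \<rho> (x + \<sigma> * r))" for f :: "real \<Rightarrow> real" and r
      using integral_shift[of "\<lambda>x. f x * \<rho> (x + \<sigma> * r)" "- \<sigma> * r"] by simp
    have ex: "(LBINT y. f y * \<rho> y) = integral {-A..A} (\<lambda>y. f y * \<rho> y)" if "continuous_on UNIV f" for f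
    proof -
      have "(LBINT y. f y * \<rho> y) = (LBINT y. indicator {-A..A} y * (f y * \<rho> y))"
      proof (intro Bochner_Integration.integral_cong refl)
        show "f y * \<rho> y = indicator {-A..A} y * (f y * \<rho> y)" for y
          using A(2)[of y] by (cases "\<rho> y = 0") (auto simp: indicator_def)
      qed
      also have "\<dots> = integral {-A..A} (\<lambda>y. f y * \<rho> y)"
        by (rule loc_integrable_HK(2)[symmetric]) (intro loc_integrableI_continuous continuous_intros that test_functionD(3) t)
      finally show ?thesis .
    qed
    have "(LBINT y. J y * \<rho> y) = integral {-A..A} (\<lambda>y. J y * \<rho> y)" by (rule ex[OF Jc])
    also have "\<dots> = integral {-A..A} (\<lambda>y. integral {a..b} (\<lambda>r. N r y * \<rho> y))" by (simp add: J_def)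
    also have "\<dots> = integral {a..b} (\<lambda>r. integral {-A..A} (\<lambda>y. N r y * \<rho> y))"
    proof (rule integral_swap_continuous[where a="-A" and b=A and c=a and d=b and f="\<lambda>y r. N r y * \<rho> y", unfolded cbox_interval])
      show "continuous_on {(- A, a)..(A, b)} (\<lambda>(y, r). N r y * \<rho> y)"
        unfolding case_prod_beta'
        by (intro continuous_intros Nc continuous_on_compose2[OF test_functionD(3)[OF t, of UNIV]]) auto
    qed
    also have "\<dots> = integral {a..b} (\<lambda>r. LBINT y. N r y * \<rho> y)" by (simp add: ex[OF Nc1])
    also have "\<dots> = integral {a..b} (\<lambda>r. LBINT x. nl p (U r x) * \<rho> (x + \<sigma> * r))"
    proof -
      have "(LBINT y. N r y * \<rho> y) = (LBINT x. nl p (U r x) * \<rho> (x + \<sigma> * r))" for r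
        unfolding N_def by (rule pull[of "\<lambda>x. nl p (U r x)" r])
      then show ?thesis by simp
    qed
    finally have J: "(LBINT y. J y * \<rho> y) = integral {a..b} (\<lambda>r. LBINT x. nl p (U r x) * \<rho> (x + \<sigma> * r))" .
    have i: "integrable lborel (\<lambda>y. (w r (y - \<sigma> * r) + \<sigma> * v r (y - \<sigma> * r)) * \<rho> y)" for r
      by (intro in_L2_mult sh in_L2_test t)
    have iJ: "integrable lborel (\<lambda>y. J y * \<rho> y)" by (intro loc_integrable_test t loc_integrableI_continuous Jc)
    have "(LBINT y. D y * \<rho> y) = (LBINT y. (w b (y - \<sigma> * b) + \<sigma> * v b (y - \<sigma> * b)) * \<rho> y - (w a (y - \<sigma> * a) + \<sigma> * v a (y - \<sigma> * a)) * \<rho> y + J y * \<rho> y)"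
      by (intro Bochner_Integration.integral_cong) (auto simp: D_def algebra_simps)
    also have "\<dots> = (LBINT y. (w b (y - \<sigma> * b) + \<sigma> * v b (y - \<sigma> * b)) * \<rho> y) - (LBINT y. (w a (y - \<sigma> * a) + \<sigma> * v a (y - \<sigma> * a)) * \<rho> y) + (LBINT y. J y * \<rho> y)"
      by (simp only: i iJ Bochner_Integration.integral_add Bochner_Integration.integral_diff Bochner_Integration.integrable_diff)
    also have "\<dots> = 0"
      using key[OF t] pull[of "\<lambda>x. w a x + \<sigma> * v a x" a] pull[of "\<lambda>x. w b x + \<sigma> * v b x" b] J by simp
    finally show "(LBINT y. D y * \<rho> y) = 0" .
  qed
  then show ?thesis by eventually_elim (simp add: D_def J_def N_def)
qed

end

section \<open>Finite energy solutions as wave flows\<close>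

lemma norm_H1_ge: "norm_L2 f \<le> norm_H1 f" "norm_L2 (weak_deriv f) \<le> norm_H1 f"
  unfolding norm_H1_def by (auto intro: real_le_rsqrt)

lemma weak_deriv_works:
  assumes "in_H1 f" shows "has_weak_deriv_L2 f (weak_deriv f)"
proof -
  have "\<exists>g. has_weak_deriv_L2 f g" using assms by (simp add: in_H1_def)
  then show ?thesis unfolding weak_deriv_def by (rule someI_ex)
qed

text \<open>All norms and pairings depend only on classes modulo null sets, so the profiles \<open>u
  t\<close> may be replaced by their continuous representatives.\<close>

lemma finite_energy_solution_wave_flow:
  assumes p: "p > 1" and sol: "finite_energy_solution p u"
  obtains U where "wave_flow p U (time_deriv u) (\<lambda>t. weak_deriv (u t))" "\<And>t. AE x in lborel. u t x = U t x"
proof -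
  define v where "v = (\<lambda>t. weak_deriv (u t))"
  have H1: "in_H1 (u t)" for t using sol by (simp add: finite_energy_solution_def continuous_H1_def)
  have u_L2: "in_L2 (u t)" for t using H1 by (simp add: in_H1_def)
  have um: "u t \<in> borel_measurable borel" for t by (rule in_L2_meas[OF u_L2])
  have wd: "has_time_deriv u (time_deriv u t) t" for t
  proof -
    have "\<exists>w. has_time_deriv u w t" using sol by (simp add: finite_energy_solution_def C1_L2_def)
    then show ?thesis unfolding time_deriv_def by (rule someI_ex)
  qed
  have wc: "L2_cont (time_deriv u) t" and wL: "in_L2 (time_deriv u t)" for t
    using sol by (auto simp: finite_energy_solution_def C1_L2_def continuous_L2_def L2_cont_def)
  have vw: "has_weak_deriv_L2 (u t) (v t)" for t unfolding v_def by (rule weak_deriv_works[OF H1])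
  have vL: "in_L2 (v t)" for t using vw by (simp add: has_weak_deriv_L2_def)
  have H1c: "((\<lambda>s. norm_H1 (\<lambda>x. u s x - u t x)) \<longlongrightarrow> 0) (at t)" for t
    using sol by (simp add: finite_energy_solution_def continuous_H1_def)
  have vc: "L2_cont v t" for t
    unfolding L2_cont_def
  proof (rule squeeze0[OF H1c])
    show "norm_L2 (\<lambda>x. v s x - v t x) \<le> norm_H1 (\<lambda>x. u s x - u t x)" for s
    proof -
      have d: "has_weak_deriv_L2 (\<lambda>x. u s x - u t x) (\<lambda>x. v s x - v t x)"
        unfolding has_weak_deriv_L2_def
      proof (intro conjI allI impI)
        show "in_L2 (\<lambda>x. v s x - v t x)" by (intro in_L2_diff vL)
        fix \<phi> :: "real \<Rightarrow> real" assume f: "test_function \<phi>"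
        note fL = in_L2_test[OF f] in_L2_test[OF test_functionD(2)[OF f]]
        show "(LBINT x. (u s x - u t x) * deriv \<phi> x) = - (LBINT x. (v s x - v t x) * \<phi> x)"
          using vw[of s] vw[of t] f by (simp add: has_weak_deriv_L2_def left_diff_distrib in_L2_mult u_L2 vL fL)
      qed
      then have "in_H1 (\<lambda>x. u s x - u t x)" unfolding in_H1_def using in_L2_diff[OF u_L2 u_L2] by blast
      note ww = weak_deriv_works[OF this]
      have "AE x in lborel. v s x - v t x = weak_deriv (\<lambda>x. u s x - u t x) x" by (rule weak_deriv_unique[OF d ww])
      then have "norm_L2 (\<lambda>x. v s x - v t x) = norm_L2 (weak_deriv (\<lambda>x. u s x - u t x))"
        using d ww by (intro norm_L2_cong_AE(1) in_L2_meas) (auto simp: has_weak_deriv_L2_def)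
      with norm_H1_ge(2) show ?thesis by simp
    qed
  qed (rule norm_L2_nonneg)
  define c where "c = (\<lambda>t. SOME c. AE x in lborel. u t x = primitive (v t) x + c)"
  define U where "U = (\<lambda>t x. primitive (v t) x + c t)"
  have AE: "AE x in lborel. u t x = U t x" for t
    unfolding U_def c_def by (rule someI_ex[OF H1_continuous_representative[OF u_L2 vw]])
  have lv: "loc_integrable (v t)" for t by (rule loc_integrableI_L2[OF vL])
  have Ud: "is_L2_primitive (U t) (v t)" for t
    using vL primitive_diff[OF lv] by (simp add: is_L2_primitive_def U_def)
  have Um: "U t \<in> borel_measurable borel" for t
    by (rule borel_measurable_continuous_onI[OF is_L2_primitive_continuous[OF Ud]])
  have UL: "in_L2 (U t)" for t using norm_L2_cong_AE(2)[OF um Um AE] u_L2 by blast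
  have Uderiv: "has_time_deriv U (time_deriv u t) t" for t
  proof -
    have "norm_L2 (\<lambda>x. (U (t + h) x - U t x) / h - time_deriv u t x) = norm_L2 (\<lambda>x. (u (t + h) x - u t x) / h - time_deriv u t x)" for h
    proof (rule norm_L2_cong_AE(1))
      show "AE x in lborel. (U (t + h) x - U t x) / h - time_deriv u t x = (u (t + h) x - u t x) / h - time_deriv u t x"
        using AE[of t] AE[of "t + h"] by eventually_elim simp
    qed (intro in_L2_meas in_L2_diff in_L2_divide UL u_L2 wL)+
    with wd[of t] show ?thesis by (simp add: has_time_deriv_def)
  qed
  interpret energy_curve p U "time_deriv u" v
    by unfold_locales (fact p UL wL Ud Uderiv wc vc)+
  have [measurable]: "nl p \<in> borel_measurable borel" by (intro borel_measurable_continuous_onI nl_cont p)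
  have weak: "(LBINT t. LBINT x. U t x * (- dir_deriv (1, 0) (dir_deriv (1, 0) \<phi>) (t, x) + dir_deriv (0, 1) (dir_deriv (0, 1) \<phi>) (t, x)))
      = (LBINT t. LBINT x. nl p (U t x) * \<phi> (t, x))" if f: "test_function \<phi>" for \<phi> :: "real \<times> real \<Rightarrow> real"
  proof -
    note [measurable] = um Um
    have cf: "continuous_on UNIV \<phi>" using f by (auto simp: test_function_def dest: spec[of _ 0])
    have "continuous_on UNIV (dir_deriv e (dir_deriv e \<phi>))" if "e \<in> Basis" for e
      using f that unfolding test_function_def by (auto dest!: spec[of _ 2] simp: numeral_2_eq_2)
    then have cd: "continuous_on UNIV (dir_deriv (1, 0) (dir_deriv (1, 0) \<phi>))" "continuous_on UNIV (dir_deriv (0, 1) (dir_deriv (0, 1) \<phi>))"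
      by (auto simp: Basis_prod_def)
    have m: "(\<lambda>x. g (t, x)) \<in> borel_measurable borel" if "continuous_on UNIV g" for g :: "real \<times> real \<Rightarrow> real" and t
      by (intro borel_measurable_continuous_onI continuous_on_compose2[OF that] continuous_intros) auto
    note [measurable] = m[OF cf] m[OF cd(1)] m[OF cd(2)]
    have "(LBINT x. U t x * (- dir_deriv (1, 0) (dir_deriv (1, 0) \<phi>) (t, x) + dir_deriv (0, 1) (dir_deriv (0, 1) \<phi>) (t, x)))
       = (LBINT x. u t x * (- dir_deriv (1, 0) (dir_deriv (1, 0) \<phi>) (t, x) + dir_deriv (0, 1) (dir_deriv (0, 1) \<phi>) (t, x)))" for t
      using AE[of t] by (intro integral_cong_AE) auto
    moreover have "(LBINT x. nl p (U t x) * \<phi> (t, x)) = (LBINT x. \<bar>u t x\<bar> powr (p - 1) * u t x * \<phi> (t, x))" for t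
      using AE[of t] by (intro integral_cong_AE) (auto simp: nl_def)
    ultimately show ?thesis
      using sol f by (simp add: finite_energy_solution_def weak_wave_equation_def)
  qed
  have "wave_flow p U (time_deriv u) v"
    by unfold_locales (rule transport_from_weak_equation[OF _ _ weak])
  then show thesis using that AE unfolding v_def by blast
qed

section \<open>Conservation laws and the virial identity\<close>

text \<open>The difference quotient of \<open>A\<close> minus \<open>G t\<close> is an average of \<open>G r - G t\<close> over times \<open>r\<close> near \<open>t\<close>, which
  Minkowski's inequality bounds by the modulus of continuity of \<open>G\<close>.\<close>

lemma has_time_deriv_integral:
  fixes A G :: "real \<Rightarrow> real \<Rightarrow> real"
  assumes A: "\<And>s. in_L2 (A s)" and G: "\<And>s. in_L2 (G s)"
    and Gc: "continuous_on UNIV (\<lambda>z. G (fst z) (snd z))" and GL: "L2_cont G t"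
    and int: "\<And>a b. a \<le> b \<Longrightarrow> AE y in lborel. A b y - A a y = integral {a..b} (\<lambda>r. G r y)"
  shows "has_time_deriv A (G t) t"
  unfolding has_time_deriv_def
proof (intro conjI G tendstoI)
  fix e :: real assume e: "e > 0"
  have "\<forall>\<^sub>F s in at t. norm_L2 (\<lambda>x. G s x - G t x) < e / 2"
    by (rule order_tendstoD(2)[OF GL[unfolded L2_cont_def]]) (use e in simp)
  then obtain d where d: "d > 0" "\<And>s. s \<noteq> t \<Longrightarrow> \<bar>s - t\<bar> < d \<Longrightarrow> norm_L2 (\<lambda>x. G s x - G t x) < e / 2"
    unfolding eventually_at by (auto simp: dist_real_def)
  have d': "norm_L2 (\<lambda>x. G s x - G t x) \<le> e / 2" if "\<bar>s - t\<bar> < d" for s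
    using d(2)[of s] that e by (cases "s = t") (auto simp: norm_L2_def)
  have Gm: "(\<lambda>z. G (fst z) (snd z) - G t (snd z)) \<in> borel_measurable (borel \<Otimes>\<^sub>M borel)"
    unfolding borel_prod by (intro borel_measurable_continuous_onI continuous_on_diff Gc continuous_on_compose2[OF Gc, of UNIV "\<lambda>z. (t, snd z)", simplified] continuous_intros)
  have Gy: "continuous_on UNIV (\<lambda>r. G r y)" for y
    using continuous_on_compose2[OF Gc, of UNIV "\<lambda>r. (r, y)"] by (simp add: continuous_on_Pair continuous_on_id)
  have main: "norm_L2 (\<lambda>x. (A b x - A a x) / (b - a) - G t x) \<le> e / 2"
    if ab: "a < b" "\<And>r. r \<in> {a..b} \<Longrightarrow> \<bar>r - t\<bar> < d" for a b
  proof -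
    have L: "norm_L2 (\<lambda>x. LBINT s. indicator {a..b} s * (G s x - G t x)) \<le> (b - a) * (e / 2)"
      by (rule L2_average(2)[OF Gm ab(1)]) (use ab d' in \<open>auto intro: in_L2_diff G\<close>)
    have I: "in_L2 (\<lambda>x. LBINT s. indicator {a..b} s * (G s x - G t x))"
      by (rule L2_average(1)[OF Gm ab(1), where K="e / 2"]) (use ab d' in \<open>auto intro: in_L2_diff G\<close>)
    have eq: "AE x in lborel. (A b x - A a x) / (b - a) - G t x = (1 / (b - a)) * (LBINT s. indicator {a..b} s * (G s x - G t x))"
      using int[OF less_imp_le[OF ab(1)]]
    proof eventually_elim
      case (elim x)
      have "(LBINT s. indicator {a..b} s * (G s x - G t x)) = integral {a..b} (\<lambda>s. G s x - G t x)"
        by (rule loc_integrable_HK(2)[symmetric]) (intro loc_integrableI_continuous continuous_intros Gy)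
      also have "\<dots> = integral {a..b} (\<lambda>s. G s x) - integral {a..b} (\<lambda>s. G t x)"
        by (intro Henstock_Kurzweil_Integration.integral_diff integrable_continuous_real continuous_on_subset[OF Gy] continuous_intros) auto
      also have "\<dots> = (A b x - A a x) - (b - a) * G t x" using elim ab by simp
      finally show ?case using ab by (simp add: field_simps)
    qed
    have "norm_L2 (\<lambda>x. (A b x - A a x) / (b - a) - G t x) = norm_L2 (\<lambda>x. (1 / (b - a)) * (LBINT s. indicator {a..b} s * (G s x - G t x)))"
      by (rule norm_L2_cong_AE(1)[OF _ _ eq]) (intro in_L2_meas in_L2_diff in_L2_divide in_L2_cmult A G I)+
    also have "\<dots> \<le> (1 / (b - a)) * ((b - a) * (e / 2))"
      unfolding norm_L2_cmult using ab L by (simp add: divide_le_eq mult.commute)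
    finally show ?thesis using ab by simp
  qed
  have "norm_L2 (\<lambda>x. (A (t + h) x - A t x) / h - G t x) < e" if h: "h \<noteq> 0" "\<bar>h\<bar> < d" for h
  proof (cases "h > 0")
    case True
    have "norm_L2 (\<lambda>x. (A (t + h) x - A t x) / (t + h - t) - G t x) \<le> e / 2"
      by (rule main) (use True h in auto)
    with e show ?thesis by simp
  next
    case False
    have "norm_L2 (\<lambda>x. (A t x - A (t + h) x) / (t - (t + h)) - G t x) \<le> e / 2"
      by (rule main) (use False h in auto)
    moreover have "(A t x - A (t + h) x) / (t - (t + h)) = (A (t + h) x - A t x) / h" for x
      using h by (simp add: field_simps)
    ultimately show ?thesis using e by simp
  qed
  then show "\<forall>\<^sub>F h in at 0. dist (norm_L2 (\<lambda>x. (A (t + h) x - A t x) / h - G t x)) 0 < e"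
    unfolding eventually_at by (intro exI[of _ d]) (use d in \<open>auto simp: dist_real_def norm_L2_nonneg\<close>)
qed

text \<open>The linear part of the increment is controlled by Cauchy-Schwarz; the quadratic remainder is
  of size \<open>h\<close> times the squared norm of the difference quotient.\<close>

lemma has_L1_deriv_pot:
  assumes p: "p > 1" and A: "\<And>s. in_L2 (A s)" and B: "\<And>s. \<exists>M. \<forall>x. \<bar>A s x\<bar> \<le> M"
    and M: "\<forall>\<^sub>F s in at t. \<forall>x. \<bar>A s x\<bar> \<le> M" "\<And>x. \<bar>A t x\<bar> \<le> M"
    and d: "has_time_deriv A A' t"
  shows "has_L1_deriv (\<lambda>s x. pot p (A s x)) (\<lambda>x. nl p (A t x) * A' x) t"
  unfolding has_L1_deriv_def
proof (intro conjI allI)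
  have A': "in_L2 A'" using d by (simp add: has_time_deriv_def)
  have N: "in_L2 (\<lambda>x. nl p (A s x))" for s using in_L2_nl[OF p A] B[of s] by blast
  have P: "integrable lborel (\<lambda>x. pot p (A s x))" for s
    unfolding pot_eq[OF p] using in_L2_mult[OF N A] by simp
  show "integrable lborel (\<lambda>x. pot p (A s x))" for s by (rule P)
  show "integrable lborel (\<lambda>x. nl p (A t x) * A' x)" by (rule in_L2_mult[OF N A'])
  define q where "q = (\<lambda>h x. (A (t + h) x - A t x) / h)"
  define C where "C = p * M powr (p - 1)"
  have qL: "in_L2 (q h)" for h unfolding q_def by (intro in_L2_divide in_L2_diff A)
  have q0: "((\<lambda>h. norm_L2 (\<lambda>x. q h x - A' x)) \<longlongrightarrow> 0) (at 0)" using d by (simp add: has_time_deriv_def q_def)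
  have qn: "((\<lambda>h. norm_L2 (q h)) \<longlongrightarrow> norm_L2 A') (at 0)"
  proof -
    have "((\<lambda>h. norm_L2 (q h) - norm_L2 A') \<longlongrightarrow> 0) (at 0)"
    proof (rule tendsto_rabs_zero_cancel, rule squeeze0_eventually[OF q0])
      show "\<forall>\<^sub>F h in at 0. \<bar>norm_L2 (q h) - norm_L2 A'\<bar> \<le> norm_L2 (\<lambda>x. q h x - A' x)"
      proof (intro always_eventually allI)
        fix h show "\<bar>norm_L2 (q h) - norm_L2 A'\<bar> \<le> norm_L2 (\<lambda>x. q h x - A' x)"
          using norm_L2_triangle[OF in_L2_diff[OF qL[of h] A'] A'] norm_L2_triangle[OF in_L2_diff[OF A' qL[of h]] qL[of h]]
            norm_L2_diff_commute[of "q h" A'] by simp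
      qed
    qed simp
    then show ?thesis by (rule LIM_zero_cancel)
  qed
  show "((\<lambda>h. LBINT x. \<bar>(pot p (A (t + h) x) - pot p (A t x)) / h - nl p (A t x) * A' x\<bar>) \<longlongrightarrow> 0) (at 0)"
  proof (rule squeeze0_eventually)
    have "((\<lambda>h. C * (\<bar>h\<bar> * (norm_L2 (q h))\<^sup>2) + norm_L2 (\<lambda>x. nl p (A t x)) * norm_L2 (\<lambda>x. q h x - A' x)) \<longlongrightarrow> C * (\<bar>0\<bar> * (norm_L2 A')\<^sup>2) + norm_L2 (\<lambda>x. nl p (A t x)) * 0) (at 0)"
      by (intro tendsto_intros q0 qn)
    then show "((\<lambda>h. C * (\<bar>h\<bar> * (norm_L2 (q h))\<^sup>2) + norm_L2 (\<lambda>x. nl p (A t x)) * norm_L2 (\<lambda>x. q h x - A' x)) \<longlongrightarrow> 0) (at 0)" by simp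
    have M': "\<forall>\<^sub>F h in at 0. \<forall>x. \<bar>A (t + h) x\<bar> \<le> M"
      using M(1) unfolding eventually_at_to_0[of _ t] by (simp add: add.commute)
    have "\<forall>\<^sub>F h in at 0. h \<noteq> (0::real)" by (simp add: eventually_at_filter)
    with M' show "\<forall>\<^sub>F h in at 0. (LBINT x. \<bar>(pot p (A (t + h) x) - pot p (A t x)) / h - nl p (A t x) * A' x\<bar>)
       \<le> C * (\<bar>h\<bar> * (norm_L2 (q h))\<^sup>2) + norm_L2 (\<lambda>x. nl p (A t x)) * norm_L2 (\<lambda>x. q h x - A' x)"
    proof eventually_elim
      case (elim h)
      have L: "in_L2 (\<lambda>x. q h x - A' x)" by (intro in_L2_diff qL A')
      have i1: "integrable lborel (\<lambda>x. C * (\<bar>h\<bar> * (q h x)\<^sup>2))" by (intro integrable_mult_right in_L2_sq qL)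
      have i2: "integrable lborel (\<lambda>x. \<bar>nl p (A t x) * (q h x - A' x)\<bar>)" by (intro integrable_abs in_L2_mult N L)
      have "(LBINT x. \<bar>(pot p (A (t + h) x) - pot p (A t x)) / h - nl p (A t x) * A' x\<bar>)
        \<le> (LBINT x. C * (\<bar>h\<bar> * (q h x)\<^sup>2) + \<bar>nl p (A t x) * (q h x - A' x)\<bar>)"
      proof (intro integral_mono integrable_abs Bochner_Integration.integrable_diff i1 i2 Bochner_Integration.integrable_add integrable_divide P in_L2_mult N A' L)
        fix x
        define D where "D = A (t + h) x - A t x"
        have Dq: "D = h * q h x" using elim(2) by (simp add: D_def q_def)
        have "\<bar>pot p (A (t + h) x) - pot p (A t x) - nl p (A t x) * D\<bar> \<le> C * D\<^sup>2"
          unfolding C_def D_def by (rule pot_taylor[OF p M(2)]) (use elim in blast)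
        then have "\<bar>pot p (A (t + h) x) - pot p (A t x) - nl p (A t x) * D\<bar> / \<bar>h\<bar> \<le> C * D\<^sup>2 / \<bar>h\<bar>"
          by (intro divide_right_mono) auto
        also have "C * D\<^sup>2 / \<bar>h\<bar> = C * (\<bar>h\<bar> * (q h x)\<^sup>2)"
        proof -
          have "h * h = \<bar>h\<bar> * \<bar>h\<bar>" by simp
          then have "C * D\<^sup>2 = (C * (\<bar>h\<bar> * (q h x)\<^sup>2)) * \<bar>h\<bar>" by (simp add: Dq power2_eq_square algebra_simps)
          then show ?thesis using elim(2) by (simp only: nonzero_mult_div_cancel_right abs_eq_0 not_False_eq_True)
        qed
        also have "\<bar>pot p (A (t + h) x) - pot p (A t x) - nl p (A t x) * D\<bar> / \<bar>h\<bar> = \<bar>(pot p (A (t + h) x) - pot p (A t x)) / h - nl p (A t x) * q h x\<bar>"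
          using elim(2) by (simp add: Dq abs_divide[symmetric] diff_divide_distrib)
        finally have "\<bar>(pot p (A (t + h) x) - pot p (A t x)) / h - nl p (A t x) * q h x\<bar> \<le> C * (\<bar>h\<bar> * (q h x)\<^sup>2)" .
        moreover have "(pot p (A (t + h) x) - pot p (A t x)) / h - nl p (A t x) * A' x
           = ((pot p (A (t + h) x) - pot p (A t x)) / h - nl p (A t x) * q h x) + nl p (A t x) * (q h x - A' x)"
          by (simp add: algebra_simps)
        ultimately show "\<bar>(pot p (A (t + h) x) - pot p (A t x)) / h - nl p (A t x) * A' x\<bar> \<le> C * (\<bar>h\<bar> * (q h x)\<^sup>2) + \<bar>nl p (A t x) * (q h x - A' x)\<bar>"
          by linarith
      qed
      also have "\<dots> = C * (\<bar>h\<bar> * (norm_L2 (q h))\<^sup>2) + (LBINT x. \<bar>nl p (A t x) * (q h x - A' x)\<bar>)"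
        unfolding norm_L2_square by (subst Bochner_Integration.integral_add[OF i1 i2]) simp
      also have "\<dots> \<le> C * (\<bar>h\<bar> * (norm_L2 (q h))\<^sup>2) + norm_L2 (\<lambda>x. nl p (A t x)) * norm_L2 (\<lambda>x. q h x - A' x)"
        by (intro add_left_mono Cauchy_Schwarz_L2_abs N L)
      finally show ?case .
    qed
  qed simp
qed

text \<open>Weights need not decay, so that the constant \<open>1\<close>, which measures the total
  energy, and monotone steps, which measure the energy on a half line, are included.\<close>

definition weight :: "(real \<Rightarrow> real) \<Rightarrow> (real \<Rightarrow> real) \<Rightarrow> bool" where
  "weight \<Phi> \<Phi>' \<longleftrightarrow> (\<forall>x. (\<Phi> has_real_derivative \<Phi>' x) (at x)) \<and> continuous_on UNIV \<Phi>' \<and>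
     (\<exists>B. \<forall>x. \<bar>\<Phi> x\<bar> \<le> B \<and> \<bar>\<Phi>' x\<bar> \<le> B)"

lemma weight_cont: "weight \<Phi> \<Phi>' \<Longrightarrow> continuous_on UNIV \<Phi>"
  unfolding weight_def using DERIV_isCont continuous_at_imp_continuous_on by blast

lemma weight_meas:
  assumes "weight \<Phi> \<Phi>'" shows "\<Phi> \<in> borel_measurable borel" "\<Phi>' \<in> borel_measurable borel"
  using weight_cont[OF assms] assms by (auto simp: weight_def intro: borel_measurable_continuous_onI)

lemma weight_integrable:
  assumes "weight \<Phi> \<Phi>'" "integrable lborel Q"
  shows "integrable lborel (\<lambda>x. \<Phi> x * Q x)" "integrable lborel (\<lambda>x. \<Phi>' x * Q x)"
  using assms weight_meas[OF assms(1)] unfolding weight_def by (blast intro: integrable_bounded_mult)+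

text \<open>Differentiating a weighted integral of a density whose profile, seen in the frame moving
  with velocity \<open>- \<sigma>\<close>, is a differentiable curve in $L^1$.\<close>

lemma weight_frame_deriv:
  assumes w: "weight \<Phi> \<Phi>'"
    and Q: "has_L1_deriv (\<lambda>t y. Q t (y - \<sigma> * t)) (\<lambda>y. Q' (y - \<sigma> * t)) t"
  shows "((\<lambda>t. LBINT x. \<Phi> x * Q t x) has_real_derivative
     (LBINT x. - \<sigma> * (\<Phi>' x * Q t x) + \<Phi> x * Q' x)) (at t)"
proof -
  obtain B where B: "\<And>x. \<bar>\<Phi> x\<bar> \<le> B" "\<And>x. \<bar>\<Phi>' x\<bar> \<le> B" using w unfolding weight_def by blast
  have D: "(\<Phi> has_real_derivative \<Phi>' x) (at x)" for x using w by (simp add: weight_def)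
  have L: "\<bar>\<Phi> x - \<Phi> y\<bar> \<le> B * \<bar>x - y\<bar>" for x y
    using field_differentiable_bound[of UNIV \<Phi> \<Phi>' B x y] D B(2) by auto
  have B0: "0 \<le> B" using B(1)[of 0] by simp
  have pull: "(LBINT y. f (y - \<sigma> * s)) = (LBINT x. f x)" for f :: "real \<Rightarrow> real" and s
    using integral_shift[of f "- \<sigma> * s"] by simp
  have "((\<lambda>s. LBINT y. \<Phi> (y - \<sigma> * s) * Q s (y - \<sigma> * s)) has_real_derivative
     (LBINT y. (- \<sigma> * \<Phi>' (y - \<sigma> * t)) * Q t (y - \<sigma> * t) + \<Phi> (y - \<sigma> * t) * Q' (y - \<sigma> * t))) (at t)"
  proof (rule has_L1_deriv_weight[OF Q, where \<Phi>="\<lambda>s y. \<Phi> (y - \<sigma> * s)" and B="B * max 1 \<bar>\<sigma>\<bar>"])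
    show "(\<lambda>y. \<Phi> (y - \<sigma> * s)) \<in> borel_measurable borel" for s using weight_meas(1)[OF w] by simp
    show "\<bar>\<Phi> (y - \<sigma> * s)\<bar> \<le> B * max 1 \<bar>\<sigma>\<bar>" for s y
      using B(1)[of "y - \<sigma> * s"] mult_left_mono[OF max.cobounded1[of 1 "\<bar>\<sigma>\<bar>"] B0] by simp
    show "\<bar>\<Phi> (y - \<sigma> * s) - \<Phi> (y - \<sigma> * r)\<bar> \<le> B * max 1 \<bar>\<sigma>\<bar> * \<bar>s - r\<bar>" for s r y
    proof -
      have "\<bar>\<Phi> (y - \<sigma> * s) - \<Phi> (y - \<sigma> * r)\<bar> \<le> B * \<bar>(y - \<sigma> * s) - (y - \<sigma> * r)\<bar>" by (rule L)
      also have "\<bar>(y - \<sigma> * s) - (y - \<sigma> * r)\<bar> = \<bar>\<sigma>\<bar> * \<bar>s - r\<bar>"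
        by (simp add: abs_mult[symmetric] algebra_simps abs_minus_commute)
      also have "B * (\<bar>\<sigma>\<bar> * \<bar>s - r\<bar>) \<le> B * (max 1 \<bar>\<sigma>\<bar> * \<bar>s - r\<bar>)"
        by (intro mult_left_mono mult_right_mono B0) auto
      finally show ?thesis by (simp add: mult.assoc)
    qed
    show "((\<lambda>s. \<Phi> (y - \<sigma> * s)) has_real_derivative - \<sigma> * \<Phi>' (y - \<sigma> * t)) (at t)" for y
      by (rule DERIV_cong[OF DERIV_chain2[OF D]]) (auto intro!: derivative_eq_intros)
  qed
  then show ?thesis
    unfolding pull[of "\<lambda>x. \<Phi> x * Q _ x"] pull[of "\<lambda>x. (- \<sigma> * \<Phi>' x) * Q t x + \<Phi> x * Q' x"]
    by (simp add: mult.assoc)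
qed

context wave_flow
begin

definition W :: "real \<Rightarrow> real \<Rightarrow> real \<Rightarrow> real" where "W \<sigma> t x = w t x + \<sigma> * v t x"

lemma W_L2: "in_L2 (W \<sigma> t)" unfolding W_def by (intro in_L2_add in_L2_cmult w_L2 v_L2)

lemma W_cont: "L2_cont (W \<sigma>) t"
  unfolding W_def[abs_def] by (intro L2_cont_add L2_cont_cmult w_L2 in_L2_cmult v_L2 w_cont v_cont)

lemma frame_L2: "in_L2 f \<Longrightarrow> in_L2 (\<lambda>y. f (y - c))" using in_L2_shift[of f "- c"] by simp

lemma frame_norm: "norm_L2 (\<lambda>y. f (y - c)) = norm_L2 f" using norm_L2_shift[of f "- c"] by simp

lemma U_frame_cont: "L2_cont (\<lambda>t y. U t (y - \<sigma> * t)) t"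
  unfolding L2_cont_def
proof (rule squeeze0)
  have "((\<lambda>s. norm_L2 (\<lambda>x. U s x - U t x) + \<bar>\<sigma> * (t - s)\<bar> * norm_L2 (v t)) \<longlongrightarrow> 0 + \<bar>\<sigma> * (t - t)\<bar> * norm_L2 (v t)) (at t)"
    by (intro tendsto_intros U_L2_cont[unfolded L2_cont_def])
  then show "((\<lambda>s. norm_L2 (\<lambda>x. U s x - U t x) + \<bar>\<sigma> * (t - s)\<bar> * norm_L2 (v t)) \<longlongrightarrow> 0) (at t)" by simp
  show "norm_L2 (\<lambda>y. U s (y - \<sigma> * s) - U t (y - \<sigma> * t)) \<le> norm_L2 (\<lambda>x. U s x - U t x) + \<bar>\<sigma> * (t - s)\<bar> * norm_L2 (v t)" for s
  proof -
    have "norm_L2 (\<lambda>y. U s (y - \<sigma> * s) - U t (y - \<sigma> * t)) \<le> norm_L2 (\<lambda>y. U s (y - \<sigma> * s) - U t (y - \<sigma> * s)) + norm_L2 (\<lambda>y. U t (y - \<sigma> * s) - U t (y - \<sigma> * t))"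
      by (intro norm_L2_triangle_diff frame_L2 U_L2)
    also have "norm_L2 (\<lambda>y. U s (y - \<sigma> * s) - U t (y - \<sigma> * s)) = norm_L2 (\<lambda>x. U s x - U t x)"
      by (rule frame_norm[of "\<lambda>x. U s x - U t x"])
    also have "norm_L2 (\<lambda>y. U t (y - \<sigma> * s) - U t (y - \<sigma> * t)) = norm_L2 (\<lambda>x. U t (x + \<sigma> * (t - s)) - U t x)"
      using frame_norm[of "\<lambda>x. U t (x + \<sigma> * (t - s)) - U t x" "\<sigma> * t"] by (simp add: algebra_simps)
    also have "\<dots> \<le> \<bar>\<sigma> * (t - s)\<bar> * norm_L2 (v t)" by (rule shift_lipschitz[OF U_primitive])
    finally show ?thesis by simp
  qed
qed (rule norm_L2_nonneg)

lemma W_frame_deriv: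
  assumes s: "\<sigma>\<^sup>2 = 1"
  shows "has_time_deriv (\<lambda>t y. W \<sigma> t (y - \<sigma> * t)) (\<lambda>y. - nl p (U t (y - \<sigma> * t))) t"
proof (rule has_time_deriv_integral[where G="\<lambda>t y. - nl p (U t (y - \<sigma> * t))"])
  show "in_L2 (\<lambda>y. W \<sigma> s (y - \<sigma> * s))" for s by (intro frame_L2 W_L2)
  show "in_L2 (\<lambda>y. - nl p (U s (y - \<sigma> * s)))" for s by (intro in_L2_minus frame_L2 nl_L2)
  show "continuous_on UNIV (\<lambda>z. - nl p (U (fst z) (snd z - \<sigma> * fst z)))" by (intro continuous_intros)
  obtain M where M: "\<forall>\<^sub>F s in at t. \<forall>x. \<bar>U s x\<bar> \<le> M" "\<And>x. \<bar>U t x\<bar> \<le> M" using U_loc_bound[of t] by blast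
  have "L2_cont (\<lambda>t y. nl p (U t (y - \<sigma> * t))) t"
    by (rule L2_cont_nl[OF p _ U_frame_cont, where M=M]) (use M in \<open>auto intro: frame_L2 U_L2 elim: eventually_mono\<close>)
  from L2_cont_cmult[OF this, of "-1"] show "L2_cont (\<lambda>t y. - nl p (U t (y - \<sigma> * t))) t" by simp
  show "AE y in lborel. W \<sigma> b (y - \<sigma> * b) - W \<sigma> a (y - \<sigma> * a) = integral {a..b} (\<lambda>r. - nl p (U r (y - \<sigma> * r)))" if "a \<le> b" for a b
    using transport[OF s that] by eventually_elim (simp add: W_def)
qed

text \<open>Along its characteristics \<open>W \<sigma>\<close> changes little in a short time. So a translate of \<open>W \<sigma> t\<close> is close to the same
  function at a neighbouring time, and continuity in time yields continuity under translations.\<close>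

lemma W_shift_cont:
  assumes s: "\<sigma>\<^sup>2 = 1" shows "L2_cont (\<lambda>h x. W \<sigma> t (x + h)) 0"
proof -
  have fl: "filterlim (\<lambda>h. t - \<sigma> * h) (at t) (at 0)"
    unfolding filterlim_at using s by (auto intro!: tendsto_eq_intros simp: eventually_at_filter)
  have "L2_cont (\<lambda>t y. W \<sigma> t (y - \<sigma> * t)) t"
    by (rule L2_cont_time_deriv[OF _ W_frame_deriv[OF s]]) (intro frame_L2 W_L2)
  from filterlim_compose[OF tendsto_add[OF this[unfolded L2_cont_def] W_cont[unfolded L2_cont_def, of \<sigma> t]] fl]
  have lim: "((\<lambda>h. norm_L2 (\<lambda>y. W \<sigma> (t - \<sigma> * h) (y - \<sigma> * (t - \<sigma> * h)) - W \<sigma> t (y - \<sigma> * t)) + norm_L2 (\<lambda>x. W \<sigma> (t - \<sigma> * h) x - W \<sigma> t x)) \<longlongrightarrow> 0) (at 0)"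
    by simp
  show ?thesis unfolding L2_cont_def
  proof (rule squeeze0[OF lim])
    show "norm_L2 (\<lambda>x. W \<sigma> t (x + h) - W \<sigma> t (x + 0))
      \<le> norm_L2 (\<lambda>y. W \<sigma> (t - \<sigma> * h) (y - \<sigma> * (t - \<sigma> * h)) - W \<sigma> t (y - \<sigma> * t)) + norm_L2 (\<lambda>x. W \<sigma> (t - \<sigma> * h) x - W \<sigma> t x)" for h
    proof -
      define r where "r = t - \<sigma> * h"
      have "\<sigma> * (\<sigma> * h) = h" using s by (simp add: power2_eq_square mult.assoc[symmetric])
      then have rh: "y - \<sigma> * r = (y - \<sigma> * t) + h" for y by (simp add: r_def algebra_simps)
      have "norm_L2 (\<lambda>x. W \<sigma> t (x + h) - W \<sigma> t (x + 0)) = norm_L2 (\<lambda>y. W \<sigma> t (y - \<sigma> * r) - W \<sigma> t (y - \<sigma> * t))"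
        using frame_norm[of "\<lambda>x. W \<sigma> t (x + h) - W \<sigma> t x" "\<sigma> * t"] by (simp add: rh)
      also have "\<dots> \<le> norm_L2 (\<lambda>y. W \<sigma> t (y - \<sigma> * r) - W \<sigma> r (y - \<sigma> * r)) + norm_L2 (\<lambda>y. W \<sigma> r (y - \<sigma> * r) - W \<sigma> t (y - \<sigma> * t))"
        by (intro norm_L2_triangle_diff frame_L2 W_L2)
      also have "norm_L2 (\<lambda>y. W \<sigma> t (y - \<sigma> * r) - W \<sigma> r (y - \<sigma> * r)) = norm_L2 (\<lambda>x. W \<sigma> r x - W \<sigma> t x)"
        using frame_norm[of "\<lambda>x. W \<sigma> t x - W \<sigma> r x" "\<sigma> * r"] norm_L2_diff_commute[of "W \<sigma> t" "W \<sigma> r"] by simp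
      finally show ?thesis by (simp add: r_def)
    qed
  qed (rule norm_L2_nonneg)
qed

lemma v_shift_cont: "L2_cont (\<lambda>h x. v t (x + h)) 0"
proof -
  have "L2_cont (\<lambda>h x. 1/2 * W 1 t (x + h) + (-1/2) * W (-1) t (x + h)) 0"
    by (intro L2_cont_add L2_cont_cmult W_shift_cont in_L2_cmult in_L2_shift W_L2) auto
  then show ?thesis by (simp add: W_def field_simps)
qed

lemma w_shift_cont: "L2_cont (\<lambda>h x. w t (x + h)) 0"
proof -
  have "L2_cont (\<lambda>h x. 1/2 * W 1 t (x + h) + 1/2 * W (-1) t (x + h)) 0"
    by (intro L2_cont_add L2_cont_cmult W_shift_cont in_L2_cmult in_L2_shift W_L2) auto
  then show ?thesis by (simp add: W_def field_simps)
qed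

text \<open>The increment splits into one in time at a fixed place, a translation of \<open>w\<close>,
  and a translation of \<open>U t\<close>. The last two need that \<open>w\<close> and
  \<open>v\<close> are continuous under translations.\<close>

lemma U_frame_deriv:
  assumes s: "\<sigma>\<^sup>2 = 1"
  shows "has_time_deriv (\<lambda>t y. U t (y - \<sigma> * t)) (\<lambda>y. W (- \<sigma>) t (y - \<sigma> * t)) t"
  unfolding has_time_deriv_def
proof (intro conjI)
  show "in_L2 (\<lambda>y. W (- \<sigma>) t (y - \<sigma> * t))" by (intro frame_L2 W_L2)
  define q1 where "q1 = (\<lambda>h x. (U (t + h) x - U t x) / h - w t x)"
  define q2 where "q2 = (\<lambda>h x. w t (x + (- \<sigma> * h)) - w t x)"
  define q3 where "q3 = (\<lambda>h y. (U t (y + - \<sigma> * (t + h)) - U t (y + - \<sigma> * t)) / h - - \<sigma> * v t (y + - \<sigma> * t))"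
  have 1: "((\<lambda>h. norm_L2 (q1 h)) \<longlongrightarrow> 0) (at 0)" using U_deriv[of t] by (simp add: has_time_deriv_def q1_def)
  have fl: "filterlim (\<lambda>h. - \<sigma> * h) (at 0) (at 0)"
    unfolding filterlim_at using s by (auto intro!: tendsto_eq_intros simp: eventually_at_filter)
  have 2: "((\<lambda>h. norm_L2 (q2 h)) \<longlongrightarrow> 0) (at 0)"
    using filterlim_compose[OF w_shift_cont[unfolded L2_cont_def] fl] by (simp add: q2_def)
  have "has_time_deriv (\<lambda>r x. U t (x + - \<sigma> * r)) (\<lambda>x. - \<sigma> * v t (x + - \<sigma> * t)) t"
    by (rule has_time_deriv_translate[OF U_primitive v_shift_cont]) (use s in simp)
  then have 3: "((\<lambda>h. norm_L2 (q3 h)) \<longlongrightarrow> 0) (at 0)" by (simp add: has_time_deriv_def q3_def)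
  have L: "in_L2 (q1 h)" "in_L2 (q2 h)" "in_L2 (q3 h)" for h
    unfolding q1_def q2_def q3_def by (intro in_L2_diff in_L2_divide in_L2_cmult in_L2_shift U_L2 w_L2 v_L2)+
  show "((\<lambda>h. norm_L2 (\<lambda>x. (U (t + h) (x - \<sigma> * (t + h)) - U t (x - \<sigma> * t)) / h - W (- \<sigma>) t (x - \<sigma> * t))) \<longlongrightarrow> 0) (at 0)"
  proof (rule squeeze0_at)
    show "((\<lambda>h. norm_L2 (q1 h) + norm_L2 (q2 h) + norm_L2 (q3 h)) \<longlongrightarrow> 0) (at 0)"
      using tendsto_add[OF tendsto_add[OF 1 2] 3] by simp
    show "norm_L2 (\<lambda>x. (U (t + h) (x - \<sigma> * (t + h)) - U t (x - \<sigma> * t)) / h - W (- \<sigma>) t (x - \<sigma> * t)) \<le> norm_L2 (q1 h) + norm_L2 (q2 h) + norm_L2 (q3 h)"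
      if "h \<noteq> 0" for h
    proof -
      have "(U (t + h) (x - \<sigma> * (t + h)) - U t (x - \<sigma> * t)) / h - W (- \<sigma>) t (x - \<sigma> * t)
          = q1 h (x - \<sigma> * (t + h)) + q2 h (x - \<sigma> * t) + q3 h x" for x
        using that by (simp add: q1_def q2_def q3_def W_def diff_divide_distrib algebra_simps)
      then have "norm_L2 (\<lambda>x. (U (t + h) (x - \<sigma> * (t + h)) - U t (x - \<sigma> * t)) / h - W (- \<sigma>) t (x - \<sigma> * t))
          = norm_L2 (\<lambda>x. q1 h (x - \<sigma> * (t + h)) + q2 h (x - \<sigma> * t) + q3 h x)" by simp
      also have "\<dots> \<le> norm_L2 (\<lambda>x. q1 h (x - \<sigma> * (t + h)) + q2 h (x - \<sigma> * t)) + norm_L2 (q3 h)"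
        by (intro norm_L2_triangle in_L2_add frame_L2 L)
      also have "norm_L2 (\<lambda>x. q1 h (x - \<sigma> * (t + h)) + q2 h (x - \<sigma> * t)) \<le> norm_L2 (\<lambda>x. q1 h (x - \<sigma> * (t + h))) + norm_L2 (\<lambda>x. q2 h (x - \<sigma> * t))"
        by (intro norm_L2_triangle frame_L2 L)
      finally show ?thesis by (simp add: frame_norm)
    qed
  qed (rule norm_L2_nonneg)
qed

abbreviation V :: "real \<Rightarrow> real \<Rightarrow> real" where "V t x \<equiv> pot p (U t x)"

lemma V_integrable: "integrable lborel (V t)"
  unfolding pot_eq[OF p] using in_L2_mult[OF nl_L2 U_L2] by simp

lemma W_square_integrable: "integrable lborel (\<lambda>x. (W \<sigma> t x)\<^sup>2)"
  by (rule in_L2_sq[OF W_L2])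

text \<open>Formally, \<open>W\<^sup>2/2\<close> loses \<open>W\<close> times the nonlinearity along the
  characteristics \<open>x + \<sigma>t = const\<close>, and \<open>V\<close> gains the same amount
  along the opposite ones, where the derivative of \<open>U\<close> is \<open>W \<sigma>\<close>.
  Differentiating each of the two terms in its own moving frame uses only derivatives that exist in
  the energy class.\<close>

lemma null_energy_conservation:
  assumes s: "\<sigma>\<^sup>2 = 1" and wt: "weight \<Phi> \<Phi>'"
  shows "((\<lambda>t. LBINT x. \<Phi> x * ((W \<sigma> t x)\<^sup>2 / 2 + V t x)) has_real_derivative
     - \<sigma> * (LBINT x. \<Phi>' x * ((W \<sigma> t x)\<^sup>2 / 2 - V t x))) (at t)"
proof -
  have s': "(- \<sigma>)\<^sup>2 = 1" using s by simp
  obtain M where M: "\<forall>\<^sub>F s in at t. \<forall>x. \<bar>U s x\<bar> \<le> M" "\<And>x. \<bar>U t x\<bar> \<le> M" using U_loc_bound[of t] by blast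
  have 1: "((\<lambda>t. LBINT x. \<Phi> x * (W \<sigma> t x * W \<sigma> t x)) has_real_derivative
     (LBINT x. - \<sigma> * (\<Phi>' x * (W \<sigma> t x * W \<sigma> t x)) + \<Phi> x * (- nl p (U t x) * W \<sigma> t x + W \<sigma> t x * - nl p (U t x)))) (at t)"
    by (rule weight_frame_deriv[OF wt])
      (rule has_L1_deriv_mult[OF frame_L2[OF W_L2] frame_L2[OF W_L2] W_frame_deriv[OF s] W_frame_deriv[OF s]])
  have "has_L1_deriv (\<lambda>t y. pot p (U t (y - - \<sigma> * t))) (\<lambda>y. nl p (U t (y - - \<sigma> * t)) * W (- (- \<sigma>)) t (y - - \<sigma> * t)) t"
  proof (rule has_L1_deriv_pot[OF p _ _ _ _ U_frame_deriv[OF s'], where M=M])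
    show "in_L2 (\<lambda>y. U s (y - - \<sigma> * s))" for s by (rule frame_L2[OF U_L2])
    show "\<exists>M. \<forall>y. \<bar>U s (y - - \<sigma> * s)\<bar> \<le> M" for s using U_sup[of s] by (intro exI allI)
    show "\<forall>\<^sub>F s in at t. \<forall>y. \<bar>U s (y - - \<sigma> * s)\<bar> \<le> M" using M(1) by (rule eventually_mono) simp
    show "\<bar>U t (y - - \<sigma> * t)\<bar> \<le> M" for y by (rule M(2))
  qed
  from weight_frame_deriv[OF wt, of "\<lambda>t y. pot p (U t y)" "- \<sigma>" "\<lambda>x. nl p (U t x) * W (- (- \<sigma>)) t x", OF this]
  have 2: "((\<lambda>t. LBINT x. \<Phi> x * V t x) has_real_derivative
     (LBINT x. - (- \<sigma>) * (\<Phi>' x * V t x) + \<Phi> x * (nl p (U t x) * W (- (- \<sigma>)) t x))) (at t)" .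
  have iWW: "integrable lborel (\<lambda>x. W \<sigma> t x * W \<sigma> t x)" for t by (intro in_L2_mult W_L2)
  have iN: "integrable lborel (\<lambda>x. nl p (U t x) * W \<sigma> t x)" by (intro in_L2_mult W_L2 nl_L2)
  have eq: "(LBINT x. \<Phi> x * ((W \<sigma> t x)\<^sup>2 / 2 + V t x)) = (1/2) * (LBINT x. \<Phi> x * (W \<sigma> t x * W \<sigma> t x)) + (LBINT x. \<Phi> x * V t x)" for t
  proof -
    have "(LBINT x. \<Phi> x * ((W \<sigma> t x)\<^sup>2 / 2 + V t x)) = (LBINT x. (1/2) * (\<Phi> x * (W \<sigma> t x * W \<sigma> t x)) + \<Phi> x * V t x)"
      by (intro Bochner_Integration.integral_cong) (auto simp: power2_eq_square algebra_simps)
    then show ?thesis using weight_integrable(1)[OF wt iWW] weight_integrable(1)[OF wt V_integrable] by simp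
  qed
  have "((\<lambda>t. LBINT x. \<Phi> x * ((W \<sigma> t x)\<^sup>2 / 2 + V t x)) has_real_derivative
     (1/2) * (LBINT x. - \<sigma> * (\<Phi>' x * (W \<sigma> t x * W \<sigma> t x)) + \<Phi> x * (- nl p (U t x) * W \<sigma> t x + W \<sigma> t x * - nl p (U t x)))
     + (LBINT x. - (- \<sigma>) * (\<Phi>' x * V t x) + \<Phi> x * (nl p (U t x) * W (- (- \<sigma>)) t x))) (at t)"
    unfolding eq by (intro DERIV_add DERIV_cmult 1 2)
  moreover have "(1/2) * (LBINT x. - \<sigma> * (\<Phi>' x * (W \<sigma> t x * W \<sigma> t x)) + \<Phi> x * (- nl p (U t x) * W \<sigma> t x + W \<sigma> t x * - nl p (U t x)))
     + (LBINT x. - (- \<sigma>) * (\<Phi>' x * V t x) + \<Phi> x * (nl p (U t x) * W (- (- \<sigma>)) t x))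
     = - \<sigma> * (LBINT x. \<Phi>' x * ((W \<sigma> t x)\<^sup>2 / 2 - V t x))"
  proof -
    have a: "(LBINT x. - \<sigma> * (\<Phi>' x * (W \<sigma> t x * W \<sigma> t x)) + \<Phi> x * (- nl p (U t x) * W \<sigma> t x + W \<sigma> t x * - nl p (U t x)))
      = - \<sigma> * (LBINT x. \<Phi>' x * (W \<sigma> t x * W \<sigma> t x)) - 2 * (LBINT x. \<Phi> x * (nl p (U t x) * W \<sigma> t x))"
    proof -
      have "(LBINT x. - \<sigma> * (\<Phi>' x * (W \<sigma> t x * W \<sigma> t x)) + \<Phi> x * (- nl p (U t x) * W \<sigma> t x + W \<sigma> t x * - nl p (U t x)))
        = (LBINT x. - \<sigma> * (\<Phi>' x * (W \<sigma> t x * W \<sigma> t x)) - 2 * (\<Phi> x * (nl p (U t x) * W \<sigma> t x)))"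
        by (intro Bochner_Integration.integral_cong) (auto simp: algebra_simps)
      then show ?thesis using weight_integrable(2)[OF wt iWW[of t]] weight_integrable(1)[OF wt iN] by simp
    qed
    have b: "(LBINT x. - (- \<sigma>) * (\<Phi>' x * V t x) + \<Phi> x * (nl p (U t x) * W (- (- \<sigma>)) t x))
      = \<sigma> * (LBINT x. \<Phi>' x * V t x) + (LBINT x. \<Phi> x * (nl p (U t x) * W \<sigma> t x))"
      using weight_integrable(2)[OF wt V_integrable[of t]] weight_integrable(1)[OF wt iN] by simp
    have c: "(LBINT x. \<Phi>' x * ((W \<sigma> t x)\<^sup>2 / 2 - V t x)) = (1/2) * (LBINT x. \<Phi>' x * (W \<sigma> t x * W \<sigma> t x)) - (LBINT x. \<Phi>' x * V t x)"
    proof -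
      have "(LBINT x. \<Phi>' x * ((W \<sigma> t x)\<^sup>2 / 2 - V t x)) = (LBINT x. (1/2) * (\<Phi>' x * (W \<sigma> t x * W \<sigma> t x)) - \<Phi>' x * V t x)"
        by (intro Bochner_Integration.integral_cong) (auto simp: power2_eq_square algebra_simps)
      then show ?thesis using weight_integrable(2)[OF wt iWW[of t]] weight_integrable(2)[OF wt V_integrable[of t]] by simp
    qed
    show ?thesis unfolding a b c by (simp add: algebra_simps)
  qed
  ultimately show ?thesis by simp
qed

text \<open>In the frame \<open>y = x + \<sigma>t\<close> the derivative of \<open>U\<close> is the
  opposite null derivative \<open>W (- \<sigma>)\<close>, and that of \<open>W \<sigma>\<close> is
  minus the nonlinearity, whose product with \<open>U\<close> is \<open>(p + 1) V\<close>.\<close>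

lemma virial_identity:
  assumes s: "\<sigma>\<^sup>2 = 1" and wt: "weight \<Phi> \<Phi>'"
  shows "((\<lambda>t. LBINT x. \<Phi> x * (U t x * W \<sigma> t x)) has_real_derivative
     - \<sigma> * (LBINT x. \<Phi>' x * (U t x * W \<sigma> t x)) + (LBINT x. \<Phi> x * (W (- \<sigma>) t x * W \<sigma> t x))
       - (p + 1) * (LBINT x. \<Phi> x * V t x)) (at t)"
proof -
  have "((\<lambda>t. LBINT x. \<Phi> x * (U t x * W \<sigma> t x)) has_real_derivative
     (LBINT x. - \<sigma> * (\<Phi>' x * (U t x * W \<sigma> t x)) + \<Phi> x * (W (- \<sigma>) t x * W \<sigma> t x + U t x * - nl p (U t x)))) (at t)"
    by (rule weight_frame_deriv[OF wt])
      (rule has_L1_deriv_mult[OF frame_L2[OF U_L2] frame_L2[OF W_L2] U_frame_deriv[OF s] W_frame_deriv[OF s]])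
  moreover have "(LBINT x. - \<sigma> * (\<Phi>' x * (U t x * W \<sigma> t x)) + \<Phi> x * (W (- \<sigma>) t x * W \<sigma> t x + U t x * - nl p (U t x)))
     = - \<sigma> * (LBINT x. \<Phi>' x * (U t x * W \<sigma> t x)) + (LBINT x. \<Phi> x * (W (- \<sigma>) t x * W \<sigma> t x))
       - (p + 1) * (LBINT x. \<Phi> x * V t x)"
  proof -
    have e: "U t x * - nl p (U t x) = - ((p + 1) * V t x)" for x
      using nl_mult_self[OF p, of "U t x"] by (simp add: mult.commute)
    have "(LBINT x. - \<sigma> * (\<Phi>' x * (U t x * W \<sigma> t x)) + \<Phi> x * (W (- \<sigma>) t x * W \<sigma> t x + U t x * - nl p (U t x)))
       = (LBINT x. - \<sigma> * (\<Phi>' x * (U t x * W \<sigma> t x)) + \<Phi> x * (W (- \<sigma>) t x * W \<sigma> t x) - (p + 1) * (\<Phi> x * V t x))"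
      unfolding e by (intro Bochner_Integration.integral_cong) (auto simp: algebra_simps)
    then show ?thesis
      using weight_integrable(2)[OF wt in_L2_mult[OF U_L2 W_L2], of t \<sigma> t] weight_integrable(1)[OF wt in_L2_mult[OF W_L2 W_L2], of "- \<sigma>" t \<sigma> t]
        weight_integrable(1)[OF wt V_integrable[of t]] by simp
  qed
  ultimately show ?thesis by simp
qed

end

section \<open>Averages over windows in space and time\<close>

text \<open>A spatial window of width \<open>R\<close> around \<open>z\<close>. Its tails decay so
  slowly that \<open>kern'\<close> is bounded by \<open>kern / R\<close>; therefore every flux through
  the window is controlled by the content of the same window. The step function is a bounded primitive
  of \<open>kern\<close> with respect to \<open>z\<close>.\<close>

definition kern :: "real \<Rightarrow> real \<Rightarrow> real \<Rightarrow> real" where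
  "kern R z x = inverse (1 + ((x - z) / R)\<^sup>2)"
definition kern' :: "real \<Rightarrow> real \<Rightarrow> real \<Rightarrow> real" where
  "kern' R z x = - (2 * ((x - z) / R) / R) * (kern R z x)\<^sup>2"
definition step :: "real \<Rightarrow> real \<Rightarrow> real \<Rightarrow> real" where
  "step R z x = R * (pi / 2 + arctan ((z - x) / R))"

lemma one_plus_sq_pos: "0 < 1 + y\<^sup>2" for y :: real
  by (simp add: add_pos_nonneg)

lemma kern_pos: "0 < kern R z x" and kern_le: "kern R z x \<le> 1" and kern_sym: "kern R z x = kern R x z"
  using one_plus_sq_pos[of "(x - z) / R"]
  by (auto simp: kern_def inverse_le_1_iff power_divide power2_commute)

lemma kern_deriv_x: 
  assumes R: "R > 0" shows "(kern R z has_real_derivative kern' R z x) (at x)"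
proof -
  have "((\<lambda>x. inverse (1 + ((x - z) / R)\<^sup>2)) has_real_derivative - (inverse (1 + ((x - z) / R)\<^sup>2) * (2 * ((x - z) / R) / R) * inverse (1 + ((x - z) / R)\<^sup>2))) (at x)"
    using one_plus_sq_pos[of "(x - z) / R"] R by (auto intro!: derivative_eq_intros)
  then show ?thesis unfolding kern_def[abs_def] kern'_def by (simp add: power2_eq_square mult.commute mult.left_commute)
qed

lemma kern'_le: 
  assumes R: "R > 0" shows "\<bar>kern' R z x\<bar> \<le> kern R z x / R"
proof -
  define y where "y = (x - z) / R"
  have k: "kern R z x = inverse (1 + y\<^sup>2)" by (simp add: kern_def y_def)
  have "2 * \<bar>y\<bar> \<le> 1 + y\<^sup>2" using sum_squares_bound[of 1 "\<bar>y\<bar>"] by simp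
  then have "2 * \<bar>y\<bar> * inverse (1 + y\<^sup>2) \<le> 1" using one_plus_sq_pos[of y] by (simp add: field_simps)
  then have "(2 * \<bar>y\<bar> * inverse (1 + y\<^sup>2)) * (inverse (1 + y\<^sup>2) / R) \<le> 1 * (inverse (1 + y\<^sup>2) / R)"
    using R one_plus_sq_pos[of y] by (intro mult_right_mono) auto
  moreover have "\<bar>kern' R z x\<bar> = (2 * \<bar>y\<bar> * inverse (1 + y\<^sup>2)) * (inverse (1 + y\<^sup>2) / R)"
    using R one_plus_sq_pos[of y] unfolding kern'_def k y_def[symmetric] by (simp add: abs_mult power2_eq_square)
  ultimately show ?thesis by (simp add: k)
qed

lemma kern'_le_inverse: "R > 0 \<Longrightarrow> \<bar>kern' R z x\<bar> \<le> 1 / R"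
  using kern'_le[of R z x] kern_le[of R z x] by (meson divide_right_mono less_imp_le order_trans)

lemma kern_cont: "R > 0 \<Longrightarrow> continuous_on A (kern R z)"
  using DERIV_isCont[OF kern_deriv_x] by (auto intro: continuous_at_imp_continuous_on)

lemma weight_kern: 
  assumes R: "R > 0" shows "weight (kern R z) (kern' R z)"
  unfolding weight_def
proof (intro conjI allI exI[of _ "max 1 (1 / R)"])
  show "(kern R z has_real_derivative kern' R z x) (at x)" for x by (rule kern_deriv_x[OF R])
  show "continuous_on UNIV (kern' R z)" unfolding kern'_def[abs_def] using R by (intro continuous_intros kern_cont) auto
  show "\<bar>kern R z x\<bar> \<le> max 1 (1 / R)" for x using kern_pos[of R z x] kern_le[of R z x] by simp
  show "\<bar>kern' R z x\<bar> \<le> max 1 (1 / R)" for x using kern'_le_inverse[OF R, of z x] by simp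
qed

lemma kern_lipschitz:
  assumes R: "R > 0" shows "\<bar>kern R z x - kern R z' x\<bar> \<le> 1 / R * \<bar>z - z'\<bar>"
proof -
  have "norm (kern R x z - kern R x z') \<le> 1 / R * norm (z - z')"
    by (rule field_differentiable_bound[of UNIV "kern R x" "kern' R x"]) (use kern_deriv_x[OF R] kern'_le_inverse[OF R] in auto)
  then show ?thesis by (simp add: kern_sym[of R _ x])
qed

lemma step_deriv_z:
  assumes R: "R > 0" shows "((\<lambda>z. step R z x) has_real_derivative kern R z x) (at z)"
proof -
  have "((z - x) / R)\<^sup>2 = ((x - z) / R)\<^sup>2" by (simp add: power_divide power2_commute)
  then show ?thesis unfolding step_def kern_def using R by (auto intro!: derivative_eq_intros)
qed

lemma step_deriv_x:
  assumes R: "R > 0" shows "(step R z has_real_derivative - kern R z x) (at x)"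
proof -
  have "((z - x) / R)\<^sup>2 = ((x - z) / R)\<^sup>2" by (simp add: power_divide power2_commute)
  then show ?thesis unfolding step_def[abs_def] kern_def using R by (auto intro!: derivative_eq_intros)
qed

lemma step_bounds: 
  assumes R: "R > 0" shows "0 \<le> step R z x" "step R z x \<le> pi * R"
proof -
  have "0 \<le> pi / 2 + arctan ((z - x) / R)" "pi / 2 + arctan ((z - x) / R) \<le> pi"
    using arctan_lbound[of "(z - x) / R"] arctan_ubound[of "(z - x) / R"] by linarith+
  then show "0 \<le> step R z x" "step R z x \<le> pi * R"
    using R mult_left_mono[of "pi / 2 + arctan ((z - x) / R)" pi R] by (auto simp: step_def mult.commute)
qed

lemma weight_step:
  assumes R: "R > 0" shows "weight (step R z) (\<lambda>x. - kern R z x)"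
  unfolding weight_def
proof (intro conjI allI exI[of _ "max 1 (pi * R)"])
  show "(step R z has_real_derivative - kern R z x) (at x)" for x by (rule step_deriv_x[OF R])
  show "continuous_on UNIV (\<lambda>x. - kern R z x)" by (intro continuous_intros kern_cont R)
  show "\<bar>step R z x\<bar> \<le> max 1 (pi * R)" for x using step_bounds[OF R, of z x] by simp
  show "\<bar>- kern R z x\<bar> \<le> max 1 (pi * R)" for x using kern_pos[of R z x] kern_le[of R z x] by simp
qed

lemma step_lipschitz:
  assumes R: "R > 0" shows "\<bar>step R z x - step R z' x\<bar> \<le> 1 * \<bar>z - z'\<bar>"
proof -
  have "norm (step R z x - step R z' x) \<le> 1 * norm (z - z')"
    by (rule field_differentiable_bound[of UNIV "\<lambda>z. step R z x" "\<lambda>z. kern R z x"])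
      (use step_deriv_z[OF R] kern_le kern_pos in \<open>auto simp: less_imp_le\<close>)
  then show ?thesis by simp
qed

lemma kern_integral:
  assumes R: "R > 0" shows "integrable lborel (kern R z)" "(LBINT x. kern R z x) = pi * R"
proof -
  have i: "integrable lborel (\<lambda>x::real. inverse (1 + x\<^sup>2))"
    using integrable_inverse_1_plus_square by (simp add: set_integrable_def einterval_def)
  have v: "(LBINT x. inverse (1 + x\<^sup>2)) = pi"
    using LBINT_inverse_1_plus_square
    by (simp add: interval_lebesgue_integral_def set_lebesgue_integral_def einterval_def)
  have eq: "kern R z x = inverse (1 + ((- z / R) + (1 / R) * x)\<^sup>2)" for x
    using R by (simp add: kern_def field_simps)
  show "integrable lborel (kern R z)"
    unfolding eq using lborel_integrable_real_affine[OF i, of "1/R" "- z / R"] R by simp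
  show "(LBINT x. kern R z x) = pi * R"
    unfolding eq using lborel_integral_real_affine[of "1/R" "\<lambda>x. inverse (1 + x\<^sup>2)" "- z / R"] R v
    by (simp add: field_simps)
qed

lemma joint_cont_pairing:
  fixes Q :: "real \<Rightarrow> real \<Rightarrow> real"
  assumes Q: "\<And>s. integrable lborel (Q s)" and c: "\<And>t. ((\<lambda>s. LBINT x. \<bar>Q s x - Q t x\<bar>) \<longlongrightarrow> 0) (at t)"
    and m: "\<And>z. K z \<in> borel_measurable borel" and B: "\<And>z x. \<bar>K z x\<bar> \<le> B" and L: "\<And>z z' x. \<bar>K z x - K z' x\<bar> \<le> B * \<bar>z - z'\<bar>"
  shows "continuous_on UNIV (\<lambda>y. LBINT x. K (snd y) x * Q (fst y) x)"
  unfolding continuous_on_eq_continuous_at[OF open_UNIV]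
proof
  fix y :: "real \<times> real"
  define t z where "t = fst y" and "z = snd y"
  define D where "D = (\<lambda>s. LBINT x. \<bar>Q s x - Q t x\<bar>)"
  have "isCont D t" using c[of t] by (simp add: isCont_def D_def)
  then have "isCont (\<lambda>y. D (fst y)) y" unfolding t_def by (intro isCont_o2[of y fst D]) (auto intro: continuous_intros)
  then have D0: "((\<lambda>y. D (fst y)) \<longlongrightarrow> 0) (at y)" by (simp add: isCont_def t_def[symmetric]) (simp add: D_def)
  have S0: "((\<lambda>y. snd y) \<longlongrightarrow> z) (at y)" unfolding z_def by (intro tendsto_intros)
  have lim: "((\<lambda>y. B * D (fst y) + (B * \<bar>snd y - z\<bar>) * (LBINT x. \<bar>Q t x\<bar>)) \<longlongrightarrow> B * 0 + (B * \<bar>z - z\<bar>) * (LBINT x. \<bar>Q t x\<bar>)) (at y)"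
    by (intro tendsto_intros D0 S0)
  have iw: "integrable lborel (\<lambda>x. K z x * Q s x)" for s z by (rule integrable_bounded_mult[OF Q m B])
  have iw2: "integrable lborel (\<lambda>x. K z x * (Q s x - Q t x))" for s z by (rule integrable_bounded_mult[OF _ m B]) (use Q in simp)
  have iw3: "integrable lborel (\<lambda>x. (K z' x - K z x) * Q t x)" for z'
    by (rule integrable_bounded_mult[OF Q _ L]) (use m in simp)
  have bnd: "\<bar>(LBINT x. K z' x * Q s x) - (LBINT x. K z x * Q t x)\<bar> \<le> B * D s + (B * \<bar>z' - z\<bar>) * (LBINT x. \<bar>Q t x\<bar>)" for s z'
  proof -
    have "(LBINT x. K z' x * Q s x) - (LBINT x. K z x * Q t x) = (LBINT x. K z' x * Q s x - K z x * Q t x)"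
      using iw by simp
    also have "\<dots> = (LBINT x. K z' x * (Q s x - Q t x) + (K z' x - K z x) * Q t x)"
      by (intro Bochner_Integration.integral_cong) (auto simp: algebra_simps)
    also have "\<dots> = (LBINT x. K z' x * (Q s x - Q t x)) + (LBINT x. (K z' x - K z x) * Q t x)"
      by (rule Bochner_Integration.integral_add[OF iw2 iw3])
    finally have e: "(LBINT x. K z' x * Q s x) - (LBINT x. K z x * Q t x) = \<dots>" .
    have "\<bar>LBINT x. K z' x * (Q s x - Q t x)\<bar> \<le> (LBINT x. \<bar>K z' x * (Q s x - Q t x)\<bar>)" by (rule integral_abs_bound)
    also have "\<dots> \<le> (LBINT x. B * \<bar>Q s x - Q t x\<bar>)"
      using Q by (intro integral_mono integrable_abs iw2 integrable_mult_right Bochner_Integration.integrable_diff) (auto simp: abs_mult intro: mult_right_mono B)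
    finally have 1: "\<bar>LBINT x. K z' x * (Q s x - Q t x)\<bar> \<le> B * D s" by (simp add: D_def)
    have "\<bar>LBINT x. (K z' x - K z x) * Q t x\<bar> \<le> (LBINT x. \<bar>(K z' x - K z x) * Q t x\<bar>)" by (rule integral_abs_bound)
    also have "\<dots> \<le> (LBINT x. (B * \<bar>z' - z\<bar>) * \<bar>Q t x\<bar>)"
      using Q by (intro integral_mono integrable_abs iw3 integrable_mult_right) (auto simp: abs_mult intro: mult_right_mono L)
    finally have 2: "\<bar>LBINT x. (K z' x - K z x) * Q t x\<bar> \<le> (B * \<bar>z' - z\<bar>) * (LBINT x. \<bar>Q t x\<bar>)" by simp
    show ?thesis unfolding e using 1 2 by linarith
  qed
  have "((\<lambda>y. \<bar>(LBINT x. K (snd y) x * Q (fst y) x) - (LBINT x. K z x * Q t x)\<bar>) \<longlongrightarrow> 0) (at y)"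
  proof (rule squeeze0_eventually)
    show "((\<lambda>y. B * D (fst y) + (B * \<bar>snd y - z\<bar>) * (LBINT x. \<bar>Q t x\<bar>)) \<longlongrightarrow> 0) (at y)"
      using lim by simp
    show "\<forall>\<^sub>F y in at y. \<bar>(LBINT x. K (snd y) x * Q (fst y) x) - (LBINT x. K z x * Q t x)\<bar>
        \<le> B * D (fst y) + (B * \<bar>snd y - z\<bar>) * (LBINT x. \<bar>Q t x\<bar>)"
      by (intro always_eventually allI bnd)
  qed simp
  then have "((\<lambda>y. (LBINT x. K (snd y) x * Q (fst y) x) - (LBINT x. K z x * Q t x)) \<longlongrightarrow> 0) (at y)"
    by (rule tendsto_rabs_zero_cancel)
  then have "((\<lambda>y. (LBINT x. K (snd y) x * Q (fst y) x)) \<longlongrightarrow> (LBINT x. K z x * Q t x)) (at y)"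
    by (rule LIM_zero_cancel)
  then show "isCont (\<lambda>y. LBINT x. K (snd y) x * Q (fst y) x) y"
    by (simp add: isCont_def t_def z_def)
qed

definition jcont :: "(real \<Rightarrow> real \<Rightarrow> real) \<Rightarrow> bool" where
  "jcont f \<longleftrightarrow> continuous_on UNIV (\<lambda>y. f (fst y) (snd y))"

lemma jcontD: "jcont f \<Longrightarrow> continuous_on A g \<Longrightarrow> continuous_on A h \<Longrightarrow> continuous_on A (\<lambda>y. f (g y) (h y))"
  unfolding jcont_def using continuous_on_compose2[of UNIV "\<lambda>y. f (fst y) (snd y)" A "\<lambda>y. (g y, h y)"]
  by (simp add: continuous_on_Pair)

text \<open>Integral over the time interval from \<open>t\<close> to \<open>t + R\<close>. Integrating
  over the fixed interval \<open>[0, R]\<close> makes continuity and derivatives in the parameters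
  instances of general facts.\<close>

definition window :: "real \<Rightarrow> (real \<Rightarrow> real \<Rightarrow> real) \<Rightarrow> real \<Rightarrow> real \<Rightarrow> real" where
  "window R f t z = integral {0..R} (\<lambda>s. f (t + s) z)"

lemma window_eq: "window R f t z = integral {t..t+R} (\<lambda>s. f s z)"
  using integral_shift_Icc_real[of 0 R "\<lambda>s. f s z" t] by (simp add: window_def o_def add.commute)

lemma jcont_window:
  assumes "jcont f" shows "jcont (window R f)"
proof -
  have "continuous_on (UNIV \<times> cbox 0 R) (\<lambda>(y, s). f (fst y + s) (snd y))"
    unfolding case_prod_beta' by (intro jcontD[OF assms] continuous_intros)
  from integral_continuous_on_param[OF this] show ?thesis by (simp add: jcont_def window_def)
qed

lemma window_dt:
  assumes f: "jcont f" and R: "R > 0"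
  shows "((\<lambda>t. window R f t z) has_real_derivative f (t + R) z - f t z) (at t)"
proof -
  define F where "F = primitive (\<lambda>s. f s z)"
  have c: "continuous_on UNIV (\<lambda>s. f s z)" by (intro jcontD[OF f] continuous_intros)
  have l: "loc_integrable (\<lambda>s. f s z)" by (rule loc_integrableI_continuous[OF c])
  have dF: "(F has_real_derivative f x z) (at x)" for x
    unfolding F_def by (rule primitive_deriv[OF c])
  have "window R f t z = F (t + R) - F t" for t
    unfolding window_eq F_def using primitive_diff[OF l, of t "t + R"] R by simp
  moreover have "((\<lambda>t. F (t + R) - F t) has_real_derivative f (t + R) z - f t z) (at t)"
    by (intro DERIV_diff dF DERIV_shift[THEN iffD1] dF)
  ultimately show ?thesis by simp
qed

lemma window_dz:
  assumes f: "jcont f" and g: "jcont g" and d: "\<And>s z. ((\<lambda>z. f s z) has_real_derivative g s z) (at z)"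
  shows "((\<lambda>z. window R f t z) has_real_derivative window R g t z) (at z)"
  unfolding window_def
proof (rule leibniz_rule_field_derivative[where U=UNIV and a=0 and b=R, unfolded cbox_interval])
  show "((\<lambda>z. f (t + s) z) has_real_derivative g (t + s) z) (at z)" for s z by (rule d)
  show "(\<lambda>s. f (t + s) z) integrable_on {0..R}" for z
    by (intro integrable_continuous_real jcontD[OF f] continuous_intros)
  show "continuous_on (UNIV \<times> {0..R}) (\<lambda>(z, s). g (t + s) z)"
    unfolding case_prod_beta' by (intro jcontD[OF g] continuous_intros)
qed auto

lemma window_integrable: 
  assumes "jcont f" shows "(\<lambda>s. f (t + s) z) integrable_on {0..R}"
  by (intro integrable_continuous_real jcontD[OF assms] continuous_intros)

lemma window_mono:
  assumes "jcont f" "jcont g" "\<And>s. s \<in> {t..t+R} \<Longrightarrow> f s z \<le> g s z"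
  shows "window R f t z \<le> window R g t z"
  unfolding window_def by (intro integral_le window_integrable assms) (use assms(3) in auto)

lemma window_const: "R > 0 \<Longrightarrow> window R (\<lambda>_ _. c) t z = R * c"
  by (simp add: window_def)

lemma window_add: "jcont f \<Longrightarrow> jcont g \<Longrightarrow> window R (\<lambda>s z. f s z + g s z) t z = window R f t z + window R g t z"
  unfolding window_def by (intro Henstock_Kurzweil_Integration.integral_add window_integrable)

lemma window_cmult: "window R (\<lambda>s z. c * f s z) t z = c * window R f t z"
  unfolding window_def by simp

lemma jcont_add: "jcont f \<Longrightarrow> jcont g \<Longrightarrow> jcont (\<lambda>s z. f s z + g s z)"
  unfolding jcont_def by (rule continuous_on_add)
lemma jcont_diff: "jcont f \<Longrightarrow> jcont g \<Longrightarrow> jcont (\<lambda>s z. f s z - g s z)"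
  unfolding jcont_def by (rule continuous_on_diff)
lemma jcont_cmult: "jcont f \<Longrightarrow> jcont (\<lambda>s z. c * f s z)"
  unfolding jcont_def by (rule continuous_on_mult_left)
lemma jcont_mult: "jcont f \<Longrightarrow> jcont g \<Longrightarrow> jcont (\<lambda>s z. f s z * g s z)"
  unfolding jcont_def by (rule continuous_on_mult)
lemma jcont_const: "jcont (\<lambda>s z. c)" by (simp add: jcont_def)
lemma jcont_shift: 
  assumes "jcont f" shows "jcont (\<lambda>s z. f (s + c) z)"
  unfolding jcont_def[of "\<lambda>s z. f (s + c) z"] by (intro jcontD[OF assms] continuous_intros)

text \<open>Green's theorem on a rectangle for the two-form \<open>dP \<and> dQ\<close>, whose primitive is \<open>P dQ\<close>. The function \<open>D\<close> is the mixed
  second derivative of \<open>Q\<close>, which is obtained from either first derivative.\<close>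

lemma green_dP_dQ:
  fixes P Q Pt Pz Qt Qz D :: "real \<Rightarrow> real \<Rightarrow> real"
  assumes c: "jcont P" "jcont Pt" "jcont Pz" "jcont Qt" "jcont Qz" "jcont D"
    and Pt: "\<And>t z. ((\<lambda>t. P t z) has_real_derivative Pt t z) (at t)"
    and Pz: "\<And>t z. ((\<lambda>z. P t z) has_real_derivative Pz t z) (at z)"
    and Qzt: "\<And>t z. ((\<lambda>t. Qz t z) has_real_derivative D t z) (at t)"
    and Qtz: "\<And>t z. ((\<lambda>z. Qt t z) has_real_derivative D t z) (at z)"
    and st: "s \<le> t" and ab: "a \<le> b"
  shows "integral {s..t} (\<lambda>r. integral {a..b} (\<lambda>z. Pt r z * Qz r z - Pz r z * Qt r z)) 
      = integral {a..b} (\<lambda>z. P t z * Qz t z) - integral {a..b} (\<lambda>z. P s z * Qz s z)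
        - integral {s..t} (\<lambda>r. P r b * Qt r b - P r a * Qt r a)"
proof -
  define J where "J = (\<lambda>t. integral {a..b} (\<lambda>z. P t z * Qz t z))"
  define A where "A = (\<lambda>r. integral {a..b} (\<lambda>z. Pt r z * Qz r z - Pz r z * Qt r z))"
  define S where "S = (\<lambda>r. P r b * Qt r b - P r a * Qt r a)"
  have dJ: "(J has_real_derivative A r + S r) (at r)" for r
  proof -
    have "(J has_real_derivative integral {a..b} (\<lambda>z. Pt r z * Qz r z + D r z * P r z)) (at r)"
      unfolding J_def
    proof (rule leibniz_rule_field_derivative[where U=UNIV and a=a and b=b, unfolded cbox_interval])
      show "((\<lambda>r. P r z * Qz r z) has_real_derivative Pt r z * Qz r z + D r z * P r z) (at r)" for r z
        by (rule DERIV_mult[OF Pt Qzt])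
      show "(\<lambda>z. P r z * Qz r z) integrable_on {a..b}" for r
        by (intro integrable_continuous_real continuous_intros jcontD[OF c(1)] jcontD[OF c(5)])
      show "continuous_on (UNIV \<times> {a..b}) (\<lambda>(r, z). Pt r z * Qz r z + D r z * P r z)"
        unfolding case_prod_beta'
        by (intro continuous_intros jcontD[OF c(1)] jcontD[OF c(2)] jcontD[OF c(5)] jcontD[OF c(6)])
    qed auto
    also have "integral {a..b} (\<lambda>z. Pt r z * Qz r z + D r z * P r z) = A r + S r"
    proof -
      have "integral {a..b} (\<lambda>z. Pz r z * Qt r z + D r z * P r z) = S r"
        unfolding S_def by (rule FTC_integral[OF ab DERIV_mult[OF Pz Qtz]])
      moreover have "integral {a..b} (\<lambda>z. (Pt r z * Qz r z - Pz r z * Qt r z) + (Pz r z * Qt r z + D r z * P r z)) = A r + integral {a..b} (\<lambda>z. Pz r z * Qt r z + D r z * P r z)"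
        unfolding A_def
        by (intro Henstock_Kurzweil_Integration.integral_add integrable_continuous_real continuous_intros 
              jcontD[OF c(1)] jcontD[OF c(2)] jcontD[OF c(3)] jcontD[OF c(4)] jcontD[OF c(5)] jcontD[OF c(6)])
      ultimately show ?thesis by simp
    qed
    finally show ?thesis .
  qed
  have "integral {s..t} (\<lambda>r. A r + S r) = J t - J s" by (rule FTC_integral[OF st dJ])
  moreover have "continuous_on {s..t} A"
    unfolding A_def
    by (rule integral_continuous_on_param[where a=a and b=b, unfolded cbox_interval])
      (unfold case_prod_beta', intro continuous_intros jcontD[OF c(2)] jcontD[OF c(3)] jcontD[OF c(4)] jcontD[OF c(5)])
  moreover have "continuous_on {s..t} S"
    unfolding S_def by (intro continuous_intros jcontD[OF c(1)] jcontD[OF c(4)])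
  ultimately have "integral {s..t} A + integral {s..t} S = J t - J s"
    by (simp add: Henstock_Kurzweil_Integration.integral_add integrable_continuous_real)
  then have "integral {s..t} A = J t - J s - integral {s..t} S" by linarith
  then show ?thesis unfolding A_def S_def J_def .
qed

section \<open>Uniform bounds from the energy\<close>

locale bounded_flow = wave_flow +
  fixes E :: real
  assumes E_pos: "E > 0"
    and energy_le: "(LBINT x. (w t x)\<^sup>2 / 2 + (v t x)\<^sup>2 / 2 + V t x) \<le> E"

context wave_flow
begin

lemma w_square_integrable: "integrable lborel (\<lambda>x. (w t x)\<^sup>2)" by (rule in_L2_sq[OF w_L2])
lemma v_square_integrable: "integrable lborel (\<lambda>x. (v t x)\<^sup>2)" by (rule in_L2_sq[OF v_L2])

lemma weight_one: "weight (\<lambda>_. 1) (\<lambda>_. 0)" by (auto simp: weight_def intro!: exI[of _ 1])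

lemma null_energy_const:
  assumes "\<sigma>\<^sup>2 = 1" shows "(LBINT x. (W \<sigma> t x)\<^sup>2 / 2 + V t x) = (LBINT x. (W \<sigma> s x)\<^sup>2 / 2 + V s x)"
proof -
  have "((\<lambda>t. LBINT x. (W \<sigma> t x)\<^sup>2 / 2 + V t x) has_real_derivative 0) (at t)" for t
    using null_energy_conservation[OF assms weight_one, of t] by simp
  from DERIV_isconst_all[OF this[THEN allI]] show ?thesis by simp
qed

lemma energy_const:
  "(LBINT x. (w t x)\<^sup>2 / 2 + (v t x)\<^sup>2 / 2 + V t x) = (LBINT x. (w s x)\<^sup>2 / 2 + (v s x)\<^sup>2 / 2 + V s x)"
proof -
  have "2 * (LBINT x. (w t x)\<^sup>2 / 2 + (v t x)\<^sup>2 / 2 + V t x) 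
    = (LBINT x. (W 1 t x)\<^sup>2 / 2 + V t x) + (LBINT x. (W (-1) t x)\<^sup>2 / 2 + V t x)" for t
  proof -
    have "(LBINT x. (W 1 t x)\<^sup>2 / 2 + V t x) + (LBINT x. (W (-1) t x)\<^sup>2 / 2 + V t x)
      = (LBINT x. ((W 1 t x)\<^sup>2 / 2 + V t x) + ((W (-1) t x)\<^sup>2 / 2 + V t x))"
      using W_square_integrable V_integrable by (intro Bochner_Integration.integral_add[symmetric] Bochner_Integration.integrable_add integrable_divide)
    also have "\<dots> = (LBINT x. 2 * ((w t x)\<^sup>2 / 2 + (v t x)\<^sup>2 / 2 + V t x))"
      by (intro Bochner_Integration.integral_cong) (auto simp: W_def power2_eq_square field_simps)
    finally show ?thesis by (simp only: integral_mult_right_zero)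
  qed
  from this[of t] this[of s] show ?thesis
    using null_energy_const[OF power_one, of t s] null_energy_const[of "-1" t s, OF power2_minus[of 1, unfolded power_one]] by linarith
qed

end

context bounded_flow
begin

lemma V_nonneg: "0 \<le> V t x" by (rule pot_nonneg[OF p])

lemma energy_parts:
  "(LBINT x. (w t x)\<^sup>2) / 2 + (LBINT x. (v t x)\<^sup>2) / 2 + (LBINT x. V t x) \<le> E"
  using energy_le[of t] w_square_integrable[of t] v_square_integrable[of t] V_integrable[of t]
  by (simp only: Bochner_Integration.integral_add Bochner_Integration.integrable_add integrable_divide integral_divide_zero)

lemma V_le: "(LBINT x. V t x) \<le> E"
proof -
  have "0 \<le> (LBINT x. (w t x)\<^sup>2)" "0 \<le> (LBINT x. (v t x)\<^sup>2)" by (intro integral_nonneg_AE AE_I2; simp)+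
  with energy_parts[of t] show ?thesis by linarith
qed

lemma v_norm_le: "(norm_L2 (v t))\<^sup>2 \<le> 2 * E"
proof -
  have "0 \<le> (LBINT x. (w t x)\<^sup>2)" "0 \<le> (LBINT x. V t x)" by (intro integral_nonneg_AE AE_I2; simp add: V_nonneg)+
  with energy_parts[of t] show ?thesis unfolding norm_L2_square by linarith
qed

lemma null_energy_le:
  assumes "\<sigma>\<^sup>2 = 1" shows "(LBINT x. (W \<sigma> t x)\<^sup>2 / 2 + V t x) \<le> 2 * E"
proof -
  have "(LBINT x. (W \<sigma> t x)\<^sup>2 / 2 + V t x) \<le> (LBINT x. 2 * ((w t x)\<^sup>2 / 2 + (v t x)\<^sup>2 / 2 + V t x))"
  proof (rule integral_mono)
    show "integrable lborel (\<lambda>x. (W \<sigma> t x)\<^sup>2 / 2 + V t x)" using W_square_integrable V_integrable by simp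
    show "integrable lborel (\<lambda>x. 2 * ((w t x)\<^sup>2 / 2 + (v t x)\<^sup>2 / 2 + V t x))"
      using w_square_integrable v_square_integrable V_integrable by simp
    fix x
    have "(w t x + \<sigma> * v t x)\<^sup>2 + (w t x - \<sigma> * v t x)\<^sup>2 = 2 * (w t x)\<^sup>2 + 2 * \<sigma>\<^sup>2 * (v t x)\<^sup>2"
      by (simp add: power2_eq_square algebra_simps)
    then have "(W \<sigma> t x)\<^sup>2 \<le> 2 * (w t x)\<^sup>2 + 2 * (v t x)\<^sup>2"
      unfolding W_def assms using zero_le_power2[of "w t x - \<sigma> * v t x"] by linarith
    then show "(W \<sigma> t x)\<^sup>2 / 2 + V t x \<le> 2 * ((w t x)\<^sup>2 / 2 + (v t x)\<^sup>2 / 2 + V t x)"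
      using V_nonneg[of t x] by simp
  qed
  also have "\<dots> \<le> 2 * E" using energy_le[of t] by (simp only: integral_mult_right_zero)
  finally show ?thesis .
qed

lemma W_square_le: "\<sigma>\<^sup>2 = 1 \<Longrightarrow> (LBINT x. (W \<sigma> t x)\<^sup>2) \<le> 4 * E"
proof -
  assume s: "\<sigma>\<^sup>2 = 1"
  have "0 \<le> (LBINT x. V t x)" by (intro integral_nonneg_AE AE_I2) (simp add: V_nonneg)
  with null_energy_le[OF s, of t] show ?thesis using W_square_integrable[of \<sigma> t] V_integrable[of t] by simp
qed

text \<open>The energy bounds the norm of \<open>v\<close> by \<open>sqrt (2 E)\<close>, so \<open>U
  t\<close> is Hoelder continuous with exponent \<open>1/2\<close>; the length of the interval is
  chosen so that \<open>U t\<close> changes on it by at most \<open>\<delta> / 2\<close>.\<close>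

lemma U_near:
  assumes d: "0 \<le> \<delta>" and y: "x0 \<le> y" "y \<le> x0 + \<delta>\<^sup>2 / (8 * E)"
  shows "\<bar>U t x0\<bar> - \<delta> / 2 \<le> \<bar>U t y\<bar>"
proof -
  have "\<bar>U t y - U t x0\<bar> \<le> sqrt (y - x0) * norm_L2 (v t)" by (rule is_L2_primitive_bound[OF U_primitive y(1)])
  also have "\<dots> \<le> sqrt (\<delta>\<^sup>2 / (8 * E)) * sqrt (2 * E)"
    using y v_norm_le[of t] by (intro mult_mono real_sqrt_le_mono real_le_rsqrt) (auto simp: norm_L2_nonneg)
  also have "\<dots> = sqrt (\<delta>\<^sup>2 / 4)" using E_pos by (simp add: real_sqrt_mult[symmetric])
  also have "\<dots> = \<delta> / 2" using d by (simp add: real_sqrt_divide)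
  finally show ?thesis by linarith
qed

lemma pot_mono: "0 \<le> a \<Longrightarrow> a \<le> \<bar>b\<bar> \<Longrightarrow> pot p a \<le> pot p b"
  using p by (auto simp: pot_def intro!: divide_right_mono powr_mono2)

lemma mass_near:
  assumes \<Phi>: "weight \<Phi> \<Phi>'" "\<And>x. 0 \<le> \<Phi> x" "\<And>y. x0 \<le> y \<Longrightarrow> y \<le> x0 + \<delta>\<^sup>2 / (8 * E) \<Longrightarrow> k \<le> \<Phi> y"
    and d: "0 < \<delta>" "0 \<le> k" and b: "0 \<le> b" "b \<le> \<bar>U t x0\<bar> - \<delta> / 2"
  shows "k * pot p b * (\<delta>\<^sup>2 / (8 * E)) \<le> (LBINT x. \<Phi> x * V t x)"
proof -
  define l where "l = \<delta>\<^sup>2 / (8 * E)"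
  have l: "0 \<le> l" using E_pos by (simp add: l_def)
  have "k * pot p b * l = (LBINT x. indicator {x0..x0+l} x * (k * pot p b))" using l by simp
  also have "\<dots> \<le> (LBINT x. \<Phi> x * V t x)"
  proof (rule integral_mono)
    show "integrable lborel (\<lambda>x. indicator {x0..x0 + l} x * (k * pot p b))"
      by (rule integrable_Icc)
    show "integrable lborel (\<lambda>x. \<Phi> x * V t x)" by (rule weight_integrable(1)[OF \<Phi>(1) V_integrable])
    fix x
    have "k * pot p b \<le> \<Phi> x * V t x" if "x \<in> {x0..x0+l}"
    proof (intro mult_mono \<Phi> pot_mono b)
      show "b \<le> \<bar>U t x\<bar>" using b(2) U_near[of \<delta> x0 x t] that d by (auto simp: l_def)
    qed (use that in \<open>auto simp: l_def pot_nonneg[OF p]\<close>)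
    then show "indicator {x0..x0 + l} x * (k * pot p b) \<le> \<Phi> x * V t x"
      using \<Phi>(2) V_nonneg by (auto simp: indicator_def)
  qed
  finally show ?thesis by (simp add: l_def)
qed

text \<open>The energy does not control the norm of \<open>U t\<close> in $L^2(\mathbb{R})$, so
  Sobolev's inequality is of no use for a uniform bound. Instead, a large value of \<open>U t\<close>
  forces a large potential energy nearby.\<close>

lemma U_bound: "\<bar>U t x\<bar> \<le> 2 + 8 * E\<^sup>2 * (p + 1)"
proof (rule ccontr)
  define E2 where "E2 = E\<^sup>2 * (p + 1)"
  assume "\<not> ?thesis"
  then have m: "\<bar>U t x\<bar> > 2 + 8 * E2" by (simp add: E2_def)
  define b where "b = \<bar>U t x\<bar> - 1 / 2"
  have "E2 \<ge> 0" using p by (simp add: E2_def)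
  then have b1: "b \<ge> 1" "b > 8 * E2" using m by (auto simp: b_def)
  have "1 * pot p b * (1\<^sup>2 / (8 * E)) \<le> (LBINT x. 1 * V t x)"
    by (rule mass_near[OF weight_one]) (use b1 in \<open>auto simp: b_def\<close>)
  also have "\<dots> \<le> E" using V_le by simp
  finally have "pot p b / (8 * E) \<le> E" by simp
  then have "pot p b \<le> 8 * E\<^sup>2" using E_pos by (simp add: field_simps power2_eq_square)
  moreover have "b / (p + 1) \<le> pot p b"
  proof -
    have "b powr 1 \<le> b powr (p + 1)" using b1 p by (intro powr_mono) auto
    then show ?thesis using b1 p by (simp add: pot_def divide_right_mono)
  qed
  ultimately have "b / (p + 1) \<le> 8 * E\<^sup>2" by linarith
  then have "b \<le> 8 * E2" using p by (simp add: E2_def field_simps)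
  with b1 show False by simp
qed

end

section \<open>The interaction estimate\<close>

locale windowed_flow = bounded_flow +
  fixes R :: real
  assumes R: "R > 0"
begin

text \<open>Averages over the window around \<open>z\<close> of half the square of a null derivative, of
  the potential energy, and of the product of the two null derivatives. The functions
  \<open>cumD\<close> accumulate \<open>W\<^sup>2/2 + V\<close> over windows to the left of
  \<open>z\<close>.\<close>

definition nullD :: "real \<Rightarrow> real \<Rightarrow> real \<Rightarrow> real" where
  "nullD \<sigma> s z = (LBINT x. kern R z x * ((W \<sigma> s x)\<^sup>2 / 2))"
definition potD :: "real \<Rightarrow> real \<Rightarrow> real" where
  "potD s z = (LBINT x. kern R z x * V s x)"
definition prodD :: "real \<Rightarrow> real \<Rightarrow> real" where
  "prodD s z = (LBINT x. kern R z x * (W (-1) s x * W 1 s x))"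
definition cumD :: "real \<Rightarrow> real \<Rightarrow> real \<Rightarrow> real" where
  "cumD \<sigma> s z = (LBINT x. step R z x * ((W \<sigma> s x)\<^sup>2 / 2 + V s x))"

lemma kern_integrable: "integrable lborel Q \<Longrightarrow> integrable lborel (\<lambda>x. kern R z x * Q x)"
  by (rule weight_integrable(1)[OF weight_kern[OF R]])
lemma kern'_integrable: "integrable lborel Q \<Longrightarrow> integrable lborel (\<lambda>x. kern' R z x * Q x)"
  by (rule weight_integrable(2)[OF weight_kern[OF R]])
lemma step_integrable: "integrable lborel Q \<Longrightarrow> integrable lborel (\<lambda>x. step R z x * Q x)"
  by (rule weight_integrable(1)[OF weight_step[OF R]])

lemma W2_integrable: "integrable lborel (\<lambda>x. (W \<sigma> s x)\<^sup>2 / 2)" using W_square_integrable by simp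
lemma WV_integrable: "integrable lborel (\<lambda>x. (W \<sigma> s x)\<^sup>2 / 2 + V s x)" using W2_integrable V_integrable by simp

lemma L1_cont_W: "((\<lambda>s. LBINT x. \<bar>(W \<sigma> s x)\<^sup>2 / 2 - (W \<sigma> t x)\<^sup>2 / 2\<bar>) \<longlongrightarrow> 0) (at t)"
  using L2_cont_inner[OF in_L2_cmult[OF W_L2] W_L2 L2_cont_cmult[OF W_cont, of "1/2"] W_cont]
  by (simp add: power2_eq_square)

lemma L1_cont_V: "((\<lambda>s. LBINT x. \<bar>V s x - V t x\<bar>) \<longlongrightarrow> 0) (at t)"
  using L2_cont_inner[OF in_L2_cmult[OF nl_L2] U_L2 L2_cont_cmult[OF nl_L2_cont, of "1/(p+1)"] U_L2_cont]
  by (simp add: pot_eq[OF p])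

lemma L1_cont_WW: "((\<lambda>s. LBINT x. \<bar>W (-1) s x * W 1 s x - W (-1) t x * W 1 t x\<bar>) \<longlongrightarrow> 0) (at t)"
  by (rule L2_cont_inner[OF W_L2 W_L2 W_cont W_cont])

lemma jcont_kern:
  assumes "\<And>s. integrable lborel (Q s)" "\<And>t. ((\<lambda>s. LBINT x. \<bar>Q s x - Q t x\<bar>) \<longlongrightarrow> 0) (at t)"
  shows "jcont (\<lambda>s z. LBINT x. kern R z x * Q s x)"
  unfolding jcont_def
proof (rule joint_cont_pairing[OF assms, where B="max 1 (1 / R)"])
  show "kern R z \<in> borel_measurable borel" for z by (rule weight_meas(1)[OF weight_kern[OF R]])
  show "\<bar>kern R z x\<bar> \<le> max 1 (1 / R)" for z x using kern_pos[of R z x] kern_le[of R z x] by simp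
  show "\<bar>kern R z x - kern R z' x\<bar> \<le> max 1 (1 / R) * \<bar>z - z'\<bar>" for z z' x
    using kern_lipschitz[OF R, of z x z'] mult_right_mono[of "1 / R" "max 1 (1 / R)" "\<bar>z - z'\<bar>"] by simp
qed

lemma jcont_step:
  assumes "\<And>s. integrable lborel (Q s)" "\<And>t. ((\<lambda>s. LBINT x. \<bar>Q s x - Q t x\<bar>) \<longlongrightarrow> 0) (at t)"
  shows "jcont (\<lambda>s z. LBINT x. step R z x * Q s x)"
  unfolding jcont_def
proof (rule joint_cont_pairing[OF assms, where B="max 1 (pi * R)"])
  show "step R z \<in> borel_measurable borel" for z by (rule weight_meas(1)[OF weight_step[OF R]])
  show "\<bar>step R z x\<bar> \<le> max 1 (pi * R)" for z x using step_bounds[OF R, of z x] by simp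
  show "\<bar>step R z x - step R z' x\<bar> \<le> max 1 (pi * R) * \<bar>z - z'\<bar>" for z z' x
    using step_lipschitz[OF R, of z x z'] mult_right_mono[of 1 "max 1 (pi * R)" "\<bar>z - z'\<bar>"] by simp
qed

lemma jcont_nullD: "jcont (nullD \<sigma>)"
  unfolding nullD_def[abs_def] by (rule jcont_kern[OF W2_integrable L1_cont_W])
lemma jcont_potD: "jcont potD"
  unfolding potD_def[abs_def] by (rule jcont_kern[OF V_integrable L1_cont_V])
lemma jcont_prodD: "jcont prodD"
  unfolding prodD_def[abs_def] by (rule jcont_kern[OF in_L2_mult[OF W_L2 W_L2] L1_cont_WW])
lemma jcont_cumD: "jcont (cumD \<sigma>)"
proof -
  have "cumD \<sigma> = (\<lambda>s z. (LBINT x. step R z x * ((W \<sigma> s x)\<^sup>2 / 2)) + (LBINT x. step R z x * V s x))"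
    unfolding cumD_def[abs_def] distrib_left
    by (intro ext Bochner_Integration.integral_add step_integrable W2_integrable V_integrable)
  then show ?thesis
    using jcont_add[OF jcont_step[OF W2_integrable L1_cont_W] jcont_step[OF V_integrable L1_cont_V]] by simp
qed

definition massD :: "real \<Rightarrow> real \<Rightarrow> real \<Rightarrow> real" where
  "massD \<sigma> s z = nullD \<sigma> s z + potD s z"

lemma jcont_massD: "jcont (massD \<sigma>)"
  unfolding massD_def[abs_def] by (intro jcont_add jcont_nullD jcont_potD)

lemma massD_eq: "massD \<sigma> s z = (LBINT x. kern R z x * ((W \<sigma> s x)\<^sup>2 / 2 + V s x))"
  unfolding massD_def nullD_def potD_def distrib_left
  by (rule Bochner_Integration.integral_add[symmetric]) (intro kern_integrable W2_integrable V_integrable)+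

lemma nullD_minus_potD: "nullD \<sigma> s z - potD s z = (LBINT x. kern R z x * ((W \<sigma> s x)\<^sup>2 / 2 - V s x))"
  unfolding nullD_def potD_def right_diff_distrib
  by (rule Bochner_Integration.integral_diff[symmetric]) (intro kern_integrable W2_integrable V_integrable)+

lemma nullD_nonneg: "0 \<le> nullD \<sigma> s z" and potD_nonneg: "0 \<le> potD s z" 
  unfolding nullD_def potD_def using kern_pos[of R z] V_nonneg by (auto intro!: integral_nonneg_AE AE_I2 mult_nonneg_nonneg simp: less_imp_le)

lemma massD_nonneg: "0 \<le> massD \<sigma> s z" unfolding massD_def using nullD_nonneg potD_nonneg by (simp add: add_nonneg_nonneg)

lemma massD_le: "\<sigma>\<^sup>2 = 1 \<Longrightarrow> massD \<sigma> s z \<le> 2 * E"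
proof -
  assume s: "\<sigma>\<^sup>2 = 1"
  have "massD \<sigma> s z \<le> (LBINT x. (W \<sigma> s x)\<^sup>2 / 2 + V s x)"
    unfolding massD_eq
  proof (intro integral_mono kern_integrable WV_integrable)
    fix x show "kern R z x * ((W \<sigma> s x)\<^sup>2 / 2 + V s x) \<le> (W \<sigma> s x)\<^sup>2 / 2 + V s x"
      using mult_right_mono[OF kern_le[of R z x], of "(W \<sigma> s x)\<^sup>2 / 2 + V s x"] V_nonneg[of s x] by simp
  qed
  also have "\<dots> \<le> 2 * E" by (rule null_energy_le[OF s])
  finally show ?thesis .
qed

lemma cumD_bounds: 
  assumes s: "\<sigma>\<^sup>2 = 1" shows "0 \<le> cumD \<sigma> s z" "cumD \<sigma> s z \<le> 2 * pi * R * E"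
proof -
  show "0 \<le> cumD \<sigma> s z"
    unfolding cumD_def using step_bounds[OF R] V_nonneg by (intro integral_nonneg_AE AE_I2 mult_nonneg_nonneg) auto
  have "cumD \<sigma> s z \<le> (LBINT x. (pi * R) * ((W \<sigma> s x)\<^sup>2 / 2 + V s x))"
    unfolding cumD_def using step_bounds[OF R] V_nonneg
    by (intro integral_mono step_integrable integrable_mult_right WV_integrable mult_right_mono) auto
  also have "\<dots> = pi * R * (LBINT x. (W \<sigma> s x)\<^sup>2 / 2 + V s x)" by (rule integral_mult_right_zero)
  also have "\<dots> \<le> pi * R * (2 * E)" using R by (intro mult_left_mono null_energy_le s) auto
  finally show "cumD \<sigma> s z \<le> 2 * pi * R * E" by simp
qed

text \<open>Both partial derivatives of \<open>cumD \<sigma>\<close> are window averages: \<open>massD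
  \<sigma>\<close> in the variable \<open>z\<close>, and by the conservation law
  \<open>\<sigma>\<close> times the difference of \<open>nullD \<sigma>\<close> and
  \<open>potD\<close> in time.\<close>

lemma cumD_dt:
  assumes s: "\<sigma>\<^sup>2 = 1"
  shows "((\<lambda>s. cumD \<sigma> s z) has_real_derivative \<sigma> * (nullD \<sigma> t z - potD t z)) (at t)"
  using null_energy_conservation[OF s weight_step[OF R], of z t] unfolding cumD_def nullD_minus_potD by simp

lemma cumD_dz: "((\<lambda>z. cumD \<sigma> s z) has_real_derivative massD \<sigma> s z) (at z)"
proof -
  have "has_L1_deriv (\<lambda>z x. (W \<sigma> s x)\<^sup>2 / 2 + V s x) (\<lambda>x. 0) z"
    using WV_integrable by (simp add: has_L1_deriv_def)
  then have "((\<lambda>z. cumD \<sigma> s z) has_real_derivative (LBINT x. kern R z x * ((W \<sigma> s x)\<^sup>2 / 2 + V s x) + step R z x * 0)) (at z)"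
    unfolding cumD_def
  proof (rule has_L1_deriv_weight[where \<Phi>="step R" and B="max 1 (pi * R)" and \<Phi>'="kern R z"])
    show "step R z \<in> borel_measurable borel" for z by (rule weight_meas(1)[OF weight_step[OF R]])
    show "\<bar>step R z x\<bar> \<le> max 1 (pi * R)" for z x using step_bounds[OF R, of z x] by simp
    show "\<bar>step R z x - step R z' x\<bar> \<le> max 1 (pi * R) * \<bar>z - z'\<bar>" for z z' x
      using step_lipschitz[OF R, of z x z'] mult_right_mono[of 1 "max 1 (pi * R)" "\<bar>z - z'\<bar>"] by simp
    show "((\<lambda>z. step R z x) has_real_derivative kern R z x) (at z)" for x by (rule step_deriv_z[OF R])
  qed
  then show ?thesis by (simp add: massD_eq)
qed

definition flux :: "real \<Rightarrow> real \<Rightarrow> real \<Rightarrow> real" where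
  "flux \<sigma> t z = cumD \<sigma> (t + R) z - cumD \<sigma> t z"

lemma flux_eq:
  assumes s: "\<sigma>\<^sup>2 = 1" shows "flux \<sigma> t z = \<sigma> * (window R (nullD \<sigma>) t z - window R potD t z)"
proof -
  have "flux \<sigma> t z = integral {t..t+R} (\<lambda>s. \<sigma> * (nullD \<sigma> s z - potD s z))"
    unfolding flux_def using R by (intro FTC_integral[symmetric] cumD_dt[OF s]) simp
  also have "\<dots> = \<sigma> * (integral {t..t+R} (\<lambda>s. nullD \<sigma> s z) - integral {t..t+R} (\<lambda>s. potD s z))"
    by (subst Henstock_Kurzweil_Integration.integral_diff[symmetric])
      (auto intro!: integrable_continuous_real jcontD[OF jcont_nullD] jcontD[OF jcont_potD] continuous_intros)
  finally show ?thesis by (simp add: window_eq)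
qed

abbreviation "cum_bound \<equiv> 2 * pi * R\<^sup>2 * E"

lemma window_cumD_bounds:
  assumes s: "\<sigma>\<^sup>2 = 1" shows "0 \<le> window R (cumD \<sigma>) t z" "window R (cumD \<sigma>) t z \<le> cum_bound"
proof -
  show "0 \<le> window R (cumD \<sigma>) t z"
    using window_mono[OF jcont_const[of 0] jcont_cumD, of t R \<sigma> z] cumD_bounds[OF s] by (simp add: window_const[OF R])
  have "window R (cumD \<sigma>) t z \<le> R * (2 * pi * R * E)"
    using window_mono[OF jcont_cumD jcont_const[of "2 * pi * R * E"], of t R \<sigma> z] cumD_bounds[OF s] by (simp add: window_const[OF R])
  then show "window R (cumD \<sigma>) t z \<le> cum_bound" by (simp add: power2_eq_square algebra_simps)
qed

lemma window_massD_integral: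
  assumes s: "\<sigma>\<^sup>2 = 1" and n: "0 \<le> n"
  shows "integral {-n..n} (\<lambda>z. window R (massD \<sigma>) t z) \<le> cum_bound"
proof -
  have "integral {-n..n} (\<lambda>z. window R (massD \<sigma>) t z) = window R (cumD \<sigma>) t n - window R (cumD \<sigma>) t (-n)"
    using n by (intro FTC_integral window_dz[OF jcont_cumD jcont_massD cumD_dz]) simp
  then show ?thesis using window_cumD_bounds[OF s, of t n] window_cumD_bounds[OF s, of t "-n"] by linarith
qed

lemma window_nonneg:
  assumes "jcont f" "\<And>s z. 0 \<le> f s z" shows "0 \<le> window R f t z"
  using window_mono[OF jcont_const[of 0] assms(1), of t R z] assms(2) by (simp add: window_const[OF R])

lemma window_massD: "window R (massD \<sigma>) t z = window R (nullD \<sigma>) t z + window R potD t z"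
  unfolding massD_def[abs_def] by (rule window_add[OF jcont_nullD jcont_potD])

definition side_flux :: "real \<Rightarrow> real \<Rightarrow> real \<Rightarrow> real" where
  "side_flux s t n = integral {s..t} (\<lambda>r. window R (cumD 1) r n * flux (-1) r n - window R (cumD 1) r (-n) * flux (-1) r (-n))"

lemma jcont_flux: "jcont (flux \<sigma>)"
  unfolding flux_def[abs_def] by (intro jcont_diff jcont_shift jcont_cumD)

text \<open>Let \<open>P\<close> and \<open>Q\<close> be the windowed \<open>cumD 1\<close> and
  \<open>cumD (-1)\<close>, and \<open>A\<close>, \<open>B\<close>, \<open>N\<close> the windowed
  \<open>nullD 1\<close>, \<open>nullD (-1)\<close>, \<open>potD\<close>. The partial derivatives of
  \<open>P\<close> are \<open>A - N\<close> and \<open>A + N\<close>, those of \<open>Q\<close> are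
  \<open>N - B\<close> and \<open>B + N\<close>, so \<open>dP \<and> dQ\<close> has density \<open>2
  (A B - N\<^sup>2)\<close>. As \<open>P\<close> and \<open>Q\<close> take values in a fixed bounded
  interval and are monotone in \<open>z\<close>, the boundary terms at the initial and final time are
  bounded independently of the length of the time interval.\<close>

lemma interaction_identity:
  assumes st: "s \<le> t" and n: "0 \<le> n"
  shows "integral {s..t} (\<lambda>r. integral {-n..n} (\<lambda>z. 2 * (window R (nullD 1) r z * window R (nullD (-1)) r z - (window R potD r z)\<^sup>2)))
     \<le> cum_bound\<^sup>2 + \<bar>side_flux s t n\<bar>"
proof -
  define P where "P = window R (cumD 1)"
  define Qz where "Qz = window R (massD (-1))"
  have Pj: "jcont P" unfolding P_def by (rule jcont_window[OF jcont_cumD])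
  have Qj: "jcont Qz" unfolding Qz_def by (rule jcont_window[OF jcont_massD])
  have "integral {s..t} (\<lambda>r. integral {-n..n} (\<lambda>z. flux 1 r z * Qz r z - window R (massD 1) r z * flux (-1) r z))
     = integral {-n..n} (\<lambda>z. P t z * Qz t z) - integral {-n..n} (\<lambda>z. P s z * Qz s z) - integral {s..t} (\<lambda>r. P r n * flux (-1) r n - P r (-n) * flux (-1) r (-n))"
  proof (rule green_dP_dQ[where D="\<lambda>t z. massD (-1) (t + R) z - massD (-1) t z"])
    show "jcont (\<lambda>t z. massD (-1) (t + R) z - massD (-1) t z)" by (intro jcont_diff jcont_shift jcont_massD)
    show "((\<lambda>t. P t z) has_real_derivative flux 1 t z) (at t)" for t z
      unfolding P_def flux_def by (rule window_dt[OF jcont_cumD R])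
    show "((\<lambda>z. P t z) has_real_derivative window R (massD 1) t z) (at z)" for t z
      unfolding P_def by (rule window_dz[OF jcont_cumD jcont_massD cumD_dz])
    show "((\<lambda>t. Qz t z) has_real_derivative massD (-1) (t + R) z - massD (-1) t z) (at t)" for t z
      unfolding Qz_def by (rule window_dt[OF jcont_massD R])
    show "((\<lambda>z. flux (-1) t z) has_real_derivative massD (-1) (t + R) z - massD (-1) t z) (at z)" for t z
      unfolding flux_def by (intro DERIV_diff cumD_dz)
  qed (use st n in \<open>simp_all add: Pj Qj jcont_flux jcont_window jcont_massD\<close>)
  also have "(\<lambda>r. integral {-n..n} (\<lambda>z. flux 1 r z * Qz r z - window R (massD 1) r z * flux (-1) r z))
    = (\<lambda>r. integral {-n..n} (\<lambda>z. 2 * (window R (nullD 1) r z * window R (nullD (-1)) r z - (window R potD r z)\<^sup>2)))"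
    by (intro ext arg_cong[where f="integral _"])
      (simp add: flux_eq Qz_def window_massD power2_eq_square algebra_simps)
  also have "integral {s..t} (\<lambda>r. P r n * flux (-1) r n - P r (-n) * flux (-1) r (-n)) = side_flux s t n"
    by (simp add: side_flux_def P_def)
  finally have eq: "integral {s..t} (\<lambda>r. integral {-n..n} (\<lambda>z. 2 * (window R (nullD 1) r z * window R (nullD (-1)) r z - (window R potD r z)\<^sup>2)))
     = integral {-n..n} (\<lambda>z. P t z * Qz t z) - integral {-n..n} (\<lambda>z. P s z * Qz s z) - side_flux s t n" .
  have Qn: "0 \<le> Qz r z" for r z unfolding Qz_def by (rule window_nonneg[OF jcont_massD massD_nonneg])
  have Pb: "0 \<le> P r z" "P r z \<le> cum_bound" for r z unfolding P_def by (rule window_cumD_bounds; simp)+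
  have m0: "0 \<le> cum_bound" using Pb[of 0 0] by linarith
  have i: "(\<lambda>z. P r z * Qz r z) integrable_on {-n..n}" "(\<lambda>z. cum_bound * Qz r z) integrable_on {-n..n}" for r
    by (intro integrable_continuous_real continuous_intros jcontD[OF Pj] jcontD[OF Qj])+
  have "integral {-n..n} (\<lambda>z. P t z * Qz t z) \<le> integral {-n..n} (\<lambda>z. cum_bound * Qz t z)"
    by (intro integral_le i mult_right_mono Pb Qn)
  also have "\<dots> = cum_bound * integral {-n..n} (\<lambda>z. Qz t z)" by simp
  also have "\<dots> \<le> cum_bound * cum_bound" unfolding Qz_def by (intro mult_left_mono window_massD_integral n m0) simp
  finally have 1: "integral {-n..n} (\<lambda>z. P t z * Qz t z) \<le> cum_bound\<^sup>2" by (simp add: power2_eq_square)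
  have 2: "0 \<le> integral {-n..n} (\<lambda>z. P s z * Qz s z)"
    by (intro integral_nonneg i mult_nonneg_nonneg Pb Qn)
  show ?thesis unfolding eq using 1 2 by linarith
qed

lemma step_tendsto: "(\<lambda>n. step R (real n) x) \<longlonglongrightarrow> pi * R" "(\<lambda>n. step R (- real n) x) \<longlonglongrightarrow> 0"
proof -
  have 1: "filterlim (\<lambda>n. (real n - x) / R) at_top sequentially" using R by real_asymp
  have 2: "filterlim (\<lambda>n. (- real n - x) / R) at_bot sequentially" using R by real_asymp
  have "(\<lambda>n. R * (pi / 2 + arctan ((real n - x) / R))) \<longlonglongrightarrow> R * (pi / 2 + pi / 2)"
    by (intro tendsto_intros filterlim_compose[OF tendsto_arctan_at_top 1])
  then show "(\<lambda>n. step R (real n) x) \<longlonglongrightarrow> pi * R" by (simp add: step_def mult.commute)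
  have "(\<lambda>n. R * (pi / 2 + arctan ((- real n - x) / R))) \<longlonglongrightarrow> R * (pi / 2 + - (pi / 2))"
    by (intro tendsto_intros filterlim_compose[OF tendsto_arctan_at_bot 2])
  then show "(\<lambda>n. step R (- real n) x) \<longlonglongrightarrow> 0" by (simp add: step_def)
qed

lemma cumD_tendsto:
  "(\<lambda>n. cumD \<sigma> s (real n)) \<longlonglongrightarrow> pi * R * (LBINT x. (W \<sigma> s x)\<^sup>2 / 2 + V s x)" (is ?A)
  "(\<lambda>n. cumD \<sigma> s (- real n)) \<longlonglongrightarrow> 0" (is ?B)
proof -
  have [measurable]: "(\<lambda>x. (W \<sigma> s x)\<^sup>2 / 2 + V s x) \<in> borel_measurable borel" using WV_integrable by auto
  have [measurable]: "step R z \<in> borel_measurable borel" for z by (rule weight_meas(1)[OF weight_step[OF R]])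
  have *: "(\<lambda>n. LBINT x. step R (X n) x * ((W \<sigma> s x)\<^sup>2 / 2 + V s x)) \<longlonglongrightarrow> (LBINT x. c * ((W \<sigma> s x)\<^sup>2 / 2 + V s x))"
    if X: "\<And>x. (\<lambda>n. step R (X n) x) \<longlonglongrightarrow> c" for X :: "nat \<Rightarrow> real" and c
  proof (rule integral_dominated_convergence[where w="\<lambda>x. pi * R * ((W \<sigma> s x)\<^sup>2 / 2 + V s x)"])
    show "integrable lborel (\<lambda>x. pi * R * ((W \<sigma> s x)\<^sup>2 / 2 + V s x))" by (intro integrable_mult_right WV_integrable)
    show "AE x in lborel. (\<lambda>n. step R (X n) x * ((W \<sigma> s x)\<^sup>2 / 2 + V s x)) \<longlonglongrightarrow> c * ((W \<sigma> s x)\<^sup>2 / 2 + V s x)"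
      by (intro AE_I2 tendsto_mult_right X)
    have "norm (step R (X n) x * ((W \<sigma> s x)\<^sup>2 / 2 + V s x)) \<le> pi * R * ((W \<sigma> s x)\<^sup>2 / 2 + V s x)" for n x
      using mult_right_mono[OF step_bounds(2)[OF R, of "X n" x], of "(W \<sigma> s x)\<^sup>2 / 2 + V s x"] step_bounds(1)[OF R, of "X n" x] V_nonneg[of s x]
      by (simp add: abs_mult)
    then show "AE x in lborel. norm (step R (X n) x * ((W \<sigma> s x)\<^sup>2 / 2 + V s x)) \<le> pi * R * ((W \<sigma> s x)\<^sup>2 / 2 + V s x)" for n by simp
  qed measurable
  show ?A using *[OF step_tendsto(1)] by (simp only: cumD_def integral_mult_right_zero)
  show ?B using *[OF step_tendsto(2)] by (simp add: cumD_def)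
qed

text \<open>Far to the right \<open>cumD\<close> tends to a multiple of the total null energy, which
  does not depend on time, and far to the left to \<open>0\<close>. Hence its increments in time
  vanish in the limit.\<close>

lemma side_flux_tendsto: "(\<lambda>n. side_flux s t (real n)) \<longlonglongrightarrow> 0"
proof -
  have fl: "(\<lambda>n. flux (-1) r (real n)) \<longlonglongrightarrow> 0" "(\<lambda>n. flux (-1) r (- real n)) \<longlonglongrightarrow> 0" for r
  proof -
    have "(\<lambda>n. flux (-1) r (real n)) \<longlonglongrightarrow> pi * R * (LBINT x. (W (-1) (r + R) x)\<^sup>2 / 2 + V (r + R) x) - pi * R * (LBINT x. (W (-1) r x)\<^sup>2 / 2 + V r x)"
      unfolding flux_def by (intro tendsto_diff cumD_tendsto)
    moreover have "(LBINT x. (W (-1) (r + R) x)\<^sup>2 / 2 + V (r + R) x) = (LBINT x. (W (-1) r x)\<^sup>2 / 2 + V r x)"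
      by (rule null_energy_const) simp
    ultimately show "(\<lambda>n. flux (-1) r (real n)) \<longlonglongrightarrow> 0" by simp
    have "(\<lambda>n. flux (-1) r (- real n)) \<longlonglongrightarrow> 0 - 0"
      unfolding flux_def by (intro tendsto_diff cumD_tendsto)
    then show "(\<lambda>n. flux (-1) r (- real n)) \<longlonglongrightarrow> 0" by simp
  qed
  have Pb: "\<bar>window R (cumD 1) r z\<bar> \<le> cum_bound" for r z using window_cumD_bounds[of 1 r z] by simp
  have Fb: "\<bar>flux (-1) r z\<bar> \<le> 2 * pi * R * E" for r z
    unfolding flux_def using cumD_bounds[of "-1" r z] cumD_bounds[of "-1" "r + R" z] by simp
  have m0: "0 \<le> cum_bound" using Pb[of 0 0] by linarith
  have prod0: "(\<lambda>n. window R (cumD 1) r (X n) * flux (-1) r (X n)) \<longlonglongrightarrow> 0" if "(\<lambda>n. flux (-1) r (X n)) \<longlonglongrightarrow> 0" for r and X :: "nat \<Rightarrow> real"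
  proof (rule Lim_null_comparison)
    show "\<forall>\<^sub>F n in sequentially. norm (window R (cumD 1) r (X n) * flux (-1) r (X n)) \<le> cum_bound * \<bar>flux (-1) r (X n)\<bar>"
      using Pb by (auto simp: abs_mult intro!: always_eventually mult_right_mono)
    show "(\<lambda>n. cum_bound * \<bar>flux (-1) r (X n)\<bar>) \<longlonglongrightarrow> 0" using tendsto_mult_right_zero[OF tendsto_rabs_zero[OF that]] .
  qed
  have "(\<lambda>n. integral {s..t} (\<lambda>r. window R (cumD 1) r (real n) * flux (-1) r (real n) - window R (cumD 1) r (- real n) * flux (-1) r (- real n)))
     \<longlonglongrightarrow> integral {s..t} (\<lambda>r. 0)"
  proof (rule dominated_convergence(2)[where h="\<lambda>_. 2 * (cum_bound * (2 * pi * R * E))"])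
    show "(\<lambda>r. window R (cumD 1) r (real n) * flux (-1) r (real n) - window R (cumD 1) r (- real n) * flux (-1) r (- real n)) integrable_on {s..t}" for n
      by (intro integrable_continuous_real continuous_intros jcontD[OF jcont_window[OF jcont_cumD]] jcontD[OF jcont_flux])
    show "(\<lambda>_. 2 * (cum_bound * (2 * pi * R * E))) integrable_on {s..t}" by (intro integrable_continuous_real continuous_intros)
    fix r assume "r \<in> {s..t}"
    show "(\<lambda>n. window R (cumD 1) r (real n) * flux (-1) r (real n) - window R (cumD 1) r (- real n) * flux (-1) r (- real n)) \<longlonglongrightarrow> 0"
      using tendsto_diff[OF prod0[OF fl(1)] prod0[OF fl(2)]] by simp
    fix n
    have "\<bar>window R (cumD 1) r z * flux (-1) r z\<bar> \<le> cum_bound * (2 * pi * R * E)" for z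
      unfolding abs_mult by (intro mult_mono Pb Fb m0) auto
    from this[of "real n"] this[of "- real n"]
    show "norm (window R (cumD 1) r (real n) * flux (-1) r (real n) - window R (cumD 1) r (- real n) * flux (-1) r (- real n)) \<le> 2 * (cum_bound * (2 * pi * R * E))"
      unfolding real_norm_def by linarith
  qed
  then show ?thesis by (simp add: side_flux_def)
qed

subsection \<open>Combination with the virial identity\<close>

lemma window_Cauchy_Schwarz:
  "(window R prodD t z / 2)\<^sup>2 \<le> window R (nullD 1) t z * window R (nullD (-1)) t z"
proof (rule psd_discriminant)
  fix x y :: real
  have pt: "0 \<le> x\<^sup>2 * nullD 1 s z + (x * y) * prodD s z + y\<^sup>2 * nullD (-1) s z" for s
  proof -
    have "0 \<le> (LBINT \<xi>. kern R z \<xi> * ((x * W 1 s \<xi> + y * W (-1) s \<xi>)\<^sup>2 / 2))"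
      using kern_pos[of R z] by (intro integral_nonneg_AE AE_I2 mult_nonneg_nonneg) (auto simp: less_imp_le)
    also have "\<dots> = (LBINT \<xi>. x\<^sup>2 * (kern R z \<xi> * ((W 1 s \<xi>)\<^sup>2 / 2)) + (x * y) * (kern R z \<xi> * (W (-1) s \<xi> * W 1 s \<xi>)) + y\<^sup>2 * (kern R z \<xi> * ((W (-1) s \<xi>)\<^sup>2 / 2)))"
      by (intro Bochner_Integration.integral_cong) (auto simp: power2_eq_square field_simps)
    also have "\<dots> = x\<^sup>2 * nullD 1 s z + (x * y) * prodD s z + y\<^sup>2 * nullD (-1) s z"
      unfolding nullD_def prodD_def
      by (simp only: Bochner_Integration.integral_add Bochner_Integration.integrable_add integrable_mult_right integral_mult_right_zero kern_integrable W2_integrable in_L2_mult W_L2)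
    finally show ?thesis .
  qed
  have j: "jcont (\<lambda>s z. x\<^sup>2 * nullD 1 s z + (x * y) * prodD s z)" by (intro jcont_add jcont_cmult jcont_nullD jcont_prodD)
  have "0 \<le> window R (\<lambda>s z. (x\<^sup>2 * nullD 1 s z + (x * y) * prodD s z) + y\<^sup>2 * nullD (-1) s z) t z"
    using window_mono[OF jcont_const[of 0] jcont_add[OF j jcont_cmult[OF jcont_nullD, of "y\<^sup>2" "-1"]], of t R z] pt
    by (simp add: window_const[OF R])
  also have "\<dots> = x\<^sup>2 * window R (nullD 1) t z + (x * y) * window R prodD t z + y\<^sup>2 * window R (nullD (-1)) t z"
    by (simp add: window_add j jcont_cmult jcont_nullD jcont_prodD window_cmult)
  finally show "0 \<le> window R (nullD 1) t z * x\<^sup>2 + 2 * (window R prodD t z / 2) * x * y + window R (nullD (-1)) t z * y\<^sup>2"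
    by (simp add: algebra_simps)
qed

definition sup_bound :: real where "sup_bound = 2 + 8 * E\<^sup>2 * (p + 1)"
definition virial_err :: real where "virial_err = sup_bound / 2 * (pi + 4 * E) * sqrt R"

lemma U_sup_bound: "\<bar>U t x\<bar> \<le> sup_bound" unfolding sup_bound_def by (rule U_bound)
lemma sup_bound_nonneg: "0 \<le> sup_bound" using U_sup_bound[of 0 0] by linarith
lemma virial_err_nonneg: "0 \<le> virial_err" unfolding virial_err_def using sup_bound_nonneg E_pos R by (intro mult_nonneg_nonneg) auto

text \<open>The weight \<open>1 / sqrt R\<close> in the arithmetic-geometric inequality balances the
  length \<open>R\<close> of the window against the bounded total energy. The resulting bound grows
  like \<open>sqrt R\<close>, which is smaller than the size \<open>R\<close> that a persistent
  concentration would give to the averages.\<close>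

lemma kern_UW_le: "(LBINT x. kern R z x * \<bar>U t x * W 1 t x\<bar>) \<le> virial_err"
proof -
  note M = sup_bound_nonneg
  define k where "k = sqrt R"
  have k: "k > 0" "k * k = R" using R by (auto simp: k_def)
  have iK: "integrable lborel (\<lambda>x. kern R z x)" by (rule kern_integral(1)[OF R])
  have iW: "integrable lborel (\<lambda>x. kern R z x * (W 1 t x)\<^sup>2)" by (intro kern_integrable W_square_integrable)
  have "(LBINT x. kern R z x * \<bar>U t x * W 1 t x\<bar>) \<le> (LBINT x. (sup_bound / 2 / k) * kern R z x + (sup_bound / 2 * k) * (kern R z x * (W 1 t x)\<^sup>2))"
  proof (rule integral_mono)
    show "integrable lborel (\<lambda>x. kern R z x * \<bar>U t x * W 1 t x\<bar>)" by (intro kern_integrable integrable_abs in_L2_mult U_L2 W_L2)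
    show "integrable lborel (\<lambda>x. (sup_bound / 2 / k) * kern R z x + (sup_bound / 2 * k) * (kern R z x * (W 1 t x)\<^sup>2))"
      by (rule Bochner_Integration.integrable_add[OF integrable_mult_right[OF iK] integrable_mult_right[OF iW]])
    fix x
    have "2 * \<bar>W 1 t x\<bar> \<le> 1 / k + k * (W 1 t x)\<^sup>2"
    proof -
      have "0 \<le> (1 - k * \<bar>W 1 t x\<bar>)\<^sup>2 / k" using k by simp
      also have "\<dots> = 1 / k + k * (W 1 t x)\<^sup>2 - 2 * \<bar>W 1 t x\<bar>" using k by (simp add: power2_eq_square field_simps)
      finally show ?thesis by simp
    qed
    then have "sup_bound / 2 * (2 * \<bar>W 1 t x\<bar>) \<le> sup_bound / 2 * (1 / k + k * (W 1 t x)\<^sup>2)" using M by (intro mult_left_mono) auto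
    moreover have "\<bar>U t x\<bar> * \<bar>W 1 t x\<bar> \<le> sup_bound * \<bar>W 1 t x\<bar>" by (intro mult_right_mono U_sup_bound) auto
    ultimately have "\<bar>U t x * W 1 t x\<bar> \<le> sup_bound / 2 * (1 / k + k * (W 1 t x)\<^sup>2)" by (simp add: abs_mult)
    then have "kern R z x * \<bar>U t x * W 1 t x\<bar> \<le> kern R z x * (sup_bound / 2 * (1 / k + k * (W 1 t x)\<^sup>2))"
      using kern_pos[of R z x] by (intro mult_left_mono) auto
    then show "kern R z x * \<bar>U t x * W 1 t x\<bar> \<le> (sup_bound / 2 / k) * kern R z x + (sup_bound / 2 * k) * (kern R z x * (W 1 t x)\<^sup>2)"
      by (simp add: algebra_simps)
  qed
  also have "\<dots> = (sup_bound / 2 / k) * (pi * R) + (sup_bound / 2 * k) * (LBINT x. kern R z x * (W 1 t x)\<^sup>2)"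
    by (subst Bochner_Integration.integral_add) (simp_all only: iK iW integrable_mult_right integral_mult_right_zero kern_integral(2)[OF R])
  also have "\<dots> \<le> (sup_bound / 2 / k) * (pi * R) + (sup_bound / 2 * k) * (4 * E)"
  proof -
    have "(LBINT x. kern R z x * (W 1 t x)\<^sup>2) \<le> (LBINT x. (W 1 t x)\<^sup>2)"
    proof (intro integral_mono iW W_square_integrable)
      fix x show "kern R z x * (W 1 t x)\<^sup>2 \<le> (W 1 t x)\<^sup>2" using mult_right_mono[OF kern_le[of R z x], of "(W 1 t x)\<^sup>2"] by simp
    qed
    also have "\<dots> \<le> 4 * E" by (rule W_square_le) simp
    finally show ?thesis using M k by (intro add_left_mono mult_left_mono) auto
  qed
  also have "\<dots> = sup_bound / 2 * (pi + 4 * E) * k" 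
  proof -
    have "(sup_bound / 2 / k) * (pi * R) = sup_bound / 2 * pi * k" unfolding k(2)[symmetric] using k(1) by simp
    then show ?thesis by (simp add: algebra_simps)
  qed
  finally show ?thesis by (simp add: k_def virial_err_def)
qed

text \<open>By the virial identity the difference is made of two boundary values and one flux through
  the window, and the flux is integrated over a time of length \<open>R\<close>.\<close>

lemma virial_window: "\<bar>window R prodD t z - (p + 1) * window R potD t z\<bar> \<le> 3 * virial_err"
proof -
  define h where "h = (\<lambda>s. LBINT x. kern R z x * (U s x * W 1 s x))"
  define k where "k = (\<lambda>s. LBINT x. kern' R z x * (U s x * W 1 s x))"
  have dh: "(h has_real_derivative - k s + prodD s z - (p + 1) * potD s z) (at s)" for s
    using virial_identity[of 1, OF _ weight_kern[OF R], of z s] by (simp add: h_def k_def prodD_def potD_def)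
  have hi: "((\<lambda>s. - k s + prodD s z - (p + 1) * potD s z) has_integral h (t + R) - h t) {t..t+R}"
    using R by (intro FTC_has_integral dh) simp
  have gi: "((\<lambda>s. prodD s z - (p + 1) * potD s z) has_integral (window R prodD t z - (p + 1) * window R potD t z)) {t..t+R}"
    unfolding window_eq
    by (intro has_integral_diff has_integral_mult_right integrable_integral integrable_continuous_real jcontD[OF jcont_prodD] jcontD[OF jcont_potD] continuous_intros)
  have "(k has_integral (window R prodD t z - (p + 1) * window R potD t z) - (h (t + R) - h t)) {t..t+R}"
    using has_integral_diff[OF gi hi] by simp
  moreover
  have iUW: "integrable lborel (\<lambda>x. U s x * W 1 s x)" for s by (intro in_L2_mult U_L2 W_L2)
  have hb: "\<bar>h s\<bar> \<le> virial_err" for s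
  proof -
    have "\<bar>h s\<bar> \<le> (LBINT x. \<bar>kern R z x * (U s x * W 1 s x)\<bar>)" unfolding h_def by (rule integral_abs_bound)
    also have "\<dots> = (LBINT x. kern R z x * \<bar>U s x * W 1 s x\<bar>)"
      using kern_pos[of R z] by (simp add: abs_mult less_imp_le)
    also have "\<dots> \<le> virial_err" by (rule kern_UW_le)
    finally show ?thesis .
  qed
  have kb: "\<bar>k s\<bar> \<le> virial_err / R" for s
  proof -
    have "\<bar>k s\<bar> \<le> (LBINT x. \<bar>kern' R z x * (U s x * W 1 s x)\<bar>)" unfolding k_def by (rule integral_abs_bound)
    also have "\<dots> \<le> (LBINT x. (kern R z x * \<bar>U s x * W 1 s x\<bar>) / R)"
    proof (intro integral_mono integrable_abs kern'_integrable integrable_divide kern_integrable iUW)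
      fix x show "\<bar>kern' R z x * (U s x * W 1 s x)\<bar> \<le> (kern R z x * \<bar>U s x * W 1 s x\<bar>) / R"
        using mult_right_mono[OF kern'_le[OF R, of z x], of "\<bar>U s x * W 1 s x\<bar>"] by (simp add: abs_mult)
    qed
    also have "\<dots> = (LBINT x. kern R z x * \<bar>U s x * W 1 s x\<bar>) / R" by simp
    also have "\<dots> \<le> virial_err / R" using R by (intro divide_right_mono kern_UW_le) auto
    finally show ?thesis .
  qed
  ultimately have "norm ((window R prodD t z - (p + 1) * window R potD t z) - (h (t + R) - h t)) \<le> virial_err / R * measure lborel {t..t+R}"
    by (intro has_integral_bound_real[where S="{}" and f=k]) (use R virial_err_nonneg in auto)
  then show ?thesis using hb[of t] hb[of "t + R"] R by simp
qed

text \<open>Cauchy-Schwarz bounds the product of the null energies from below by the square of half the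
  averaged product of null derivatives, which by the virial identity is \<open>(p + 1) / 2\<close>
  times the potential energy up to a small error. The coefficient on the left is positive exactly
  because \<open>p > 1\<close>.\<close>

lemma potD_window_coercive:
  "((p + 1)\<^sup>2 - 4) / 2 * (window R potD t z)\<^sup>2
    \<le> 2 * (window R (nullD 1) t z * window R (nullD (-1)) t z - (window R potD t z)\<^sup>2) + 3 * (p + 1) * virial_err * window R potD t z"
proof -
  define N G where "N = window R potD t z" and "G = window R prodD t z"
  have N: "0 \<le> N" unfolding N_def by (rule window_nonneg[OF jcont_potD potD_nonneg])
  define r where "r = G - (p + 1) * N"
  have r: "\<bar>r\<bar> \<le> 3 * virial_err" using virial_window[of t z] by (simp add: r_def N_def G_def)
  have "G\<^sup>2 / 4 \<le> window R (nullD 1) t z * window R (nullD (-1)) t z"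
    using window_Cauchy_Schwarz[of t z] by (simp add: G_def power_divide)
  moreover have "G\<^sup>2 = (p + 1)\<^sup>2 * N\<^sup>2 + 2 * ((p + 1) * N * r) + r\<^sup>2" by (simp add: r_def power2_eq_square algebra_simps)
  moreover have "- ((p + 1) * N * r) \<le> (p + 1) * N * (3 * virial_err)"
    using mult_left_mono[of "- r" "3 * virial_err" "(p + 1) * N"] N p r by simp
  moreover have "0 \<le> r\<^sup>2" by simp
  ultimately have "(p + 1)\<^sup>2 * N\<^sup>2 - 2 * ((p + 1) * N * (3 * virial_err)) \<le> 4 * (window R (nullD 1) t z * window R (nullD (-1)) t z)"
    by linarith
  then show ?thesis unfolding N_def[symmetric] by (simp add: field_simps)
qed

lemma potD_window_square:
  assumes st: "s \<le> t" and n: "0 \<le> n"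
  shows "((p + 1)\<^sup>2 - 4) / 2 * integral {s..t} (\<lambda>r. integral {-n..n} (\<lambda>z. (window R potD r z)\<^sup>2))
     \<le> cum_bound\<^sup>2 + \<bar>side_flux s t n\<bar> + 3 * (p + 1) * virial_err * cum_bound * (t - s)"
proof -
  define q where "q = ((p + 1)\<^sup>2 - 4) / 2"
  define c where "c = 3 * (p + 1) * virial_err"
  have c0: "0 \<le> c" unfolding c_def using p virial_err_nonneg by simp
  note jw = jcont_window[OF jcont_potD] jcont_window[OF jcont_nullD]
  define I where "I = (\<lambda>r z. 2 * (window R (nullD 1) r z * window R (nullD (-1)) r z - (window R potD r z)\<^sup>2))"
  have jI: "jcont I" unfolding I_def power2_eq_square by (intro jcont_cmult jcont_diff jcont_mult jw)
  have jN2: "jcont (\<lambda>r z. (window R potD r z)\<^sup>2)" unfolding power2_eq_square by (intro jcont_mult jw)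
  have ii: "(\<lambda>z. f r z) integrable_on {-n..n}" if "jcont f" for f r by (intro integrable_continuous_real jcontD[OF that] continuous_intros)
  have ci: "continuous_on {s..t} (\<lambda>r. integral {-n..n} (\<lambda>z. f r z))" if "jcont f" for f
    by (rule integral_continuous_on_param[where a="-n" and b=n, unfolded cbox_interval])
      (unfold case_prod_beta', intro jcontD[OF that] continuous_intros)
  have N_le: "integral {-n..n} (\<lambda>z. window R potD r z) \<le> cum_bound" for r
  proof -
    have "integral {-n..n} (\<lambda>z. window R potD r z) \<le> integral {-n..n} (\<lambda>z. window R (massD 1) r z)"
    proof (intro integral_le ii jw jcont_window jcont_massD)
      fix z show "window R potD r z \<le> window R (massD 1) r z"
        unfolding window_massD using window_nonneg[OF jcont_nullD nullD_nonneg, of 1 r z] by simp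
    qed
    also have "\<dots> \<le> cum_bound" by (rule window_massD_integral[OF _ n]) simp
    finally show ?thesis .
  qed
  have pt: "q * integral {-n..n} (\<lambda>z. (window R potD r z)\<^sup>2) \<le> integral {-n..n} (\<lambda>z. I r z) + c * cum_bound" for r
  proof -
    have "q * integral {-n..n} (\<lambda>z. (window R potD r z)\<^sup>2) = integral {-n..n} (\<lambda>z. q * (window R potD r z)\<^sup>2)" by simp
    also have "\<dots> \<le> integral {-n..n} (\<lambda>z. I r z + c * window R potD r z)"
    proof (intro integral_le ii[OF jcont_cmult[OF jN2]] ii[OF jcont_add[OF jI jcont_cmult[OF jw(1)]]])
      show "q * (window R potD r z)\<^sup>2 \<le> I r z + c * window R potD r z" for z
        unfolding q_def I_def c_def by (rule potD_window_coercive)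
    qed
    also have "\<dots> = integral {-n..n} (\<lambda>z. I r z) + integral {-n..n} (\<lambda>z. c * window R potD r z)"
      by (intro Henstock_Kurzweil_Integration.integral_add ii[OF jI] ii[OF jcont_cmult[OF jw(1)]])
    also have "integral {-n..n} (\<lambda>z. c * window R potD r z) = c * integral {-n..n} (\<lambda>z. window R potD r z)" by simp
    also have "\<dots> \<le> c * cum_bound" by (intro mult_left_mono N_le c0)
    finally show ?thesis by simp
  qed
  have "q * integral {s..t} (\<lambda>r. integral {-n..n} (\<lambda>z. (window R potD r z)\<^sup>2)) = integral {s..t} (\<lambda>r. q * integral {-n..n} (\<lambda>z. (window R potD r z)\<^sup>2))" by simp
  also have "\<dots> \<le> integral {s..t} (\<lambda>r. integral {-n..n} (\<lambda>z. I r z) + c * cum_bound)"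
    by (intro integral_le pt integrable_continuous_real continuous_intros ci jN2 jI)
  also have "\<dots> = integral {s..t} (\<lambda>r. integral {-n..n} (\<lambda>z. I r z)) + c * cum_bound * (t - s)"
    using st by (subst Henstock_Kurzweil_Integration.integral_add) (auto intro!: integrable_continuous_real ci jI)
  also have "\<dots> \<le> (cum_bound\<^sup>2 + \<bar>side_flux s t n\<bar>) + c * cum_bound * (t - s)"
    unfolding I_def by (intro add_right_mono interaction_identity st n)
  finally show ?thesis by (simp add: q_def c_def)
qed

subsection \<open>Finite speed of propagation and removal of the time average\<close>

lemma kern'_flux_le:
  "\<bar>LBINT x. kern' R z x * ((W \<sigma> s x)\<^sup>2 / 2 - V s x)\<bar> \<le> massD \<sigma> s z / R"
proof -
  have i: "integrable lborel (\<lambda>x. (W \<sigma> s x)\<^sup>2 / 2 - V s x)" by (intro Bochner_Integration.integrable_diff W2_integrable V_integrable)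
  have "\<bar>LBINT x. kern' R z x * ((W \<sigma> s x)\<^sup>2 / 2 - V s x)\<bar> \<le> (LBINT x. \<bar>kern' R z x * ((W \<sigma> s x)\<^sup>2 / 2 - V s x)\<bar>)"
    by (rule integral_abs_bound)
  also have "\<dots> \<le> (LBINT x. (kern R z x * ((W \<sigma> s x)\<^sup>2 / 2 + V s x)) / R)"
  proof (intro integral_mono integrable_abs kern'_integrable i integrable_divide kern_integrable WV_integrable)
    fix x
    have "\<bar>(W \<sigma> s x)\<^sup>2 / 2 - V s x\<bar> \<le> (W \<sigma> s x)\<^sup>2 / 2 + V s x" using V_nonneg[of s x] by (simp add: abs_le_iff)
    then have "\<bar>kern' R z x\<bar> * \<bar>(W \<sigma> s x)\<^sup>2 / 2 - V s x\<bar> \<le> (kern R z x / R) * ((W \<sigma> s x)\<^sup>2 / 2 + V s x)"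
      by (intro mult_mono kern'_le R) (use kern_pos[of R z x] R in auto)
    then show "\<bar>kern' R z x * ((W \<sigma> s x)\<^sup>2 / 2 - V s x)\<bar> \<le> (kern R z x * ((W \<sigma> s x)\<^sup>2 / 2 + V s x)) / R"
      by (simp add: abs_mult)
  qed
  also have "\<dots> = massD \<sigma> s z / R" unfolding massD_eq by (rule integral_divide_zero)
  finally show ?thesis .
qed

definition energyD :: "real \<Rightarrow> real \<Rightarrow> real" where "energyD s z = massD 1 s z + massD (-1) s z"

lemma jcont_energyD: "jcont energyD" unfolding energyD_def[abs_def] by (intro jcont_add jcont_massD)

lemma energyD_nonneg: "0 \<le> energyD s z" unfolding energyD_def using massD_nonneg by (simp add: add_nonneg_nonneg)

text \<open>A substitute for finite speed of propagation: the flux through the window is at most its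
  content divided by \<open>R\<close>, so over a time \<open>R\<close> the content grows at most by
  the factor \<open>exp 1\<close>.\<close>

lemma energyD_growth:
  assumes ts: "t \<le> s" "s \<le> t + R" shows "energyD s z \<le> 3 * energyD t z"
proof -
  define f where "f = (\<lambda>\<sigma> s. - \<sigma> * (LBINT x. kern' R z x * ((W \<sigma> s x)\<^sup>2 / 2 - V s x)))"
  have dm: "((\<lambda>s. massD \<sigma> s z) has_real_derivative f \<sigma> s) (at s)" if "\<sigma>\<^sup>2 = 1" for \<sigma> s
    unfolding massD_eq f_def by (rule null_energy_conservation[OF that weight_kern[OF R]])
  have de: "((\<lambda>s. energyD s z) has_real_derivative f 1 s + f (-1) s) (at s)" for s
    unfolding energyD_def by (intro DERIV_add dm) auto
  have fb: "f 1 s + f (-1) s \<le> energyD s z / R" for s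
    using kern'_flux_le[of z 1 s] kern'_flux_le[of z "-1" s] unfolding f_def energyD_def add_divide_distrib by simp
  define h where "h = (\<lambda>s. energyD s z * exp (- (s - t) / R))"
  have dh: "(h has_real_derivative ((f 1 s + f (-1) s) - energyD s z / R) * exp (- (s - t) / R)) (at s)" for s
    unfolding h_def using R by (auto intro!: derivative_eq_intros de simp: field_simps)
  have "h s \<le> h t"
  proof (rule DERIV_nonpos_imp_nonincreasing[OF ts(1)])
    fix x
    have "((f 1 x + f (-1) x) - energyD x z / R) * exp (- (x - t) / R) \<le> 0"
      using fb[of x] by (intro mult_nonpos_nonneg) auto
    with dh show "\<exists>y. (h has_real_derivative y) (at x) \<and> y \<le> 0" by blast
  qed
  then have "energyD s z * exp (- (s - t) / R) \<le> energyD t z" by (simp add: h_def)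
  then have "energyD s z * exp (- (s - t) / R) * exp ((s - t) / R) \<le> energyD t z * exp ((s - t) / R)" by (intro mult_right_mono) auto
  then have "energyD s z \<le> energyD t z * exp ((s - t) / R)"
    by (simp add: mult.assoc exp_add[symmetric] diff_divide_distrib)
  also have "\<dots> \<le> energyD t z * 3"
  proof (intro mult_left_mono energyD_nonneg)
    have "(s - t) / R \<le> 1" using ts R by simp
    then have "exp ((s - t) / R) \<le> exp 1" by simp
    also have "\<dots> \<le> 3" by (rule exp_le)
    finally show "exp ((s - t) / R) \<le> 3" .
  qed
  finally show ?thesis by simp
qed

lemma energyD_square_integral:
  assumes n: "0 \<le> n" shows "integral {-n..n} (\<lambda>z. (energyD t z)\<^sup>2) \<le> 16 * pi * R * E\<^sup>2"
proof -
  have jE2: "jcont (\<lambda>t z. (energyD t z)\<^sup>2)" unfolding power2_eq_square by (intro jcont_mult jcont_energyD)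
  have ii: "(\<lambda>z. f t z) integrable_on {-n..n}" if "jcont f" for f by (intro integrable_continuous_real jcontD[OF that] continuous_intros)
  have le: "energyD t z \<le> 4 * E" for z unfolding energyD_def using massD_le[of 1 t z] massD_le[of "-1" t z] by simp
  have "integral {-n..n} (\<lambda>z. (energyD t z)\<^sup>2) \<le> integral {-n..n} (\<lambda>z. 4 * E * energyD t z)"
    using le energyD_nonneg by (intro integral_le ii jE2 ii[OF jcont_cmult[OF jcont_energyD]]) (simp add: power2_eq_square mult_right_mono)
  also have "\<dots> = 4 * E * integral {-n..n} (\<lambda>z. energyD t z)" by simp
  also have "integral {-n..n} (\<lambda>z. energyD t z) = (cumD 1 t n + cumD (-1) t n) - (cumD 1 t (-n) + cumD (-1) t (-n))"
    unfolding energyD_def using n by (intro FTC_integral DERIV_add cumD_dz) simp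
  also have "4 * E * \<dots> \<le> 4 * E * (4 * pi * R * E)"
    using cumD_bounds[of 1 t n] cumD_bounds[of "-1" t n] cumD_bounds[of 1 t "-n"] cumD_bounds[of "-1" t "-n"] E_pos
    by (intro mult_left_mono) auto
  finally show ?thesis by (simp add: power2_eq_square algebra_simps)
qed

text \<open>The potential energy may oscillate in time, so the average of its square is not controlled
  by the square of its average. But it is bounded by the energy in the window, which changes by at
  most a constant factor; one factor \<open>potD\<close> is therefore replaced by the energy at time
  \<open>t\<close>, and the product is split with a parameter \<open>K\<close>.\<close>

lemma potD_square_window:
  assumes K: "K > 0"
  shows "window R (\<lambda>s z. (potD s z)\<^sup>2) t z \<le> 3 / 2 * (K * (window R potD t z)\<^sup>2 + (energyD t z)\<^sup>2 / K)"
proof -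
  have jP2: "jcont (\<lambda>t z. (potD t z)\<^sup>2)" unfolding power2_eq_square by (intro jcont_mult jcont_potD)
  define N where "N = window R potD t z"
  define e where "e = energyD t z"
  have "potD s z \<le> energyD s z" for s
    using nullD_nonneg[of 1 s z] massD_nonneg[of "-1" s z] by (simp add: energyD_def massD_def[of 1])
  then have "(potD s z)\<^sup>2 \<le> (3 * e) * potD s z" if "s \<in> {t..t+R}" for s
    unfolding power2_eq_square e_def using energyD_growth[of t s z] that potD_nonneg[of s z]
    by (intro mult_right_mono) (auto intro: order_trans)
  then have "window R (\<lambda>s z. (potD s z)\<^sup>2) t z \<le> window R (\<lambda>s z. (3 * e) * potD s z) t z"
    by (intro window_mono jP2 jcont_cmult jcont_potD) auto
  also have "\<dots> = 3 * (e * N)" by (simp only: window_cmult N_def mult.assoc)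
  also have "\<dots> \<le> 3 / 2 * (K * N\<^sup>2 + e\<^sup>2 / K)"
  proof -
    have "0 \<le> (K * N - e)\<^sup>2 / K" using K by simp
    also have "\<dots> = K * N\<^sup>2 + e\<^sup>2 / K - 2 * (e * N)" using K by (simp add: power2_eq_square field_simps)
    finally show ?thesis by simp
  qed
  finally show ?thesis by (simp add: N_def e_def)
qed

definition massL2 :: "real \<Rightarrow> real \<Rightarrow> real" where
  "massL2 n s = integral {-n..n} (\<lambda>z. (potD s z)\<^sup>2)"

lemma massL2_cont: "continuous_on A (massL2 n)"
  unfolding massL2_def
  by (rule integral_continuous_on_param[where a="-n" and b=n, unfolded cbox_interval])
    (unfold case_prod_beta' power2_eq_square, intro continuous_on_mult jcontD[OF jcont_potD] continuous_intros)

lemma massL2_nonneg: "0 \<le> massL2 n s"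
  unfolding massL2_def power2_eq_square
  by (intro integral_nonneg integrable_continuous_real continuous_on_mult jcontD[OF jcont_potD] continuous_intros) simp

lemma massL2_window:
  assumes n: "0 \<le> n" and K: "K > 0"
  shows "integral {0..R} (\<lambda>s. massL2 n (r + s)) \<le> 3 / 2 * (K * integral {-n..n} (\<lambda>z. (window R potD r z)\<^sup>2) + 16 * pi * R * E\<^sup>2 / K)"
proof -
  have jP2: "jcont (\<lambda>t z. (potD t z)\<^sup>2)" unfolding power2_eq_square by (intro jcont_mult jcont_potD)
  have jE2: "jcont (\<lambda>t z. (energyD t z)\<^sup>2)" unfolding power2_eq_square by (intro jcont_mult jcont_energyD)
  have jN2: "jcont (\<lambda>r z. (window R potD r z)\<^sup>2)" unfolding power2_eq_square by (intro jcont_mult jcont_window jcont_potD)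
  have ii: "(\<lambda>z. f r z) integrable_on {-n..n}" if "jcont f" for f by (intro integrable_continuous_real jcontD[OF that] continuous_intros)
  have "integral {0..R} (\<lambda>s. massL2 n (r + s)) = integral {-n..n} (\<lambda>z. window R (\<lambda>s z. (potD s z)\<^sup>2) r z)"
    unfolding massL2_def window_def
  proof (rule integral_swap_continuous[where a=0 and b=R and c="-n" and d=n and f="\<lambda>s z. (potD (r + s) z)\<^sup>2", unfolded cbox_interval])
    show "continuous_on {(0, - n)..(R, n)} (\<lambda>(s, z). (potD (r + s) z)\<^sup>2)"
      unfolding case_prod_beta' power2_eq_square by (intro continuous_on_mult jcontD[OF jcont_potD] continuous_intros)
  qed
  also have "\<dots> \<le> integral {-n..n} (\<lambda>z. 3 / 2 * (K * (window R potD r z)\<^sup>2 + (1 / K) * (energyD r z)\<^sup>2))"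
  proof (intro integral_le ii[OF jcont_window[OF jP2]] ii[OF jcont_cmult[OF jcont_add[OF jcont_cmult[OF jN2] jcont_cmult[OF jE2]]]])
    show "window R (\<lambda>s z. (potD s z)\<^sup>2) r z \<le> 3 / 2 * (K * (window R potD r z)\<^sup>2 + (1 / K) * (energyD r z)\<^sup>2)" for z
      using potD_square_window[OF K, of r z] by simp
  qed
  also have "\<dots> = 3 / 2 * (K * integral {-n..n} (\<lambda>z. (window R potD r z)\<^sup>2) + (1 / K) * integral {-n..n} (\<lambda>z. (energyD r z)\<^sup>2))"
    using Henstock_Kurzweil_Integration.integral_add[OF ii[OF jcont_cmult[OF jN2, of K]] ii[OF jcont_cmult[OF jE2, of "1/K"]]]
    by (simp only: Henstock_Kurzweil_Integration.integral_mult_right)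
  also have "\<dots> \<le> 3 / 2 * (K * integral {-n..n} (\<lambda>z. (window R potD r z)\<^sup>2) + (1 / K) * (16 * pi * R * E\<^sup>2))"
    using K by (intro mult_left_mono add_left_mono energyD_square_integral n) auto
  finally show ?thesis by simp
qed

text \<open>Every time in \<open>[s + R, t]\<close> lies in the windows that start during a time
  interval of length \<open>R\<close> inside \<open>[s, t]\<close>, which accounts for the factor
  \<open>R\<close> on the left.\<close>

lemma massL2_bound:
  assumes st: "s + R \<le> t" and n: "0 \<le> n" and K: "K > 0"
  shows "R * integral {s + R..t} (massL2 n)
    \<le> 3 / 2 * (K * (2 / ((p + 1)\<^sup>2 - 4)) * (cum_bound\<^sup>2 + \<bar>side_flux s t n\<bar> + 3 * (p + 1) * virial_err * cum_bound * (t - s))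
               + 16 * pi * R * E\<^sup>2 * (t - s) / K)"
proof -
  have st': "s \<le> t" using st R by simp
  define q where "q = ((p + 1)\<^sup>2 - 4) / 2"
  have q: "q > 0"
  proof -
    have "2\<^sup>2 < (p + 1)\<^sup>2" using p by (intro power_strict_mono) auto
    then show ?thesis by (simp add: q_def)
  qed
  define A where "A = (\<lambda>r. integral {-n..n} (\<lambda>z. (window R potD r z)\<^sup>2))"
  have Ac: "continuous_on {s..t} A"
    unfolding A_def by (rule integral_continuous_on_param[where a="-n" and b=n, unfolded cbox_interval])
      (unfold case_prod_beta' power2_eq_square, intro continuous_on_mult jcontD[OF jcont_window[OF jcont_potD]] continuous_intros)
  have mc: "continuous_on B (\<lambda>y. massL2 n (f y))" if "continuous_on B f" for B :: "'b::topological_space set" and f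
    by (rule continuous_on_compose2[OF massL2_cont[of UNIV n] that]) auto
  have sc: "integral {s..t} (\<lambda>r. integral {0..R} (\<lambda>x. massL2 n (r + x))) = integral {0..R} (\<lambda>x. integral {s..t} (\<lambda>r. massL2 n (r + x)))"
    by (rule integral_swap_continuous[where a=s and b=t and c=0 and d=R and f="\<lambda>r x. massL2 n (r + x)", unfolded cbox_interval])
      (unfold case_prod_beta', intro mc continuous_intros)
  have "R * integral {s + R..t} (massL2 n) = integral {0..R} (\<lambda>x. integral {s + R..t} (massL2 n))" using R by simp
  also have "\<dots> \<le> integral {0..R} (\<lambda>x. integral {s..t} (\<lambda>r. massL2 n (r + x)))"
  proof (rule integral_le)
    show "(\<lambda>x. integral {s + R..t} (massL2 n)) integrable_on {0..R}" by (intro integrable_continuous_real continuous_intros)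
    show "(\<lambda>x. integral {s..t} (\<lambda>r. massL2 n (r + x))) integrable_on {0..R}"
      by (intro integrable_continuous_real, rule integral_continuous_on_param[where a=s and b=t, unfolded cbox_interval])
        (unfold case_prod_beta', intro mc continuous_intros)
    fix x assume x: "x \<in> {0..R}"
    have "integral {s + R..t} (massL2 n) \<le> integral {s + x..t + x} (massL2 n)"
      by (rule integral_subset_le) (use x in \<open>auto intro!: integrable_continuous_real massL2_cont massL2_nonneg\<close>)
    also have "\<dots> = integral {s..t} (\<lambda>r. massL2 n (r + x))"
      using integral_shift_Icc_real[of s t "massL2 n" x] by (simp add: o_def add.commute)
    finally show "integral {s + R..t} (massL2 n) \<le> integral {s..t} (\<lambda>r. massL2 n (r + x))" .
  qed
  also have "\<dots> = integral {s..t} (\<lambda>r. integral {0..R} (\<lambda>x. massL2 n (r + x)))" by (rule sc[symmetric])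
  also have "\<dots> \<le> integral {s..t} (\<lambda>r. 3 / 2 * (K * A r + 16 * pi * R * E\<^sup>2 / K))"
  proof (rule integral_le)
    show "(\<lambda>r. integral {0..R} (\<lambda>x. massL2 n (r + x))) integrable_on {s..t}"
      by (intro integrable_continuous_real, rule integral_continuous_on_param[where a=0 and b=R, unfolded cbox_interval])
        (unfold case_prod_beta', intro mc continuous_intros)
    show "(\<lambda>r. 3 / 2 * (K * A r + 16 * pi * R * E\<^sup>2 / K)) integrable_on {s..t}"
      by (intro integrable_continuous_real continuous_intros Ac)
    show "integral {0..R} (\<lambda>x. massL2 n (r + x)) \<le> 3 / 2 * (K * A r + 16 * pi * R * E\<^sup>2 / K)" for r
      unfolding A_def by (rule massL2_window[OF n K])
  qed
  also have "\<dots> = 3 / 2 * (integral {s..t} (\<lambda>r. K * A r + 16 * pi * R * E\<^sup>2 / K))"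
    by (rule Henstock_Kurzweil_Integration.integral_mult_right)
  also have "integral {s..t} (\<lambda>r. K * A r + 16 * pi * R * E\<^sup>2 / K) = integral {s..t} (\<lambda>r. K * A r) + integral {s..t} (\<lambda>r. 16 * pi * R * E\<^sup>2 / K)"
    by (intro Henstock_Kurzweil_Integration.integral_add integrable_continuous_real continuous_intros Ac)
  also have "\<dots> = K * integral {s..t} A + 16 * pi * R * E\<^sup>2 * (t - s) / K" using st' by (simp add: field_simps)
  also have "3 / 2 * \<dots> \<le> 3 / 2 * (K * ((cum_bound\<^sup>2 + \<bar>side_flux s t n\<bar> + 3 * (p + 1) * virial_err * cum_bound * (t - s)) / q) + 16 * pi * R * E\<^sup>2 * (t - s) / K)"
  proof -
    have "q * integral {s..t} A \<le> cum_bound\<^sup>2 + \<bar>side_flux s t n\<bar> + 3 * (p + 1) * virial_err * cum_bound * (t - s)"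
      unfolding q_def A_def by (rule potD_window_square[OF st' n])
    then have "integral {s..t} A \<le> (cum_bound\<^sup>2 + \<bar>side_flux s t n\<bar> + 3 * (p + 1) * virial_err * cum_bound * (t - s)) / q"
      using q by (simp add: pos_le_divide_eq mult.commute)
    then show ?thesis using K by (intro mult_left_mono add_right_mono) auto
  qed
  also have "K * (X / q) = K * (2 / ((p + 1)\<^sup>2 - 4)) * X" for X unfolding q_def by simp
  finally show ?thesis .
qed

end

section \<open>Decay of the mean supremum\<close>

context windowed_flow
begin

text \<open>Potential energy that a value of modulus \<open>\<delta>\<close> forces into a window:
  \<open>U\<close> stays above \<open>\<delta> / 2\<close> on an interval of length
  \<open>\<delta>\<^sup>2 / (8 E)\<close>, and \<open>kern\<close> is at least \<open>1/5\<close> up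
  to distance \<open>2 R\<close> from its centre.\<close>

definition lower_mass :: "real \<Rightarrow> real" where
  "lower_mass \<delta> = 1 / 5 * pot p (\<delta> / 2) * (\<delta>\<^sup>2 / (8 * E))"

lemma lower_mass_pos: "\<delta> > 0 \<Longrightarrow> lower_mass \<delta> > 0"
  using p E_pos by (simp add: lower_mass_def pot_def)

lemma kern_ge:
  assumes "\<bar>y - z\<bar> \<le> 2 * R" shows "1 / 5 \<le> kern R z y"
proof -
  have "\<bar>(y - z) / R\<bar> \<le> 2" using assms R by (simp add: abs_divide divide_le_eq)
  then have "((y - z) / R)\<^sup>2 \<le> 2\<^sup>2" by (metis abs_ge_zero power2_abs power_mono)
  then have "1 + ((y - z) / R)\<^sup>2 \<le> 5" by simp
  then have "inverse 5 \<le> inverse (1 + ((y - z) / R)\<^sup>2)" using one_plus_sq_pos[of "(y - z) / R"] by (intro le_imp_inverse_le)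
  then show ?thesis by (simp add: kern_def)
qed

lemma potD_ge:
  assumes d: "\<delta> > 0" "\<delta>\<^sup>2 / (8 * E) \<le> R" and U: "\<delta> \<le> \<bar>U s x0\<bar>" and z: "\<bar>z - x0\<bar> \<le> R"
  shows "lower_mass \<delta> \<le> potD s z"
  unfolding lower_mass_def potD_def
proof (rule mass_near[OF weight_kern[OF R]])
  show "0 \<le> kern R z x" for x using kern_pos[of R z x] by simp
  show "1 / 5 \<le> kern R z y" if "x0 \<le> y" "y \<le> x0 + \<delta>\<^sup>2 / (8 * E)" for y
    by (rule kern_ge) (use that d z in linarith)
qed (use d U in auto)

lemma massL2_ge:
  assumes d: "\<delta> > 0" "\<delta>\<^sup>2 / (8 * E) \<le> R" and U: "\<delta> \<le> \<bar>U s x0\<bar>" and n: "\<bar>x0\<bar> + R \<le> n"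
  shows "2 * R * (lower_mass \<delta>)\<^sup>2 \<le> massL2 n s"
proof -
  have ii: "(\<lambda>z. (potD s z)\<^sup>2) integrable_on {a..b}" for a b
    unfolding power2_eq_square by (intro integrable_continuous_real continuous_on_mult jcontD[OF jcont_potD] continuous_intros)
  have "2 * R * (lower_mass \<delta>)\<^sup>2 = integral {x0 - R..x0 + R} (\<lambda>_. (lower_mass \<delta>)\<^sup>2)" using R by simp
  also have "\<dots> \<le> integral {x0 - R..x0 + R} (\<lambda>z. (potD s z)\<^sup>2)"
  proof (rule integral_le[OF _ ii])
    show "(lower_mass \<delta>)\<^sup>2 \<le> (potD s z)\<^sup>2" if "z \<in> {x0 - R..x0 + R}" for z
      using potD_ge[OF d U, of z] lower_mass_pos[OF d(1)] that by (intro power_mono) (auto simp: abs_le_iff)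
  qed (intro integrable_continuous_real continuous_intros)
  also have "\<dots> \<le> massL2 n s"
    unfolding massL2_def using n by (intro integral_subset_le ii) (auto simp: abs_le_iff)
  finally show ?thesis .
qed

lemma massL2_mono: "m \<le> n \<Longrightarrow> massL2 m s \<le> massL2 n s"
  unfolding massL2_def power2_eq_square
  by (intro integral_subset_le integrable_continuous_real continuous_on_mult jcontD[OF jcont_potD] continuous_intros) auto

lemma norm_Linf_le: 
  assumes "\<And>x. \<bar>U s x\<bar> \<le> C" shows "norm_Linf (U s) \<le> ennreal C"
  unfolding norm_Linf_def
  using in_L2_meas[OF U_L2, of s] assms by (intro esssup_I AE_I2 ennreal_leI) auto

text \<open>If \<open>|U s|\<close> reaches \<open>\<delta>\<close> somewhere, then all windows centred
  within distance \<open>R\<close> of that point carry a fixed amount of potential energy, so the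
  second term alone is at least the uniform bound on \<open>U\<close>. The supremum over
  \<open>n\<close> is there because the point may be arbitrarily far away.\<close>

lemma norm_Linf_massL2:
  assumes d: "\<delta> > 0" "\<delta>\<^sup>2 / (8 * E) \<le> R"
  shows "norm_Linf (U s) \<le> ennreal \<delta> + ennreal (sup_bound / (2 * R * (lower_mass \<delta>)\<^sup>2)) * (SUP n. ennreal (massL2 (real n) s))"
proof (cases "\<exists>x0. \<delta> \<le> \<bar>U s x0\<bar>")
  case False
  then have "norm_Linf (U s) \<le> ennreal \<delta>" by (intro norm_Linf_le) (meson linorder_le_cases)
  then show ?thesis by (rule order_trans) simp
next
  case True
  then obtain x0 where x0: "\<delta> \<le> \<bar>U s x0\<bar>" by blast
  obtain n :: nat where n: "\<bar>x0\<bar> + R \<le> real n" using real_arch_simple by blast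
  define c where "c = 2 * R * (lower_mass \<delta>)\<^sup>2"
  have c: "c > 0" using R lower_mass_pos[OF d(1)] by (simp add: c_def)
  have "norm_Linf (U s) \<le> ennreal sup_bound" by (rule norm_Linf_le[OF U_sup_bound])
  also have "sup_bound = sup_bound / c * c" using c by simp
  also have "ennreal (sup_bound / c * c) \<le> ennreal (sup_bound / c * massL2 (real n) s)"
    using massL2_ge[OF d x0 n] c sup_bound_nonneg by (intro ennreal_leI mult_left_mono) (auto simp: c_def)
  also have "\<dots> = ennreal (sup_bound / c) * ennreal (massL2 (real n) s)"
    using c sup_bound_nonneg massL2_nonneg by (intro ennreal_mult) auto
  also have "\<dots> \<le> ennreal (sup_bound / c) * (SUP n. ennreal (massL2 (real n) s))"
    by (intro mult_left_mono SUP_upper) auto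
  finally show ?thesis unfolding c_def by (rule order_trans) simp
qed

text \<open>The left side increases with \<open>n\<close>, so the lateral term may be sent to its limit
  \<open>0\<close> first.\<close>

lemma massL2_bound_limit:
  assumes st: "s + R \<le> t" and K: "K > 0"
  shows "R * integral {s + R..t} (massL2 (real n))
    \<le> 3 / 2 * (K * (2 / ((p + 1)\<^sup>2 - 4)) * (cum_bound\<^sup>2 + 3 * (p + 1) * virial_err * cum_bound * (t - s)) + 16 * pi * R * E\<^sup>2 * (t - s) / K)"
proof -
  define b where "b = (\<lambda>x. 3 / 2 * (K * (2 / ((p + 1)\<^sup>2 - 4)) * (cum_bound\<^sup>2 + \<bar>x\<bar> + 3 * (p + 1) * virial_err * cum_bound * (t - s))
               + 16 * pi * R * E\<^sup>2 * (t - s) / K))"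
  have "(\<lambda>m. b (side_flux s t (real m))) \<longlonglongrightarrow> b 0"
    unfolding b_def by (intro tendsto_intros side_flux_tendsto)
  moreover have "R * integral {s + R..t} (massL2 (real n)) \<le> b (side_flux s t (real m))" if "m \<ge> n" for m
  proof -
    have "R * integral {s + R..t} (massL2 (real n)) \<le> R * integral {s + R..t} (massL2 (real m))"
      using R that by (intro mult_left_mono integral_le integrable_continuous_real massL2_cont massL2_mono) auto
    also have "\<dots> \<le> b (side_flux s t (real m))" unfolding b_def by (rule massL2_bound[OF st _ K]) simp
    finally show ?thesis .
  qed
  ultimately have "R * integral {s + R..t} (massL2 (real n)) \<le> b 0"
    by (intro LIMSEQ_le_const[where X="\<lambda>m. b (side_flux s t (real m))"]) auto
  then show ?thesis by (simp add: b_def)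
qed

lemma nn_integral_norm_Linf:
  assumes st: "s + R \<le> t" and K: "K > 0" and d: "\<delta> > 0" "\<delta>\<^sup>2 / (8 * E) \<le> R"
    and B: "\<And>n. R * integral {s + R..t} (massL2 (real n)) \<le> B"
  shows "(\<integral>\<^sup>+r\<in>{s + R..t}. norm_Linf (U r) \<partial>lborel)
     \<le> ennreal (\<delta> * (t - s - R) + sup_bound / (2 * R * (lower_mass \<delta>)\<^sup>2) * (B / R))"
proof -
  define A where "A = {s + R..t}"
  define k where "k = sup_bound / (2 * R * (lower_mass \<delta>)\<^sup>2)"
  have k: "0 \<le> k" using sup_bound_nonneg R by (simp add: k_def)
  have [measurable]: "massL2 n \<in> borel_measurable borel" for n by (rule borel_measurable_continuous_onI[OF massL2_cont])
  have B0: "0 \<le> B" using B[of 0] R integral_nonneg[of "massL2 0" "{s+R..t}"] massL2_nonneg[of 0]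
    by (metis integrable_continuous_real massL2_cont mult_nonneg_nonneg less_imp_le of_nat_0 order_trans)
  have one: "(\<integral>\<^sup>+r. ennreal (massL2 (real n) r) * indicator A r \<partial>lborel) \<le> ennreal (B / R)" for n
  proof -
    have l: "loc_integrable (massL2 (real n))" by (rule loc_integrableI_continuous[OF massL2_cont])
    have "(\<integral>\<^sup>+r. ennreal (massL2 (real n) r) * indicator A r \<partial>lborel) = (\<integral>\<^sup>+r. ennreal (indicator A r * massL2 (real n) r) \<partial>lborel)"
      by (intro nn_integral_cong) (auto simp: indicator_def)
    also have "\<dots> = ennreal (LBINT r. indicator A r * massL2 (real n) r)"
    proof (rule nn_integral_eq_integral)
      show "integrable lborel (\<lambda>r. indicator A r * massL2 (real n) r)"
        using loc_integrable_Icc[OF l, of "s + R" t] by (simp add: set_integrable_def A_def)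
    qed (use massL2_nonneg in auto)
    also have "\<dots> = ennreal (integral A (massL2 (real n)))" unfolding A_def loc_integrable_HK(2)[OF l] ..
    also have "\<dots> \<le> ennreal (B / R)" using B[of n] R by (intro ennreal_leI) (simp add: A_def pos_le_divide_eq mult.commute)
    finally show ?thesis .
  qed
  have "(\<integral>\<^sup>+r\<in>A. norm_Linf (U r) \<partial>lborel)
     \<le> (\<integral>\<^sup>+r. ennreal \<delta> * indicator A r + ennreal k * (SUP n. ennreal (massL2 (real n) r) * indicator A r) \<partial>lborel)"
  proof (intro nn_integral_mono)
    fix r
    show "norm_Linf (U r) * indicator A r \<le> ennreal \<delta> * indicator A r + ennreal k * (SUP n. ennreal (massL2 (real n) r) * indicator A r)"
      using norm_Linf_massL2[OF d, of r] by (auto simp: indicator_def k_def)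
  qed
  also have "\<dots> = (\<integral>\<^sup>+r. ennreal \<delta> * indicator A r \<partial>lborel) + (\<integral>\<^sup>+r. ennreal k * (SUP n. ennreal (massL2 (real n) r) * indicator A r) \<partial>lborel)"
    by (intro nn_integral_add) (auto simp: A_def)
  also have "(\<integral>\<^sup>+r. ennreal k * (SUP n. ennreal (massL2 (real n) r) * indicator A r) \<partial>lborel) = ennreal k * (\<integral>\<^sup>+r. (SUP n. ennreal (massL2 (real n) r) * indicator A r) \<partial>lborel)"
    by (intro nn_integral_cmult) (auto simp: A_def)
  also have "(\<integral>\<^sup>+r. (SUP n. ennreal (massL2 (real n) r) * indicator A r) \<partial>lborel) = (SUP n. \<integral>\<^sup>+r. ennreal (massL2 (real n) r) * indicator A r \<partial>lborel)"
  proof (rule nn_integral_monotone_convergence_SUP)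
    show "incseq (\<lambda>n r. ennreal (massL2 (real n) r) * indicator A r)"
      by (auto simp: incseq_def le_fun_def intro!: mult_right_mono ennreal_leI massL2_mono)
  qed (auto simp: A_def)
  also have "(\<integral>\<^sup>+r. ennreal \<delta> * indicator A r \<partial>lborel) = ennreal \<delta> * ennreal (t - s - R)"
    using st by (subst nn_integral_cmult) (auto simp: A_def diff_diff_eq)
  also have "\<dots> = ennreal (\<delta> * (t - s - R))" using d st by (intro ennreal_mult[symmetric]) auto
  also have "ennreal (\<delta> * (t - s - R)) + ennreal k * (SUP n. \<integral>\<^sup>+r. ennreal (massL2 (real n) r) * indicator A r \<partial>lborel)
     \<le> ennreal (\<delta> * (t - s - R)) + ennreal k * ennreal (B / R)"
    by (intro add_left_mono mult_left_mono SUP_least one) auto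
  also have "\<dots> = ennreal (\<delta> * (t - s - R) + k * (B / R))"
    using k B0 R d st by (simp add: ennreal_mult ennreal_plus del: times_divide_eq_right)
  finally show ?thesis by (simp add: A_def k_def)
qed

end

text \<open>The constant collects the uniform bound on \<open>U\<close> (\<open>M\<close>), the lower mass (\<open>l\<close>) and the right side of \<open>massL2_bound_limit\<close> with the powers
  of \<open>\<rho>\<close> removed. What matters is that it depends on \<open>p\<close>, \<open>E\<close> and \<open>\<delta>\<close> alone.\<close>

definition decay_const :: "real \<Rightarrow> real \<Rightarrow> real \<Rightarrow> real" where
  "decay_const p E \<delta> = (let M = 2 + 8 * E\<^sup>2 * (p + 1); l = 1 / 5 * pot p (\<delta> / 2) * (\<delta>\<^sup>2 / (8 * E)) in
     M / (4 * l\<^sup>2) * (3 / 2 * (2 / ((p + 1)\<^sup>2 - 4) * (4 * pi\<^sup>2 * E\<^sup>2 + 18 * pi * (p + 1) * (M / 2 * (pi + 4 * E)) * E) + 48 * pi * E\<^sup>2)))"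

context bounded_flow
begin

text \<open>Windows of width \<open>R = \<rho>^4\<close> and the splitting parameter \<open>K =
  \<rho>^(-3)\<close> balance the two terms of \<open>massL2_bound_limit\<close>; times \<open>T \<ge>
  \<rho>^6\<close> make the boundary term of the interaction identity, which does not grow with
  \<open>T\<close>, no larger than the others.\<close>

lemma avg_Linf_decay:
  assumes d: "\<delta> > 0" and \<rho>: "\<rho> \<ge> 1" "\<delta>\<^sup>2 / (8 * E) \<le> \<rho> ^ 4" and T: "\<rho> ^ 6 \<le> T"
  shows "avg_Linf U t0 T \<le> ennreal (\<delta> + decay_const p E \<delta> / \<rho>)"
proof -
  interpret windowed_flow p U w v E "\<rho> ^ 4" by unfold_locales (use \<rho> in simp)
  have r46: "\<rho> ^ 4 \<le> \<rho> ^ 6" using \<rho> by (intro power_increasing) auto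
  have T1: "1 \<le> T" using T \<rho> one_le_power[of \<rho> 6] by linarith
  \<comment> \<open>Starting one window earlier, the estimate covers the whole interval from \<open>t0 - T\<close> to \<open>t0 + T\<close>.\<close>
  define s where "s = t0 - T - \<rho> ^ 4"
  define t where "t = t0 + T"
  have ts: "t - s = 2 * T + \<rho> ^ 4" "t - s - \<rho> ^ 4 = 2 * T" "s + \<rho> ^ 4 = t0 - T" by (auto simp: s_def t_def)
  have ts3: "t - s \<le> 3 * T" using ts r46 T by linarith
  define K where "K = 1 / \<rho> ^ 3"
  have K: "K > 0" using \<rho> by (simp add: K_def)
  define v' where "v' = sup_bound / 2 * (pi + 4 * E)"
  have v0: "0 \<le> v'" using sup_bound_nonneg E_pos by (simp add: v'_def)
  have ve: "virial_err = v' * \<rho> ^ 2"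
  proof -
    have "\<rho> ^ 4 = (\<rho>\<^sup>2)\<^sup>2" by (simp flip: power_mult)
    then have "sqrt (\<rho> ^ 4) = \<rho>\<^sup>2" by (intro real_sqrt_unique) simp_all
    then show ?thesis by (simp add: virial_err_def v'_def)
  qed
  define q where "q = 2 / ((p + 1)\<^sup>2 - 4)"
  have q: "q \<ge> 0"
  proof -
    have "2\<^sup>2 < (p + 1)\<^sup>2" using p by (intro power_strict_mono) auto
    then show ?thesis by (simp add: q_def)
  qed
  define C where "C = 3 / 2 * (q * (4 * pi\<^sup>2 * E\<^sup>2 + 18 * pi * (p + 1) * v' * E) + 48 * pi * E\<^sup>2)"
  have C0: "0 \<le> C" unfolding C_def using q v0 E_pos p by (intro mult_nonneg_nonneg add_nonneg_nonneg) auto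
  have est: "3 / 2 * (K * (2 / ((p + 1)\<^sup>2 - 4)) * ((2 * pi * (\<rho> ^ 4)\<^sup>2 * E)\<^sup>2 + 3 * (p + 1) * virial_err * (2 * pi * (\<rho> ^ 4)\<^sup>2 * E) * (t - s)) + 16 * pi * \<rho> ^ 4 * E\<^sup>2 * (t - s) / K)
     \<le> C * \<rho> ^ 7 * T"
  proof -
    have 1: "(2 * pi * (\<rho> ^ 4)\<^sup>2 * E)\<^sup>2 \<le> (4 * pi\<^sup>2 * E\<^sup>2) * \<rho> ^ 10 * T"
    proof -
      have "(2 * pi * (\<rho> ^ 4)\<^sup>2 * E)\<^sup>2 = (4 * pi\<^sup>2 * E\<^sup>2) * \<rho> ^ 10 * \<rho> ^ 6"
        by (simp add: power_mult_distrib flip: power_mult power_add)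
      also have "\<dots> \<le> (4 * pi\<^sup>2 * E\<^sup>2) * \<rho> ^ 10 * T" using T \<rho> by (intro mult_left_mono) auto
      finally show ?thesis .
    qed
    have 2: "3 * (p + 1) * virial_err * (2 * pi * (\<rho> ^ 4)\<^sup>2 * E) * (t - s) \<le> (18 * pi * (p + 1) * v' * E) * \<rho> ^ 10 * T"
    proof -
      have "3 * (p + 1) * virial_err * (2 * pi * (\<rho> ^ 4)\<^sup>2 * E) * (t - s) = (6 * pi * (p + 1) * v' * E * \<rho> ^ 10) * (t - s)"
      proof -
        have "\<rho>\<^sup>2 * (\<rho> ^ 4)\<^sup>2 = \<rho> ^ 10" by (simp flip: power_mult power_add)
        then show ?thesis unfolding ve by (simp add: algebra_simps)
      qed
      also have "\<dots> \<le> (6 * pi * (p + 1) * v' * E * \<rho> ^ 10) * (3 * T)"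
        using ts3 v0 E_pos p \<rho> by (intro mult_left_mono mult_nonneg_nonneg) auto
      finally show ?thesis by (simp add: algebra_simps)
    qed
    have 3: "16 * pi * \<rho> ^ 4 * E\<^sup>2 * (t - s) / K \<le> (48 * pi * E\<^sup>2) * \<rho> ^ 7 * T"
    proof -
      have "16 * pi * \<rho> ^ 4 * E\<^sup>2 * (t - s) / K = (16 * pi * E\<^sup>2 * \<rho> ^ 7) * (t - s)"
      proof -
        have "\<rho> ^ 4 * \<rho> ^ 3 = \<rho> ^ 7" by (simp flip: power_add)
        then have e: "16 * pi * E\<^sup>2 * \<rho> ^ 7 = 16 * pi * \<rho> ^ 4 * E\<^sup>2 * \<rho> ^ 3" by (simp add: mult.assoc mult.left_commute)
        show ?thesis unfolding K_def e by simp
      qed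
      also have "\<dots> \<le> (16 * pi * E\<^sup>2 * \<rho> ^ 7) * (3 * T)" using ts3 \<rho> by (intro mult_left_mono mult_nonneg_nonneg) auto
      finally show ?thesis by (simp add: algebra_simps)
    qed
    have "K * q * ((2 * pi * (\<rho> ^ 4)\<^sup>2 * E)\<^sup>2 + 3 * (p + 1) * virial_err * (2 * pi * (\<rho> ^ 4)\<^sup>2 * E) * (t - s))
       \<le> K * q * ((4 * pi\<^sup>2 * E\<^sup>2) * \<rho> ^ 10 * T + (18 * pi * (p + 1) * v' * E) * \<rho> ^ 10 * T)"
      using K q by (intro mult_left_mono add_mono 1 2) auto
    also have "\<dots> = q * (4 * pi\<^sup>2 * E\<^sup>2 + 18 * pi * (p + 1) * v' * E) * \<rho> ^ 7 * T"
    proof -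
      have "K * \<rho> ^ 10 = \<rho> ^ 7"
      proof -
        have "\<rho> ^ 10 = \<rho> ^ 3 * \<rho> ^ 7" by (simp flip: power_add)
        then have "K * \<rho> ^ 10 = (K * \<rho> ^ 3) * \<rho> ^ 7" by (simp only: mult.assoc)
        also have "K * \<rho> ^ 3 = 1" using \<rho> by (simp add: K_def)
        finally show ?thesis by simp
      qed
      moreover have "K * q * ((4 * pi\<^sup>2 * E\<^sup>2) * \<rho> ^ 10 * T + (18 * pi * (p + 1) * v' * E) * \<rho> ^ 10 * T)
         = q * (4 * pi\<^sup>2 * E\<^sup>2 + 18 * pi * (p + 1) * v' * E) * (K * \<rho> ^ 10) * T" by (simp only: distrib_left distrib_right mult.assoc mult.commute mult.left_commute)
      ultimately show ?thesis by simp
    qed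
    finally have "K * q * ((2 * pi * (\<rho> ^ 4)\<^sup>2 * E)\<^sup>2 + 3 * (p + 1) * virial_err * (2 * pi * (\<rho> ^ 4)\<^sup>2 * E) * (t - s)) \<le> \<dots>" .
    then have "3 / 2 * (K * q * ((2 * pi * (\<rho> ^ 4)\<^sup>2 * E)\<^sup>2 + 3 * (p + 1) * virial_err * (2 * pi * (\<rho> ^ 4)\<^sup>2 * E) * (t - s)) + 16 * pi * \<rho> ^ 4 * E\<^sup>2 * (t - s) / K)
      \<le> 3 / 2 * (q * (4 * pi\<^sup>2 * E\<^sup>2 + 18 * pi * (p + 1) * v' * E) * \<rho> ^ 7 * T + (48 * pi * E\<^sup>2) * \<rho> ^ 7 * T)"
      by (intro mult_left_mono add_mono 3) auto
    also have "\<dots> = C * \<rho> ^ 7 * T" unfolding C_def by (simp only: distrib_left distrib_right mult.assoc)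
    finally show ?thesis by (simp only: q_def)
  qed
  have st: "s + \<rho> ^ 4 \<le> t" using ts T1 by linarith
  have B: "\<rho> ^ 4 * integral {s + \<rho> ^ 4..t} (massL2 (real n)) \<le> C * \<rho> ^ 7 * T" for n
    by (rule order_trans[OF massL2_bound_limit[OF st K] est])
  define l where "l = lower_mass \<delta>"
  have l: "l > 0" unfolding l_def by (rule lower_mass_pos[OF d])
  have "(\<integral>\<^sup>+r\<in>{t0 - T..t0 + T}. norm_Linf (U r) \<partial>lborel) \<le> ennreal (\<delta> * (2 * T) + sup_bound / (2 * \<rho> ^ 4 * l\<^sup>2) * (C * \<rho> ^ 7 * T / \<rho> ^ 4))"
    using nn_integral_norm_Linf[OF st K d \<rho>(2) B, unfolded ts(2,3), folded l_def] by (simp only: t_def)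
  also have "sup_bound / (2 * \<rho> ^ 4 * l\<^sup>2) * (C * \<rho> ^ 7 * T / \<rho> ^ 4) = (sup_bound / (4 * l\<^sup>2) * C / \<rho>) * (2 * T)"
  proof -
    have "\<rho> ^ 4 * \<rho> ^ 4 = \<rho> ^ 7 * \<rho>" by (simp flip: power_add power_Suc2)
    then have "sup_bound / (2 * \<rho> ^ 4 * l\<^sup>2) * (C * \<rho> ^ 7 * T / \<rho> ^ 4) = (sup_bound * C * T) * \<rho> ^ 7 / ((2 * l\<^sup>2 * \<rho>) * \<rho> ^ 7)"
      by (simp add: mult.assoc mult.commute mult.left_commute)
    also have "\<dots> = (sup_bound * C * T) / (2 * l\<^sup>2 * \<rho>)" using \<rho> by simp
    also have "\<dots> = (sup_bound / (4 * l\<^sup>2) * C / \<rho>) * (2 * T)" using \<rho> l by (simp add: field_simps)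
    finally show ?thesis .
  qed
  also have "\<delta> * (2 * T) + (sup_bound / (4 * l\<^sup>2) * C / \<rho>) * (2 * T) = (\<delta> + sup_bound / (4 * l\<^sup>2) * C / \<rho>) * (2 * T)"
    by (simp only: distrib_right)
  also have "sup_bound / (4 * l\<^sup>2) * C = decay_const p E \<delta>"
    unfolding decay_const_def Let_def C_def l_def lower_mass_def q_def v'_def sup_bound_def ..
  finally have I: "(\<integral>\<^sup>+r\<in>{t0 - T..t0 + T}. norm_Linf (U r) \<partial>lborel) \<le> ennreal ((\<delta> + decay_const p E \<delta> / \<rho>) * (2 * T))" .
  have "0 \<le> decay_const p E \<delta>"
    unfolding \<open>sup_bound / (4 * l\<^sup>2) * C = decay_const p E \<delta>\<close>[symmetric] using C0 sup_bound_nonneg by simp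
  then have D: "0 \<le> \<delta> + decay_const p E \<delta> / \<rho>" using d \<rho> by simp
  have "avg_Linf U t0 T \<le> ennreal ((\<delta> + decay_const p E \<delta> / \<rho>) * (2 * T)) / ennreal (2 * T)"
    unfolding avg_Linf_def by (intro divide_right_mono_ennreal I)
  also have "\<dots> = ennreal (\<delta> + decay_const p E \<delta> / \<rho>)"
    using D T1 by (subst divide_ennreal) auto
  finally show ?thesis .
qed

lemma avg_Linf_bounded:
  assumes T: "T > 0" shows "avg_Linf U t0 T \<le> ennreal (2 + 8 * E\<^sup>2 * (p + 1))"
proof -
  define M where "M = 2 + 8 * E\<^sup>2 * (p + 1)"
  have M: "0 \<le> M" using p by (simp add: M_def)
  have "norm_Linf (U r) \<le> ennreal M" for r
    unfolding norm_Linf_def using in_L2_meas[OF U_L2, of r] U_bound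
    by (intro esssup_I AE_I2 ennreal_leI) (auto simp: M_def)
  then have "(\<integral>\<^sup>+r\<in>{t0 - T..t0 + T}. norm_Linf (U r) \<partial>lborel) \<le> (\<integral>\<^sup>+r. ennreal M * indicator {t0 - T..t0 + T} r \<partial>lborel)"
    by (intro nn_integral_mono mult_right_mono) auto
  also have "\<dots> = ennreal M * ennreal (2 * T)" using T by (subst nn_integral_cmult) auto
  also have "\<dots> = ennreal (M * (2 * T))" using M T by (intro ennreal_mult[symmetric]) auto
  finally have "avg_Linf U t0 T \<le> ennreal (M * (2 * T)) / ennreal (2 * T)"
    unfolding avg_Linf_def by (rule divide_right_mono_ennreal)
  also have "\<dots> = ennreal M" using M T by (subst divide_ennreal) auto
  finally show ?thesis by (simp add: M_def)
qed

end

lemma finite_energy_solution_bounded_flow: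
  assumes p: "p > 1" and E: "E > 0" and sol: "finite_energy_solution p u" and en: "energy p u s \<le> E"
  obtains U w v where "bounded_flow p U w v E" "\<And>t0 T. avg_Linf u t0 T = avg_Linf U t0 T"
proof -
  obtain U where wf: "wave_flow p U (time_deriv u) (\<lambda>t. weak_deriv (u t))" and AE: "\<And>t. AE x in lborel. u t x = U t x"
    using finite_energy_solution_wave_flow[OF p sol] by blast
  interpret wave_flow p U "time_deriv u" "\<lambda>t. weak_deriv (u t)" by (rule wf)
  have um [measurable]: "u t \<in> borel_measurable borel" for t
    using sol by (auto simp: finite_energy_solution_def C1_L2_def intro: in_L2_meas)
  note [measurable] = in_L2_meas[OF U_L2] in_L2_meas[OF w_L2] in_L2_meas[OF v_L2]
  have [measurable]: "pot p \<in> borel_measurable borel" by (intro borel_measurable_continuous_onI pot_cont p)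
  have "energy p u s = (LBINT x. (time_deriv u s x)\<^sup>2 / 2 + (weak_deriv (u s) x)\<^sup>2 / 2 + pot p (U s x))"
    unfolding energy_def
  proof (rule integral_cong_AE)
    show "AE x in lborel. 1 / 2 * (time_deriv u s x)\<^sup>2 + 1 / 2 * (weak_deriv (u s) x)\<^sup>2 + 1 / (p + 1) * \<bar>u s x\<bar> powr (p + 1)
       = (time_deriv u s x)\<^sup>2 / 2 + (weak_deriv (u s) x)\<^sup>2 / 2 + pot p (U s x)"
      using AE[of s] by eventually_elim (simp add: pot_def)
  qed simp_all
  then have "(LBINT x. (time_deriv u t x)\<^sup>2 / 2 + (weak_deriv (u t) x)\<^sup>2 / 2 + pot p (U t x)) \<le> E" for t
    using en energy_const[of t s] by simp
  then have bf: "bounded_flow p U (time_deriv u) (\<lambda>t. weak_deriv (u t)) E"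
    by unfold_locales (use E in auto)
  have "norm_Linf (u t) = norm_Linf (U t)" for t
    unfolding norm_Linf_def by (rule esssup_AE_cong) (use AE[of t] in auto)
  then have "avg_Linf u t0 T = avg_Linf U t0 T" for t0 T by (simp add: avg_Linf_def)
  with bf show thesis using that by blast
qed

theorem theorem1p1:
  fixes p E :: real
  assumes "p > 1" and "E > 0"
  shows "(\<exists>c :: real \<Rightarrow> real. (\<forall>T>0. c T > 0) \<and> (c \<longlongrightarrow> 0) at_top \<and>
            (\<forall>u s. finite_energy_solution p u \<and> energy p u s \<le> E \<longrightarrow>
               (\<forall>t0 T. T > 0 \<longrightarrow> avg_Linf u t0 T \<le> ennreal (c T)))) \<and>
         (\<forall>u s. finite_energy_solution p u \<and> energy p u s \<le> E \<longrightarrow>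
            ((\<lambda>T. SUP t0. avg_Linf u t0 T) \<longlongrightarrow> 0) at_top)"
proof -
  \<comment> \<open>The smallest admissible bound is the supremum over all solutions and all centres; adding \<open>1 / T\<close> makes it positive.\<close>
  define S where "S = (\<lambda>T. Sup {a. \<exists>u s t0. finite_energy_solution p u \<and> energy p u s \<le> E \<and> a = avg_Linf u t0 T})"
  define c where "c = (\<lambda>T. enn2real (S T) + 1 / T)"
  have le_S: "avg_Linf u t0 T \<le> S T" if "finite_energy_solution p u" "energy p u s \<le> E" for u s t0 T
    unfolding S_def using that by (intro Sup_upper) blast
  have S_bound: "S T \<le> ennreal (2 + 8 * E\<^sup>2 * (p + 1))" if T: "T > 0" for T
    unfolding S_def
  proof (rule Sup_least, clarify)
    fix u s t0 assume "finite_energy_solution p u" "energy p u s \<le> E"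
    from finite_energy_solution_bounded_flow[OF assms this] obtain U w v
      where "bounded_flow p U w v E" and eq: "\<And>t0 T. avg_Linf u t0 T = avg_Linf U t0 T" by blast
    then interpret bounded_flow p U w v E by simp
    show "avg_Linf u t0 T \<le> ennreal (2 + 8 * E\<^sup>2 * (p + 1))" unfolding eq by (rule avg_Linf_bounded[OF T])
  qed
  have S_small: "\<forall>\<^sub>F T in at_top. S T \<le> ennreal e" if e: "e > 0" for e
  proof -
    define \<delta> where "\<delta> = e / 2"
    have d: "\<delta> > 0" using e by (simp add: \<delta>_def)
    define \<rho> where "\<rho> = max (max 1 (\<delta>\<^sup>2 / (8 * E))) (decay_const p E \<delta> / \<delta>)"
    have r: "\<rho> \<ge> 1" "\<delta>\<^sup>2 / (8 * E) \<le> \<rho>" "decay_const p E \<delta> / \<delta> \<le> \<rho>" by (auto simp: \<rho>_def)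
    have "\<rho> \<le> \<rho> ^ 4" using r(1) by (rule self_le_power) simp
    then have r4: "\<delta>\<^sup>2 / (8 * E) \<le> \<rho> ^ 4" using r(2) by linarith
    have small: "decay_const p E \<delta> / \<rho> \<le> \<delta>" using r(1,3) d by (simp add: divide_le_eq mult.commute)
    have "S T \<le> ennreal e" if T: "\<rho> ^ 6 \<le> T" for T
      unfolding S_def
    proof (rule Sup_least, clarify)
      fix u s t0 assume "finite_energy_solution p u" "energy p u s \<le> E"
      from finite_energy_solution_bounded_flow[OF assms this] obtain U w v
        where "bounded_flow p U w v E" and eq: "\<And>t0 T. avg_Linf u t0 T = avg_Linf U t0 T" by blast
      then interpret bounded_flow p U w v E by simp
      have "avg_Linf u t0 T \<le> ennreal (\<delta> + decay_const p E \<delta> / \<rho>)"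
        unfolding eq by (rule avg_Linf_decay[OF d r(1) r4 T])
      also have "\<dots> \<le> ennreal (\<delta> + \<delta>)" using small by (intro ennreal_leI) simp
      also have "\<delta> + \<delta> = e" by (simp add: \<delta>_def)
      finally show "avg_Linf u t0 T \<le> ennreal e" .
    qed
    then show ?thesis unfolding eventually_at_top_linorder by blast
  qed
  have S_fin: "S T < top" if "T > 0" for T
    by (rule le_less_trans[OF S_bound[OF that]]) simp
  have le_c: "S T \<le> ennreal (c T)" if "T > 0" for T
  proof -
    have "S T = ennreal (enn2real (S T))" using S_fin[OF that] by simp
    also have "\<dots> \<le> ennreal (c T)" using that by (intro ennreal_leI) (simp add: c_def)
    finally show ?thesis .
  qed
  have c_pos: "c T > 0" if "T > 0" for T
    using that unfolding c_def by (intro add_nonneg_pos) auto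
  have "((\<lambda>T. enn2real (S T)) \<longlongrightarrow> 0) at_top"
  proof (rule tendstoI)
    fix e :: real assume e: "e > 0"
    have "\<forall>\<^sub>F T in at_top. S T \<le> ennreal (e / 2)" by (rule S_small) (use e in simp)
    then show "\<forall>\<^sub>F T in at_top. dist (enn2real (S T)) 0 < e"
    proof eventually_elim
      case (elim T)
      have "enn2real (S T) \<le> e / 2" using elim e by (intro enn2real_leI) auto
      then show ?case using e by simp
    qed
  qed
  moreover have "((\<lambda>T::real. 1 / T) \<longlongrightarrow> 0) at_top" by real_asymp
  ultimately have c_lim: "(c \<longlongrightarrow> 0) at_top" unfolding c_def using tendsto_add[of _ 0 _ _ 0] by fastforce
  have "\<exists>c :: real \<Rightarrow> real. (\<forall>T>0. c T > 0) \<and> (c \<longlongrightarrow> 0) at_top \<and>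
            (\<forall>u s. finite_energy_solution p u \<and> energy p u s \<le> E \<longrightarrow>
               (\<forall>t0 T. T > 0 \<longrightarrow> avg_Linf u t0 T \<le> ennreal (c T)))"
  proof (intro exI[of _ c] conjI allI impI c_lim c_pos)
    fix u s t0 T assume "finite_energy_solution p u \<and> energy p u s \<le> E" "(T::real) > 0"
    then show "avg_Linf u t0 T \<le> ennreal (c T)" using le_S[of u s t0 T] le_c[of T] by (auto intro: order_trans)
  qed
  moreover have "((\<lambda>T. SUP t0. avg_Linf u t0 T) \<longlongrightarrow> 0) at_top" if u: "finite_energy_solution p u" "energy p u s \<le> E" for u s
  proof (rule tendsto_sandwich[OF _ _ tendsto_const])
    show "((\<lambda>T. ennreal (c T)) \<longlongrightarrow> 0) at_top" using tendsto_ennrealI[OF c_lim] by simp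
    show "\<forall>\<^sub>F T in at_top. (SUP t0. avg_Linf u t0 T) \<le> ennreal (c T)"
      using eventually_gt_at_top[of 0]
    proof eventually_elim
      case (elim T)
      show ?case by (rule SUP_least) (rule order_trans[OF le_S[OF u] le_c[OF elim]])
    qed
  qed simp
  ultimately show ?thesis by blast
qed

end
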